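(* There exists an absolute constant $C$ such that for all $\gamma,\beta\in(0,1)$ (and every $\delta>0$) there is a polynomial-time reduction from $SSE_\delta(1-\gamma,1-\beta)$ on (not necessarily regular) graphs $G=(V,E)$ to $SSE_\delta(1-\gamma,1-\beta/C)$ on $4$-regular graphs $G'=(V',E')$.
   Context: For a graph, $d(i)$ is the degree of vertex $i$, $\vol(S)=\sum_{i\in S}d(i)$, and $N=\vol(V)$. The expansion of a nonempty set $S$ is $\phi(S)=E(S,\bar S)/\vol(S)$, where $E(S,\bar S)$ is the number of edges crossing between $S$ and its complement. For $0<s<c<1$ and $\delta>0$, $SSE_\delta(c,s)$ is the promise problem of distinguishing between two cases: (YES) $G$ has a set of volume in $[\tfrac12\delta N,\delta N]$ with expansion less than $1-c$; (NO) every set of volume at most $\delta N$ has expansion at least $1-s$. A polynomial-time reduction from promise problem $P$ to promise problem $Q$ is a polynomial-time computable map $G\mapsto G'$ that sends YES instances of $P$ to YES instances of $Q$ and NO instances of $P$ to NO instances of $Q$. *)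

theory Defs
  imports
    Complex_Main
    "HOL-Computational_Algebra.Polynomial"
    "Graph_Theory.Pair_Digraph"
begin

section \<open>Volume and expansion\<close>

text \<open>
  Graphs are finite and simple (\<^locale>\<open>pair_graph\<close>): an undirected edge \<open>uv\<close> is the pair of arcs
  \<open>(u,v)\<close> and \<open>(v,u)\<close>. Hence the degree of a vertex is its out-degree, and the edges between \<open>S\<close>
  and its complement correspond to the arcs leaving \<open>S\<close>, each edge being counted once.
\<close>

definition vdeg :: "'a pair_pre_digraph \<Rightarrow> 'a \<Rightarrow> nat" where
  "vdeg G v = out_degree (with_proj G) v"

definition vol :: "'a pair_pre_digraph \<Rightarrow> 'a set \<Rightarrow> nat" where
  "vol G S = (\<Sum>v\<in>S. vdeg G v)"

definition crossing :: "'a pair_pre_digraph \<Rightarrow> 'a set \<Rightarrow> nat" where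
  "crossing G S = card {(u, v) \<in> parcs G. u \<in> S \<and> v \<in> pverts G - S}"

definition expansion :: "'a pair_pre_digraph \<Rightarrow> 'a set \<Rightarrow> real" where
  "expansion G S = real (crossing G S) / real (vol G S)"

text \<open>
  The vertex sets that have an expansion: sets of isolated vertices have volume 0, and for them the
  quotient is undefined.
\<close>

definition expansion_sets :: "'a pair_pre_digraph \<Rightarrow> 'a set set" where
  "expansion_sets G = {S. S \<subseteq> pverts G \<and> S \<noteq> {} \<and> vol G S > 0}"

definition regular :: "nat \<Rightarrow> 'a pair_pre_digraph \<Rightarrow> bool" where
  "regular d G \<longleftrightarrow> (\<forall>v\<in>pverts G. vdeg G v = d)"


section \<open>Small set expansion as a promise problem\<close>

text \<open>
  Every instance in \<open>instances\<close> is an admissible input; the promise is that it lies in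
  \<open>yes_set\<close> or in \<open>no_set\<close>.
\<close>

record 'a promise_problem =
  instances :: "'a set"
  yes_set :: "'a set"
  no_set :: "'a set"

definition SSE :: "'a pair_pre_digraph set \<Rightarrow> real \<Rightarrow> real \<Rightarrow> real \<Rightarrow> 'a pair_pre_digraph promise_problem"
  where "SSE \<G> \<delta> c s = \<lparr>
    instances = \<G>,
    yes_set = {G \<in> \<G>. \<exists>S \<in> expansion_sets G.
      \<delta> * real (vol G (pverts G)) / 2 \<le> real (vol G S) \<and>
      real (vol G S) \<le> \<delta> * real (vol G (pverts G)) \<and>
      expansion G S < 1 - c},
    no_set = {G \<in> \<G>. \<forall>S \<in> expansion_sets G.
      real (vol G S) \<le> \<delta> * real (vol G (pverts G)) \<longrightarrow> expansion G S \<ge> 1 - s} \<rparr>"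

text \<open>
  As inputs of algorithms, graphs have the vertex set \<open>{0, \<dots>, n - 1}\<close>. The null graph is included,
  as it is in \<^locale>\<open>pair_graph\<close>.
\<close>

definition input_graphs :: "nat pair_pre_digraph set" where
  "input_graphs = {G. pair_graph G \<and> (\<exists>n. pverts G = {..<n})}"

definition regular_input_graphs :: "nat \<Rightarrow> nat pair_pre_digraph set" where
  "regular_input_graphs d = {G \<in> input_graphs. regular d G}"

text \<open>The number of vertices in unary, a separator, and the adjacency matrix row by row.\<close>

definition encode_graph :: "nat pair_pre_digraph \<Rightarrow> bool list" where
  "encode_graph G = (let n = card (pverts G) in
     replicate n True @ [False] @
     concat (map (\<lambda>i. map (\<lambda>j. (i, j) \<in> parcs G) [0..<n]) [0..<n]))"


section \<open>Deterministic multi-tape Turing machines\<close>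

datatype move = MLeft | MStay | MRight

text \<open>
  States are \<open>0, \<dots>, tm_states - 1\<close>, where \<open>0\<close> is initial and \<open>1\<close> is halting. Symbols are
  \<open>0, \<dots>, tm_symbols - 1\<close>, where \<open>0\<close> is the blank and \<open>1\<close>, \<open>2\<close> represent the bits. The transition
  function maps the state and the scanned symbols (one for each tape) to the new state and, for
  each tape, the symbol written and the head movement.
\<close>

record tm =
  tm_tapes :: nat
  tm_states :: nat
  tm_symbols :: nat
  tm_trans :: "nat \<Rightarrow> nat list \<Rightarrow> nat \<times> (nat \<times> move) list"

definition wf_tm :: "tm \<Rightarrow> bool" where
  "wf_tm M \<longleftrightarrow> tm_tapes M \<ge> 1 \<and> tm_states M \<ge> 2 \<and> tm_symbols M \<ge> 3 \<and>
     (\<forall>q < tm_states M. \<forall>as. length as = tm_tapes M \<and> set as \<subseteq> {..<tm_symbols M} \<longrightarrow>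
        (case tm_trans M q as of (q', acts) \<Rightarrow>
           q' < tm_states M \<and> length acts = tm_tapes M \<and>
           fst ` set acts \<subseteq> {..<tm_symbols M}))"

text \<open>A tape, infinite in both directions, consists of its contents and the head position.\<close>

type_synonym tape = "(int \<Rightarrow> nat) \<times> int"

type_synonym tm_config = "nat \<times> tape list"

fun scanned :: "tape \<Rightarrow> nat" where
  "scanned (f, h) = f h"

fun head_shift :: "move \<Rightarrow> int" where
  "head_shift MLeft = - 1"
| "head_shift MStay = 0"
| "head_shift MRight = 1"

fun tape_act :: "nat \<times> move \<Rightarrow> tape \<Rightarrow> tape" where
  "tape_act (a, m) (f, h) = (f(h := a), h + head_shift m)"

fun tm_step :: "tm \<Rightarrow> tm_config \<Rightarrow> tm_config" where
  "tm_step M (q, tps) =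
     (if q = 1 then (q, tps)
      else case tm_trans M q (map scanned tps) of (q', acts) \<Rightarrow> (q', map2 tape_act acts tps))"

definition word_contents :: "bool list \<Rightarrow> int \<Rightarrow> nat" where
  "word_contents w p =
     (if 0 \<le> p \<and> p < int (length w) then (if w ! nat p then 2 else 1) else 0)"

text \<open>
  The input word is on the first tape, with the head on its first symbol, and all other tapes are
  blank. On halting, the last tape has to hold the output word starting at cell \<open>0\<close>, and nothing
  else.
\<close>

definition tm_init :: "tm \<Rightarrow> bool list \<Rightarrow> tm_config" where
  "tm_init M w =
     (0, (word_contents w, 0) # replicate (tm_tapes M - 1) (word_contents [], 0))"

definition tm_outputs_within :: "tm \<Rightarrow> bool list \<Rightarrow> bool list \<Rightarrow> nat \<Rightarrow> bool" where
  "tm_outputs_within M w v t \<longleftrightarrow>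
     (\<exists>k \<le> t. case (tm_step M ^^ k) (tm_init M w) of (q, tps) \<Rightarrow>
        q = 1 \<and> fst (last tps) = word_contents v)"


section \<open>Polynomial-time reductions\<close>

definition polytime_map ::
    "('a \<Rightarrow> bool list) \<Rightarrow> ('b \<Rightarrow> bool list) \<Rightarrow> 'a set \<Rightarrow> ('a \<Rightarrow> 'b) \<Rightarrow> bool" where
  "polytime_map enc_in enc_out D f \<longleftrightarrow>
     (\<exists>M (p :: nat poly). wf_tm M \<and>
        (\<forall>x \<in> D. tm_outputs_within M (enc_in x) (enc_out (f x)) (poly p (length (enc_in x)))))"

definition polytime_reduction ::
    "('a \<Rightarrow> bool list) \<Rightarrow> ('b \<Rightarrow> bool list) \<Rightarrow> 'a promise_problem \<Rightarrow> 'b promise_problem \<Rightarrow>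
     ('a \<Rightarrow> 'b) \<Rightarrow> bool" where
  "polytime_reduction enc_in enc_out P Q f \<longleftrightarrow>
     polytime_map enc_in enc_out (instances P) f \<and>
     f ` instances P \<subseteq> instances Q \<and>
     f ` yes_set P \<subseteq> yes_set Q \<and>
     f ` no_set P \<subseteq> no_set Q"

end

(*
Every vertex u is replaced by a cluster of 4 * deg u points, four for each arc with tail u, that carries a
constant-degree expander; points of opposite arcs are joined, and every point is blown up to a
twelve-vertex gadget that makes the graph simple and 4-regular. Unions of clusters have the same relative
volume and a smaller expansion. Conversely a badly expanding set of the new graph is close to a union of
clusters, which comes from a badly expanding set S of the old graph. The volume of S may exceed the
threshold slightly; then S can be trimmed, unless the whole graph has bounded size, in which case the
reduction decides the instance by brute force. This works if no instance satisfies both promises. Otherwise,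
beta < gamma and delta < 1, and a constant map to a graph satisfying both promises is a reduction.

The expanders live on an n by n torus: after a Fourier transform, almost invariance under translations
concentrates the mass near 0, where the linear shears act by ping-pong on two cones.

Polynomial time is obtained from a small expression language with bounded sums, in which the adjacency
matrix of the new graph is definable, and a compiler from this language to multi-tape Turing machines.
*)

theory Submission
  imports Defs
begin

section \<open>Expansion of the affine maps on the discrete torus\<close>

text \<open>Rounding shapes the construction: a set of the new graph yields a set of the old graph
  whose volume is only close to its own, and just above the bound the NO promise is silent. The
  brute-force step is one-sided. The YES direction holds in every size, so only small graphs that
  are not YES instances are replaced, by the null graph, which is vacuously a NO instance. For a
  bounded volume finitely many triples of total volume, set volume and crossing number occur; hence
  the real parameters act through a finite table built into the machine, whatever their values. The
  case left open is a small graph meeting both promises: being a YES instance it is not replaced,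
  and nothing protects its NO promise. Such a graph exists only if \<beta> < \<gamma> and \<delta> <
  1. Degrees are arbitrary, so expanders are required in all sizes 4 deg(u), while the torus
  provides squares only. Four points for each arc guarantee that a nonempty cluster has at least
  four points, and then the largest square inside it covers at least half of it. All losses are
  factors independent of \<beta>, \<gamma>, \<delta>, so that a single constant suffices.\<close>

definition ch :: "nat \<Rightarrow> int \<Rightarrow> complex" where
  "ch n k = cis (2 * pi * of_int k / of_nat n)"

text \<open>Functions on Z/n are modelled as periodic functions on the integers: translations and
  shears are then written without reduction modulo n, and sums may run over any window of length
  n.\<close>

definition periodic :: "nat \<Rightarrow> (int \<Rightarrow> 'a) \<Rightarrow> bool" where
  "periodic n f \<longleftrightarrow> (\<forall>x. f (x mod int n) = f x)"

lemma periodicD: "periodic n f \<Longrightarrow> f (x mod int n) = f x"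
  by (simp add: periodic_def)

lemma periodic_cong: "periodic n f \<Longrightarrow> x mod int n = y mod int n \<Longrightarrow> f x = f y"
  by (metis periodic_def)

lemma periodicI:
  assumes "\<And>x y. x mod int n = y mod int n \<Longrightarrow> f x = f y"
  shows "periodic n f"
  unfolding periodic_def by (intro allI assms) simp

section \<open>Additive characters modulo n, periodic sums and orthogonality\<close>

lemma ch_add: "ch n (k + l) = ch n k * ch n l"
  by (simp add: ch_def cis_mult add_divide_distrib distrib_left)

lemma ch_0 [simp]: "ch n 0 = 1"
  by (simp add: ch_def)

lemma norm_ch [simp]: "norm (ch n k) = 1"
  by (simp add: ch_def)

lemma cnj_ch: "cnj (ch n k) = ch n (- k)"
  by (simp add: ch_def cis_cnj)

lemma ch_eq_1_iff:
  assumes "n > 0"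
  shows "ch n k = 1 \<longleftrightarrow> int n dvd k"
proof
  assume "ch n k = 1"
  then have "cos (2 * pi * of_int k / of_nat n) = 1"
    by (simp add: ch_def complex_eq_iff)
  then obtain j :: int where "2 * pi * of_int k / of_nat n = of_int j * 2 * pi"
    by (auto simp: cos_one_2pi_int)
  then have "of_int k = (of_int (j * int n) :: real)"
    using assms by (simp add: field_simps)
  then show "int n dvd k" by (simp only: of_int_eq_iff) simp
next
  assume "int n dvd k"
  then obtain j where "k = int n * j" by blast
  then have "2 * pi * of_int k / of_nat n = 2 * pi * of_int j"
    using assms by simp
  then show "ch n k = 1" by (simp add: ch_def complex_eq_iff cos_int_2pin sin_int_2pin)
qed

lemma periodic_ch:
  assumes "n > 0"
  shows "periodic n (\<lambda>x. ch n (k * x + l))"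
proof (rule periodicI)
  fix x y assume "x mod int n = y mod int n"
  then have "int n dvd k * (x - y)" by (simp add: mod_eq_dvd_iff)
  then have "ch n (k * (x - y)) = 1" using assms ch_eq_1_iff by blast
  moreover have "k * x + l = (k * y + l) + k * (x - y)" by (simp add: algebra_simps)
  ultimately show "ch n (k * x + l) = ch n (k * y + l)" by (simp only: ch_add mult_1_right)
qed

text \<open>Two shifts are combined: \<open>c\<close> moves the window, as required for a
  fundamental domain centred at 0, and \<open>d\<close> moves the argument, as required for
  translations and shears.\<close>

lemma sum_periodic_shift:
  fixes f :: "int \<Rightarrow> 'a :: comm_monoid_add"
  assumes "n > 0" "periodic n f"
  shows "(\<Sum>x\<in>{c..<c + int n}. f (x + d)) = (\<Sum>x\<in>{0..<int n}. f x)"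
proof (rule sum.reindex_bij_witness[where i = "\<lambda>y. (y - d - c) mod int n + c" and j = "\<lambda>x. (x + d) mod int n"])
  fix x assume x: "x \<in> {c..<c + int n}"
  have "((x + d) mod int n - d - c) mod int n = ((x + d) mod int n - (d + c)) mod int n"
    by (simp add: diff_diff_eq)
  also have "\<dots> = (x + d - (d + c)) mod int n" by (rule mod_diff_left_eq)
  also have "x + d - (d + c) = x - c" by simp
  also have "(x - c) mod int n = x - c" using x by (intro mod_pos_pos_trivial) auto
  finally show "((x + d) mod int n - d - c) mod int n + c = x" by simp
  show "f ((x + d) mod int n) = f (x + d)" using assms(2) by (rule periodicD)
next
  fix y assume y: "y \<in> {0..<int n}"
  have "((y - d - c) mod int n + c + d) mod int n = ((y - d - c) mod int n + (c + d)) mod int n"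
    by (simp add: add.assoc)
  also have "\<dots> = (y - d - c + (c + d)) mod int n" by (rule mod_add_left_eq)
  also have "y - d - c + (c + d) = y" by simp
  finally have "((y - d - c) mod int n + c + d) mod int n = y mod int n" .
  then show "((y - d - c) mod int n + c + d) mod int n = y" using y by simp
qed (use assms in \<open>auto simp: add.commute\<close>)

lemma sum_periodic_shift0:
  fixes f :: "int \<Rightarrow> 'a :: comm_monoid_add"
  assumes "n > 0" "periodic n f"
  shows "(\<Sum>x\<in>{0..<int n}. f (x + d)) = (\<Sum>x\<in>{0..<int n}. f x)"
  using sum_periodic_shift[OF assms, where c = 0 and d = d] unfolding add_0 .

text \<open>Replacing x by x + 1 leaves the sum unchanged but multiplies it by
  \<open>ch n k\<close>, so it vanishes unless this factor is 1.\<close>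

lemma sum_ch:
  assumes "n > 0"
  shows "(\<Sum>x\<in>{0..<int n}. ch n (k * x)) = (if int n dvd k then of_nat n else 0)"
proof (cases "int n dvd k")
  case True
  then have "ch n (k * x) = 1" for x using ch_eq_1_iff[OF assms] by simp
  then show ?thesis using True by simp
next
  case False
  let ?S = "\<Sum>x\<in>{0..<int n}. ch n (k * x)"
  have "?S = (\<Sum>x\<in>{0..<int n}. ch n (k * (x + 1)))"
    using sum_periodic_shift0[OF assms periodic_ch[OF assms, of k 0], of 1] by simp
  also have "\<dots> = ch n k * ?S"
    by (simp add: distrib_left ch_add sum_distrib_left mult.commute)
  finally have "(ch n k - 1) * ?S = 0" by (simp add: algebra_simps)
  then show ?thesis using False ch_eq_1_iff[OF assms] by simp
qed

lemma parseval1: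
  assumes "n > 0"
  shows "(\<Sum>a\<in>{0..<int n}. (norm (\<Sum>x\<in>{0..<int n}. g x * ch n (a * x)))\<^sup>2) =
    real n * (\<Sum>x\<in>{0..<int n}. (norm (g x))\<^sup>2)"
proof -
  let ?I = "{0..<int n}"
  have "complex_of_real (\<Sum>a\<in>?I. (norm (\<Sum>x\<in>?I. g x * ch n (a * x)))\<^sup>2) =
     (\<Sum>a\<in>?I. (\<Sum>x\<in>?I. g x * ch n (a * x)) * cnj (\<Sum>x\<in>?I. g x * ch n (a * x)))"
    by (simp only: of_real_sum complex_norm_square)
  also have "\<dots> = (\<Sum>a\<in>?I. \<Sum>x\<in>?I. \<Sum>y\<in>?I. g x * cnj (g y) * ch n ((x - y) * a))"
  proof (rule sum.cong[OF refl])
    fix a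
    have "(\<Sum>x\<in>?I. g x * ch n (a * x)) * cnj (\<Sum>x\<in>?I. g x * ch n (a * x)) =
      (\<Sum>x\<in>?I. \<Sum>y\<in>?I. (g x * ch n (a * x)) * (cnj (g y) * ch n (- (a * y))))"
      by (simp add: sum_product cnj_ch)
    also have "\<dots> = (\<Sum>x\<in>?I. \<Sum>y\<in>?I. g x * cnj (g y) * ch n ((x - y) * a))"
    proof (intro sum.cong refl)
      fix x y
      have "(x - y) * a = a * x + - (a * y)" by (simp add: algebra_simps)
      then show "(g x * ch n (a * x)) * (cnj (g y) * ch n (- (a * y))) = g x * cnj (g y) * ch n ((x - y) * a)"
        by (simp only: ch_add) simp
    qed
    finally show "(\<Sum>x\<in>?I. g x * ch n (a * x)) * cnj (\<Sum>x\<in>?I. g x * ch n (a * x)) = \<dots>" .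
  qed
  also have "\<dots> = (\<Sum>x\<in>?I. \<Sum>y\<in>?I. \<Sum>a\<in>?I. g x * cnj (g y) * ch n ((x - y) * a))"
    by (rule trans[OF sum.swap], rule sum.cong[OF refl], rule sum.swap)
  also have "\<dots> = (\<Sum>x\<in>?I. \<Sum>y\<in>?I. if y = x then g x * cnj (g x) * of_nat n else 0)"
  proof (intro sum.cong refl)
    fix x y assume xy: "x \<in> ?I" "y \<in> ?I"
    have "int n dvd x - y \<longleftrightarrow> y = x"
      using xy by (auto simp: mod_eq_dvd_iff[symmetric])
    then show "(\<Sum>a\<in>?I. g x * cnj (g y) * ch n ((x - y) * a)) = (if y = x then g x * cnj (g x) * of_nat n else 0)"
      by (auto simp: sum_ch[OF assms] simp flip: sum_distrib_left)
  qed
  also have "\<dots> = (\<Sum>x\<in>?I. complex_of_real ((norm (g x))\<^sup>2 * real n))"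
    by (intro sum.cong refl) (simp only: of_real_mult complex_norm_square, simp)
  also have "\<dots> = complex_of_real (real n * (\<Sum>x\<in>?I. (norm (g x))\<^sup>2))"
    by (simp add: sum_distrib_left mult.commute)
  finally show ?thesis by (simp only: of_real_eq_iff)
qed

section \<open>The Fourier transform on the discrete torus and its behaviour under translations and
  shears\<close>

definition dft :: "nat \<Rightarrow> (int \<Rightarrow> int \<Rightarrow> complex) \<Rightarrow> int \<Rightarrow> int \<Rightarrow> complex" where
  "dft n f a b = (\<Sum>x\<in>{0..<int n}. \<Sum>y\<in>{0..<int n}. f x y * ch n (a * x + b * y))"

definition sqnorm :: "nat \<Rightarrow> (int \<Rightarrow> int \<Rightarrow> complex) \<Rightarrow> real" where
  "sqnorm n f = (\<Sum>x\<in>{0..<int n}. \<Sum>y\<in>{0..<int n}. (norm (f x y))\<^sup>2)"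

lemma parseval2:
  assumes "n > 0"
  shows "sqnorm n (dft n f) = (real n)\<^sup>2 * sqnorm n f"
proof -
  let ?I = "{0..<int n}"
  let ?g = "\<lambda>a y. \<Sum>x\<in>?I. f x y * ch n (a * x)"
  have "dft n f a b = (\<Sum>y\<in>?I. ?g a y * ch n (b * y))" for a b
    unfolding dft_def by (rule trans[OF sum.swap]) (simp add: ch_add sum_distrib_right mult.assoc)
  then have "sqnorm n (dft n f) = (\<Sum>a\<in>?I. \<Sum>b\<in>?I. (norm (\<Sum>y\<in>?I. ?g a y * ch n (b * y)))\<^sup>2)"
    unfolding sqnorm_def by simp
  also have "\<dots> = (\<Sum>a\<in>?I. real n * (\<Sum>y\<in>?I. (norm (?g a y))\<^sup>2))"
    by (simp only: parseval1[OF assms])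
  also have "\<dots> = real n * (\<Sum>y\<in>?I. \<Sum>a\<in>?I. (norm (?g a y))\<^sup>2)"
    by (simp only: sum_distrib_left[symmetric]) (simp only: sum.swap[of _ ?I ?I, where g = "\<lambda>a y. (norm (?g a y))\<^sup>2"])
  also have "\<dots> = real n * (\<Sum>y\<in>?I. real n * (\<Sum>x\<in>?I. (norm (f x y))\<^sup>2))"
    by (simp only: parseval1[OF assms])
  also have "\<dots> = (real n)\<^sup>2 * (\<Sum>y\<in>?I. \<Sum>x\<in>?I. (norm (f x y))\<^sup>2)"
    by (simp add: sum_distrib_left power2_eq_square mult.assoc)
  also have "(\<Sum>y\<in>?I. \<Sum>x\<in>?I. (norm (f x y))\<^sup>2) = sqnorm n f"
    unfolding sqnorm_def by (rule sum.swap)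
  finally show ?thesis .
qed

definition periodic2 :: "nat \<Rightarrow> (int \<Rightarrow> int \<Rightarrow> 'a) \<Rightarrow> bool" where
  "periodic2 n f \<longleftrightarrow> (\<forall>y. periodic n (\<lambda>x. f x y)) \<and> (\<forall>x. periodic n (f x))"

lemma periodic2I:
  assumes "\<And>x y x' y'. x mod int n = x' mod int n \<Longrightarrow> y mod int n = y' mod int n \<Longrightarrow> f x y = f x' y'"
  shows "periodic2 n f"
  unfolding periodic2_def by (intro conjI allI periodicI assms refl)

lemma periodic2_cong:
  assumes "periodic2 n f" "x mod int n = x' mod int n" "y mod int n = y' mod int n"
  shows "f x y = f x' y'"
  using assms periodic_cong[of n "\<lambda>x. f x y" x x'] periodic_cong[of n "f x'" y y']
  unfolding periodic2_def by simp

lemma periodic2_dft: "n > 0 \<Longrightarrow> periodic2 n (dft n f)"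
  unfolding periodic2_def dft_def periodic_def
proof (intro conjI allI sum.cong refl)
  fix x y a b :: int assume n: "n > 0"
  show "f x y * ch n (a mod int n * x + b * y) = f x y * ch n (a * x + b * y)"
    using periodicD[OF periodic_ch[OF n, of x "b * y"], of a] by (simp add: mult.commute)
  show "f x y * ch n (a * x + b mod int n * y) = f x y * ch n (a * x + b * y)"
    using periodicD[OF periodic_ch[OF n, of y "a * x"], of b] by (simp add: mult.commute add.commute)
qed

lemma dft_transpose: "dft n (\<lambda>x y. f y x) a b = dft n f b a"
  unfolding dft_def by (rule trans[OF sum.swap]) (simp add: add.commute)

lemma dft_diff: "dft n (\<lambda>x y. f x y - g x y) a b = dft n f a b - dft n g a b"
  by (simp add: dft_def left_diff_distrib sum_subtractf)

text \<open>A translation only rotates phases. If f is almost invariant under it, the transform is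
  small wherever the phase is far from 1.\<close>

lemma dft_translate:
  assumes "n > 0" "periodic2 n f"
  shows "dft n (\<lambda>x y. f (x + 1) y) a b = ch n (- a) * dft n f a b"
proof -
  let ?I = "{0..<int n}"
  let ?F = "\<lambda>x. \<Sum>y\<in>?I. f x y * ch n (a * x + b * y)"
  have "periodic n ?F"
  proof (rule periodicI, intro sum.cong refl)
    fix x x' y assume x: "x mod int n = x' mod int n"
    then have "f x y = f x' y" by (rule periodic2_cong[OF assms(2)]) simp
    then show "f x y * ch n (a * x + b * y) = f x' y * ch n (a * x' + b * y)"
      using periodic_cong[OF periodic_ch[OF assms(1)] x, of a "b * y"] by simp
  qed
  from sum_periodic_shift0[OF assms(1) this, of 1]
  have "dft n f a b = (\<Sum>x\<in>?I. \<Sum>y\<in>?I. f (x + 1) y * ch n (a * (x + 1) + b * y))"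
    unfolding dft_def by (rule sym)
  also have "\<dots> = (\<Sum>x\<in>?I. \<Sum>y\<in>?I. ch n a * (f (x + 1) y * ch n (a * x + b * y)))"
  proof (intro sum.cong refl)
    fix x y :: int
    have "a * (x + 1) + b * y = a + (a * x + b * y)" by (simp add: algebra_simps)
    then show "f (x + 1) y * ch n (a * (x + 1) + b * y) = ch n a * (f (x + 1) y * ch n (a * x + b * y))"
      by (simp only: ch_add[of n a]) simp
  qed
  also have "\<dots> = ch n a * dft n (\<lambda>x y. f (x + 1) y) a b"
    by (simp only: dft_def sum_distrib_left)
  finally have "ch n (- a) * dft n f a b = (ch n (- a) * ch n a) * dft n (\<lambda>x y. f (x + 1) y) a b"
    by simp
  also have "ch n (- a) * ch n a = 1" by (simp flip: ch_add)
  finally show ?thesis by simp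
qed

text \<open>Substituting x for x + 2y shows that a shear permutes the frequencies. If f is almost
  invariant under it, the squared modulus of the transform is an almost invariant mass on the dual
  torus.\<close>

lemma dft_shear:
  assumes "n > 0" "periodic2 n f"
  shows "dft n (\<lambda>x y. f (x + 2 * y) y) a b = dft n f a (b - 2 * a)"
proof -
  let ?I = "{0..<int n}"
  have "(\<Sum>x\<in>?I. f (x + 2 * y) y * ch n (a * x + b * y)) =
      (\<Sum>x\<in>?I. f x y * ch n (a * x + (b - 2 * a) * y))" for y
  proof -
    have "periodic n (\<lambda>x. f x y * ch n (a * x + (b - 2 * a) * y))"
    proof (rule periodicI)
      fix x x' assume x: "x mod int n = x' mod int n"
      then have "f x y = f x' y" by (rule periodic2_cong[OF assms(2)]) simp
      then show "f x y * ch n (a * x + (b - 2 * a) * y) = f x' y * ch n (a * x' + (b - 2 * a) * y)"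
        using periodic_cong[OF periodic_ch[OF assms(1)] x, of a "(b - 2 * a) * y"] by simp
    qed
    from sum_periodic_shift0[OF assms(1) this, of "2 * y"] show ?thesis
      by (simp add: algebra_simps)
  qed
  then have "(\<Sum>y\<in>?I. \<Sum>x\<in>?I. f (x + 2 * y) y * ch n (a * x + b * y)) =
      (\<Sum>y\<in>?I. \<Sum>x\<in>?I. f x y * ch n (a * x + (b - 2 * a) * y))" by simp
  then show ?thesis unfolding dft_def
    by (rule trans[OF sum.swap trans[OF _ sum.swap]])
qed


subsection \<open>Ping-pong on the dual torus\<close>

text \<open>
  The shears map the cone \<open>\<bar>a\<bar> > \<bar>b\<bar>\<close> (away from the boundary of the fundamental domain) into the cone
  \<open>\<bar>a\<bar> < \<bar>b\<bar>\<close> in two disjoint ways, and vice versa, so no mass can be almost invariant near 0.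
\<close>

definition fdom :: "nat \<Rightarrow> int set" where
  "fdom n = {- ((int n - 1) div 2) ..< - ((int n - 1) div 2) + int n}"

lemma fdom_iff: "x \<in> fdom n \<longleftrightarrow> - int n < 2 * x \<and> 2 * x \<le> int n"
  unfolding fdom_def by auto

lemma finite_fdom [simp]: "finite (fdom n)"
  by (simp add: fdom_def)

lemma sum_fdom:
  fixes f :: "int \<Rightarrow> 'a :: comm_monoid_add"
  assumes "n > 0" "periodic n f"
  shows "(\<Sum>x\<in>fdom n. f (x + d)) = (\<Sum>x\<in>{0..<int n}. f x)"
  unfolding fdom_def by (rule sum_periodic_shift[OF assms])

text \<open>The frequencies at which one of the two unit translations turns the phase by at least
  \<pi>/4; their mass is controlled by the translations alone.\<close>

definition far :: "nat \<Rightarrow> (int \<times> int) set" where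
  "far n = {(a, b) \<in> fdom n \<times> fdom n. int n \<le> 8 * \<bar>a\<bar> \<or> int n \<le> 8 * \<bar>b\<bar>}"

text \<open>The bound n/8 gives \<bar>b + 2a\<bar>, \<bar>b - 2a\<bar> < 3n/8, so that both shear
  images lie in \<open>fdom n\<close> without reduction modulo n.\<close>

definition cone :: "nat \<Rightarrow> (int \<times> int) set" where
  "cone n = {(a, b) \<in> fdom n \<times> fdom n. 8 * \<bar>a\<bar> < int n \<and> 8 * \<bar>b\<bar> < int n \<and> \<bar>b\<bar> < \<bar>a\<bar>}"

definition diag :: "nat \<Rightarrow> (int \<times> int) set" where
  "diag n = {(a, b) \<in> fdom n \<times> fdom n. 8 * \<bar>a\<bar> < int n \<and> 8 * \<bar>b\<bar> < int n \<and> \<bar>b\<bar> = \<bar>a\<bar> \<and> a \<noteq> 0}"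

text \<open>\<open>E\<close> bounds the total change of the mass under a shear, so a set and its
  image differ in mass by at most \<open>E\<close>. Both images of the cone are disjoint and lie in
  the swapped cone or in the far region, which forces twice the mass of the cone into these two
  sets.\<close>

lemma cone_shear_bound:
  fixes \<mu> :: "int \<times> int \<Rightarrow> real"
  assumes nonneg: "\<And>z. \<mu> z \<ge> 0"
    and E1: "(\<Sum>(a, b)\<in>fdom n \<times> fdom n. \<bar>\<mu> (a, b) - \<mu> (a, b - 2 * a)\<bar>) \<le> E"
    and E2: "(\<Sum>(a, b)\<in>fdom n \<times> fdom n. \<bar>\<mu> (a, b) - \<mu> (a, b + 2 * a)\<bar>) \<le> E"
  shows "2 * sum \<mu> (cone n) \<le> sum \<mu> (prod.swap ` cone n) + sum \<mu> (far n) + 2 * E"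
    and "sum \<mu> (diag n) \<le> 2 * (sum \<mu> (prod.swap ` cone n) + sum \<mu> (far n) + E)"
proof -
  let ?D = "fdom n \<times> fdom n"
  let ?Y = "prod.swap ` cone n \<union> far n"
  have fin: "finite (cone n)" "finite (diag n)" "finite (far n)"
    by (rule finite_subset[of _ ?D]; auto simp: cone_def diag_def far_def)+
  have Y: "sum \<mu> ?Y \<le> sum \<mu> (prod.swap ` cone n) + sum \<mu> (far n)"
    using fin nonneg by (simp add: sum_Un sum_nonneg)
  let ?p = "\<lambda>(a, b). (a, b + 2 * a)" and ?m = "\<lambda>(a, b). (a :: int, b - 2 * a :: int)"
  have inj: "inj_on ?p A" "inj_on ?m A" for A by (auto simp: inj_on_def)
  have p: "sum \<mu> A - E \<le> sum \<mu> (?p ` A)" if "A \<subseteq> ?D" for A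
  proof -
    have "sum \<mu> A - sum \<mu> (?p ` A) = (\<Sum>(a, b)\<in>A. \<mu> (a, b) - \<mu> (a, b + 2 * a))"
      unfolding sum.reindex[OF inj(1)] sum_subtractf[symmetric] by (rule sum.cong) auto
    also have "\<dots> \<le> (\<Sum>(a, b)\<in>A. \<bar>\<mu> (a, b) - \<mu> (a, b + 2 * a)\<bar>)"
      by (intro sum_mono) (auto simp: split_def)
    also have "\<dots> \<le> (\<Sum>(a, b)\<in>?D. \<bar>\<mu> (a, b) - \<mu> (a, b + 2 * a)\<bar>)"
      using that by (intro sum_mono2) auto
    finally show ?thesis using E2 by simp
  qed
  have m: "sum \<mu> A - E \<le> sum \<mu> (?m ` A)" if "A \<subseteq> ?D" for A
  proof -
    have "sum \<mu> A - sum \<mu> (?m ` A) = (\<Sum>(a, b)\<in>A. \<mu> (a, b) - \<mu> (a, b - 2 * a))"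
      unfolding sum.reindex[OF inj(2)] sum_subtractf[symmetric] by (rule sum.cong) auto
    also have "\<dots> \<le> (\<Sum>(a, b)\<in>A. \<bar>\<mu> (a, b) - \<mu> (a, b - 2 * a)\<bar>)"
      by (intro sum_mono) (auto simp: split_def)
    also have "\<dots> \<le> (\<Sum>(a, b)\<in>?D. \<bar>\<mu> (a, b) - \<mu> (a, b - 2 * a)\<bar>)"
      using that by (intro sum_mono2) auto
    finally show ?thesis using E1 by simp
  qed
  have Yiff: "(a, b) \<in> ?Y" if "a \<in> fdom n" "b \<in> fdom n" "\<bar>a\<bar> < \<bar>b\<bar>" for a b
  proof (cases "(a, b) \<in> far n")
    case False
    then have "(b, a) \<in> cone n" using that by (auto simp: far_def cone_def)
    then have "prod.swap (b, a) \<in> prod.swap ` cone n" by (rule imageI)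
    then show ?thesis by simp
  qed simp
  have "(a, b + 2 * a) \<in> ?Y" "(a, b - 2 * a) \<in> ?Y" if "(a, b) \<in> cone n" for a b
    by (rule Yiff; use that in \<open>simp add: cone_def fdom_iff abs_if split: if_splits\<close>)+
  then have "?p ` cone n \<subseteq> ?Y" "?m ` cone n \<subseteq> ?Y" by fast+
  \<comment> \<open>A common image would need two second coordinates that differ by 4a, although
    both are smaller than \<bar>a\<bar> in absolute value.\<close>
  moreover have "?p ` cone n \<inter> ?m ` cone n = {}"
    by (auto simp: cone_def)
  ultimately have "sum \<mu> (?p ` cone n) + sum \<mu> (?m ` cone n) \<le> sum \<mu> ?Y"
    using fin nonneg by (subst sum.union_disjoint[symmetric]) (auto intro!: sum_mono2)
  moreover have "cone n \<subseteq> ?D" by (auto simp: cone_def)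
  ultimately show "2 * sum \<mu> (cone n) \<le> sum \<mu> (prod.swap ` cone n) + sum \<mu> (far n) + 2 * E"
    using p[of "cone n"] m[of "cone n"] Y by simp
  \<comment> \<open>On b = a only adding 2a enlarges \<bar>b\<bar>, to 3\<bar>a\<bar>, and on b = -a
    only subtracting does; each half of the diagonal has its own shear.\<close>
  let ?d1 = "diag n \<inter> {(a, b). b = a}" and ?d2 = "diag n \<inter> {(a, b). b = - a}"
  have "(a, b + 2 * a) \<in> ?Y" if "(a, b) \<in> ?d1" for a b
    by (rule Yiff; use that in \<open>simp add: diag_def fdom_iff abs_if split: if_splits\<close>)
  moreover have "(a, b - 2 * a) \<in> ?Y" if "(a, b) \<in> ?d2" for a b
    by (rule Yiff; use that in \<open>simp add: diag_def fdom_iff abs_if split: if_splits\<close>)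
  ultimately have "?p ` ?d1 \<subseteq> ?Y" "?m ` ?d2 \<subseteq> ?Y" by fast+
  then have "sum \<mu> (?p ` ?d1) \<le> sum \<mu> ?Y" "sum \<mu> (?m ` ?d2) \<le> sum \<mu> ?Y"
    using fin nonneg by (intro sum_mono2; auto)+
  note le = this
  have "?d1 \<subseteq> ?D" "?d2 \<subseteq> ?D" by (auto simp: diag_def)
  note d = p[OF this(1)] m[OF this(2)]
  have "sum \<mu> (diag n) = sum \<mu> (?d1 \<union> ?d2)"
    by (rule arg_cong[where f = "sum \<mu>"]) (auto simp: diag_def abs_if split: if_splits)
  moreover have "sum \<mu> (?d1 \<union> ?d2) \<le> sum \<mu> ?d1 + sum \<mu> ?d2"
    using fin nonneg by (simp add: sum_Un sum_nonneg)
  ultimately show "sum \<mu> (diag n) \<le> 2 * (sum \<mu> (prod.swap ` cone n) + sum \<mu> (far n) + E)"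
    using Y le d by (simp add: field_simps)
qed

text \<open>The cone bound is applied to the mass and to its transpose. Either cone then weighs at
  most about half of the other one, so both are controlled by the far region, and so is the
  diagonal.\<close>

lemma total_mass_bound:
  fixes \<mu> :: "int \<times> int \<Rightarrow> real"
  assumes nonneg: "\<And>z. \<mu> z \<ge> 0" and zero: "\<mu> (0, 0) = 0"
    and "(\<Sum>(a, b)\<in>fdom n \<times> fdom n. \<bar>\<mu> (a, b) - \<mu> (a, b - 2 * a)\<bar>) \<le> E"
    and "(\<Sum>(a, b)\<in>fdom n \<times> fdom n. \<bar>\<mu> (a, b) - \<mu> (a, b + 2 * a)\<bar>) \<le> E"
    and E3: "(\<Sum>(a, b)\<in>fdom n \<times> fdom n. \<bar>\<mu> (a, b) - \<mu> (a - 2 * b, b)\<bar>) \<le> E"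
    and E4: "(\<Sum>(a, b)\<in>fdom n \<times> fdom n. \<bar>\<mu> (a, b) - \<mu> (a + 2 * b, b)\<bar>) \<le> E"
  shows "sum \<mu> (fdom n \<times> fdom n) \<le> 9 * sum \<mu> (far n) + 14 * E"
proof -
  let ?D = "fdom n \<times> fdom n"
  have sw: "sum g ?D = (\<Sum>z\<in>?D. g (prod.swap z))" for g :: "int \<times> int \<Rightarrow> real"
    by (rule sum.reindex_bij_witness[of _ prod.swap prod.swap]) auto
  have inj: "inj_on prod.swap A" for A :: "(int \<times> int) set" by simp
  have far: "prod.swap ` far n = far n"
    by (auto simp: far_def image_iff)
  let ?\<nu> = "\<mu> \<circ> prod.swap"
  have *: "2 * sum ?\<nu> (cone n) \<le> sum ?\<nu> (prod.swap ` cone n) + sum ?\<nu> (far n) + 2 * E"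
  proof (rule cone_shear_bound(1))
    show "(\<Sum>(a, b)\<in>?D. \<bar>?\<nu> (a, b) - ?\<nu> (a, b - 2 * a)\<bar>) \<le> E"
      using E3 by (subst sw) (simp add: split_def)
    show "(\<Sum>(a, b)\<in>?D. \<bar>?\<nu> (a, b) - ?\<nu> (a, b + 2 * a)\<bar>) \<le> E"
      using E4 by (subst sw) (simp add: split_def)
  qed (use nonneg in auto)
  have "sum ?\<nu> A = sum \<mu> (prod.swap ` A)" for A
    by (rule sum.reindex[OF inj, symmetric])
  then have 2: "2 * sum \<mu> (prod.swap ` cone n) \<le> sum \<mu> (cone n) + sum \<mu> (far n) + 2 * E"
    using * by (simp add: far image_image)
  have fin: "finite (cone n)" "finite (diag n)" "finite (far n)"
    by (rule finite_subset[of _ ?D]; auto simp: cone_def diag_def far_def)+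
  have "?D \<subseteq> insert (0, 0) (cone n \<union> prod.swap ` cone n \<union> diag n \<union> far n)"
  proof
    fix z assume z: "z \<in> ?D"
    obtain a b where ab: "z = (a, b)" by fastforce
    show "z \<in> insert (0, 0) (cone n \<union> prod.swap ` cone n \<union> diag n \<union> far n)"
    proof (cases "z \<in> far n")
      case False
      then consider "\<bar>b\<bar> < \<bar>a\<bar>" | "\<bar>a\<bar> < \<bar>b\<bar>" | "\<bar>b\<bar> = \<bar>a\<bar>" by linarith
      then show ?thesis
      proof cases
        case 2
        then have "(b, a) \<in> cone n" using z False ab by (auto simp: far_def cone_def)
        then have "prod.swap (b, a) \<in> prod.swap ` cone n" by (rule imageI)
        then show ?thesis using ab by simp
      qed (use z False ab in \<open>auto simp: far_def cone_def diag_def\<close>)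
    qed simp
  qed
  then have "sum \<mu> ?D \<le> sum \<mu> (insert (0, 0) (cone n \<union> prod.swap ` cone n \<union> diag n \<union> far n))"
    using fin nonneg by (intro sum_mono2) auto
  also have "\<dots> \<le> sum \<mu> (cone n \<union> prod.swap ` cone n \<union> diag n \<union> far n)"
    using fin zero by (simp add: sum.insert_if)
  also have "sum \<mu> (cone n \<union> prod.swap ` cone n \<union> diag n \<union> far n) \<le>
      sum \<mu> (cone n) + sum \<mu> (prod.swap ` cone n) + sum \<mu> (diag n) + sum \<mu> (far n)"
  proof -
    have U: "sum \<mu> (A \<union> B) \<le> sum \<mu> A + sum \<mu> B" if "finite A" "finite B" for A B
      using that nonneg by (simp add: sum_Un sum_nonneg)
    show ?thesis
      using U[of "cone n \<union> prod.swap ` cone n \<union> diag n" "far n"] U[of "cone n \<union> prod.swap ` cone n" "diag n"]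
        U[of "cone n" "prod.swap ` cone n"] fin by simp
  qed
  finally have "sum \<mu> ?D \<le> sum \<mu> (cone n) + sum \<mu> (prod.swap ` cone n) + sum \<mu> (diag n) + sum \<mu> (far n)" .
  \<comment> \<open>Adding the two cone bounds gives c + s \<le> 2f + 4E, hence also s \<le> 2f +
    4E; inserting both into c + s + d + f yields 9f + 14E.\<close>
  moreover have "S \<le> 9 * f + 14 * E"
    if "S \<le> c + s + d + f" "0 \<le> c" "2 * s \<le> c + f + 2 * E" "2 * c \<le> s + f + 2 * E" "d \<le> 2 * (s + f + E)"
    for S c s d f E :: real using that by argo
  ultimately show ?thesis
    using sum_nonneg[of "cone n" \<mu>, OF nonneg] 2 cone_shear_bound[OF nonneg assms(3,4)] by blast
qed


subsection \<open>The spectral gap\<close>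

lemma sum_fdom2:
  fixes g :: "int \<Rightarrow> int \<Rightarrow> real"
  assumes "n > 0" "periodic2 n g"
  shows "(\<Sum>(a, b)\<in>fdom n \<times> fdom n. g a b) = (\<Sum>a\<in>{0..<int n}. \<Sum>b\<in>{0..<int n}. g a b)"
proof -
  have "(\<Sum>b\<in>fdom n. g a b) = (\<Sum>b\<in>{0..<int n}. g a b)" for a
    using sum_fdom[of n "g a" 0] assms by (simp add: periodic2_def)
  moreover have "(\<Sum>a\<in>fdom n. \<Sum>b\<in>{0..<int n}. g a b) = (\<Sum>a\<in>{0..<int n}. \<Sum>b\<in>{0..<int n}. g a b)"
    using sum_fdom[of n "\<lambda>a. \<Sum>b\<in>{0..<int n}. g a b" 0] assms
    by (simp add: periodic2_def periodic_def)
  ultimately show ?thesis by (simp add: sum.cartesian_product[symmetric])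
qed

lemma sum_fdom_dft:
  assumes "n > 0"
  shows "(\<Sum>(a, b)\<in>fdom n \<times> fdom n. (norm (dft n f a b))\<^sup>2) = (real n)\<^sup>2 * sqnorm n f"
proof -
  have "periodic2 n (\<lambda>a b. (norm (dft n f a b))\<^sup>2)"
    using periodic2_dft[OF assms, of f] by (simp add: periodic2_def periodic_def)
  from sum_fdom2[OF assms this] show ?thesis
    using parseval2[OF assms, of f] by (simp add: sqnorm_def)
qed

text \<open>The difference of two squares is split by the weighted inequality of the means. The
  weight 28 is chosen so that the factor 14 of \<open>total_mass_bound\<close> turns the second term
  into half of \<open>sqnorm n f\<close>, which can be absorbed.\<close>

lemma shear_energy:
  assumes n: "n > 0" and f: "periodic2 n f"
  defines "\<mu> \<equiv> \<lambda>(a, b). (norm (dft n f a b))\<^sup>2"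
  defines "E \<equiv> (real n)\<^sup>2 * (28 * sqnorm n (\<lambda>x y. f x y - f (x + 2 * y) y) + sqnorm n f / 28)"
  shows "(\<Sum>(a, b)\<in>fdom n \<times> fdom n. \<bar>\<mu> (a, b) - \<mu> (a, b - 2 * a)\<bar>) \<le> E"
    and "(\<Sum>(a, b)\<in>fdom n \<times> fdom n. \<bar>\<mu> (a, b) - \<mu> (a, b + 2 * a)\<bar>) \<le> E"
proof -
  let ?D = "fdom n \<times> fdom n"
  let ?g = "\<lambda>x y. f (x + 2 * y) y"
  have q: "dft n f a (b - 2 * a) = dft n ?g a b" for a b
    by (rule dft_shear[OF n f, symmetric])
  have pt: "\<bar>(norm p)\<^sup>2 - (norm q)\<^sup>2\<bar> \<le> 28 * (norm (p - q))\<^sup>2 + ((norm p)\<^sup>2 + (norm q)\<^sup>2) / 56"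
    for p q :: complex
  proof -
    let ?u = "norm p" and ?v = "norm q" and ?d = "norm (p - q)"
    have "\<bar>?u\<^sup>2 - ?v\<^sup>2\<bar> = \<bar>?u - ?v\<bar> * (?u + ?v)"
    proof -
      have "?u\<^sup>2 - ?v\<^sup>2 = (?u - ?v) * (?u + ?v)" by (simp add: power2_eq_square algebra_simps)
      then show ?thesis by (simp only: abs_mult) simp
    qed
    also have "\<dots> \<le> ?d * (?u + ?v)"
      by (intro mult_right_mono norm_triangle_ineq3) simp
    also have "\<dots> \<le> 28 * ?d\<^sup>2 + (?u + ?v)\<^sup>2 / 112"
    proof -
      have "0 \<le> (28 * ?d - (?u + ?v) / 2)\<^sup>2 / 28" by simp
      then show ?thesis by (simp add: power2_eq_square field_simps)
    qed
    also have "(?u + ?v)\<^sup>2 / 112 \<le> (?u\<^sup>2 + ?v\<^sup>2) / 56"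
    proof -
      have "0 \<le> (?u - ?v)\<^sup>2" by simp
      then show ?thesis by (simp add: power2_eq_square field_simps)
    qed
    finally show ?thesis by simp
  qed
  have sg: "sqnorm n ?g = sqnorm n f"
  proof -
    have "(\<Sum>x\<in>{0..<int n}. (norm (f (x + 2 * y) y))\<^sup>2) = (\<Sum>x\<in>{0..<int n}. (norm (f x y))\<^sup>2)" for y
      using f by (intro sum_periodic_shift0[OF n]) (simp add: periodic2_def periodic_def)
    then have "(\<Sum>y\<in>{0..<int n}. \<Sum>x\<in>{0..<int n}. (norm (f (x + 2 * y) y))\<^sup>2) =
      (\<Sum>y\<in>{0..<int n}. \<Sum>x\<in>{0..<int n}. (norm (f x y))\<^sup>2)" by simp
    then show ?thesis unfolding sqnorm_def
      by (rule trans[OF sum.swap trans[OF _ sum.swap]])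
  qed
  have "(\<Sum>(a, b)\<in>?D. \<bar>\<mu> (a, b) - \<mu> (a, b - 2 * a)\<bar>) \<le>
     (\<Sum>(a, b)\<in>?D. 28 * (norm (dft n (\<lambda>x y. f x y - ?g x y) a b))\<^sup>2 +
       ((norm (dft n f a b))\<^sup>2 + (norm (dft n ?g a b))\<^sup>2) / 56)"
    unfolding \<mu>_def using pt by (intro sum_mono) (auto simp: q dft_diff)
  also have "\<dots> = 28 * (\<Sum>(a, b)\<in>?D. (norm (dft n (\<lambda>x y. f x y - ?g x y) a b))\<^sup>2) +
       ((\<Sum>(a, b)\<in>?D. (norm (dft n f a b))\<^sup>2) + (\<Sum>(a, b)\<in>?D. (norm (dft n ?g a b))\<^sup>2)) / 56"
    by (simp add: split_def sum.distrib sum_distrib_left sum_divide_distrib add_divide_distrib)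
  also have "\<dots> = E"
    unfolding sum_fdom_dft[OF n] sg E_def by (simp add: algebra_simps)
  finally show 1: "(\<Sum>(a, b)\<in>?D. \<bar>\<mu> (a, b) - \<mu> (a, b - 2 * a)\<bar>) \<le> E" .
  \<comment> \<open>The opposite shear is reduced to the first one by shifting the periodic
    summation variable b by 2a.\<close>
  have "(\<Sum>b\<in>fdom n. \<bar>\<mu> (a, b) - \<mu> (a, b + 2 * a)\<bar>) = (\<Sum>b\<in>fdom n. \<bar>\<mu> (a, b) - \<mu> (a, b - 2 * a)\<bar>)" for a
  proof -
    let ?h = "\<lambda>b. \<bar>\<mu> (a, b) - \<mu> (a, b + 2 * a)\<bar>"
    have "periodic n ?h"
    proof (rule periodicI)
      fix b b' :: int assume b: "b mod int n = b' mod int n"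
      have "dft n f a b = dft n f a b'"
        by (rule periodic2_cong[OF periodic2_dft[OF n] refl b])
      moreover have "dft n f a (b + 2 * a) = dft n f a (b' + 2 * a)"
        by (rule periodic2_cong[OF periodic2_dft[OF n] refl mod_add_cong[OF b refl]])
      ultimately show "?h b = ?h b'" by (simp add: \<mu>_def)
    qed
    from sum_fdom[OF n this, of 0] sum_fdom[OF n this, of "- 2 * a"]
    have "(\<Sum>b\<in>fdom n. ?h b) = (\<Sum>b\<in>fdom n. ?h (b + - 2 * a))" by simp
    then show ?thesis by (simp add: abs_minus_commute)
  qed
  then show "(\<Sum>(a, b)\<in>?D. \<bar>\<mu> (a, b) - \<mu> (a, b + 2 * a)\<bar>) \<le> E"
    using 1 by (simp add: sum.cartesian_product[symmetric])
qed

lemma sqnorm_transpose: "sqnorm n (\<lambda>x y. f y x) = sqnorm n f"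
  unfolding sqnorm_def by (rule sum.swap)

text \<open>The squared modulus of 1 - \<open>ch n (- a)\<close> equals 2 - 2 cos t with t =
  2\<pi>\<bar>a\<bar>/n. For n/8 \<le> \<bar>a\<bar> \<le> n/2 the angle lies between \<pi>/4 and
  \<pi>, where the cosine is at most 3/4.\<close>

lemma translation_energy:
  assumes n: "n > 0" and f: "periodic2 n f"
  shows "(\<Sum>(a, b)\<in>{(a, b) \<in> fdom n \<times> fdom n. int n \<le> 8 * \<bar>a\<bar>}. (norm (dft n f a b))\<^sup>2) \<le>
    2 * (real n)\<^sup>2 * sqnorm n (\<lambda>x y. f x y - f (x + 1) y)"
proof -
  let ?D = "fdom n \<times> fdom n" and ?F = "{(a, b) \<in> fdom n \<times> fdom n. int n \<le> 8 * \<bar>a\<bar>}"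
  have d: "dft n (\<lambda>x y. f x y - f (x + 1) y) a b = (1 - ch n (- a)) * dft n f a b" for a b
    by (simp add: dft_diff dft_translate[OF n f] algebra_simps)
  have half: "1 / 2 \<le> (norm (1 - ch n (- a)))\<^sup>2" if "a \<in> fdom n" "int n \<le> 8 * \<bar>a\<bar>" for a
  proof -
    let ?t = "2 * pi * \<bar>of_int a\<bar> / real n"
    have "cos (2 * pi * of_int (- a) / real n) = cos ?t"
      by (cases "a \<ge> 0") auto
    then have re: "Re (ch n (- a)) = cos ?t" by (simp add: ch_def)
    have "(norm (1 - ch n (- a)))\<^sup>2 = 2 - 2 * Re (ch n (- a))"
    proof -
      have "(Re (ch n (- a)))\<^sup>2 + (Im (ch n (- a)))\<^sup>2 = 1"
        using norm_ch[of n "- a"] by (simp add: cmod_def)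
      then show ?thesis unfolding cmod_power2 by (simp add: power2_eq_square algebra_simps)
    qed
    moreover have "cos ?t \<le> cos (pi / 4)"
    proof (rule cos_monotone_0_pi_le)
      have "real n \<le> 8 * \<bar>of_int a\<bar>" using that(2) by linarith
      then show "pi / 4 \<le> ?t" using n by (simp add: field_simps)
      have "2 * \<bar>a\<bar> \<le> int n" using that(1) by (simp add: fdom_iff abs_if)
      then have "2 * \<bar>of_int a\<bar> \<le> real n" by linarith
      then show "?t \<le> pi" using n by (simp add: field_simps)
    qed simp
    moreover have "cos (pi / 4) \<le> 3 / 4"
    proof -
      have "sqrt 2 \<le> 3 / 2" by (rule real_le_lsqrt) (auto simp: power2_eq_square)
      then show ?thesis by (simp add: cos_45)
    qed
    ultimately show ?thesis using re by simp
  qed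
  have "(\<Sum>(a, b)\<in>?F. (norm (dft n f a b))\<^sup>2) \<le>
      (\<Sum>(a, b)\<in>?F. 2 * (norm (dft n (\<lambda>x y. f x y - f (x + 1) y) a b))\<^sup>2)"
  proof (intro sum_mono)
    fix z assume "z \<in> ?F"
    then obtain a b where z: "z = (a, b)" "a \<in> fdom n" "int n \<le> 8 * \<bar>a\<bar>" by auto
    have "(1 / 2) * (norm (dft n f a b))\<^sup>2 \<le> (norm (1 - ch n (- a)))\<^sup>2 * (norm (dft n f a b))\<^sup>2"
      by (intro mult_right_mono half z) simp
    then show "(case z of (a, b) \<Rightarrow> (norm (dft n f a b))\<^sup>2) \<le>
       (case z of (a, b) \<Rightarrow> 2 * (norm (dft n (\<lambda>x y. f x y - f (x + 1) y) a b))\<^sup>2)"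
      by (simp add: z(1) d norm_mult power_mult_distrib)
  qed
  also have "\<dots> \<le> (\<Sum>(a, b)\<in>?D. 2 * (norm (dft n (\<lambda>x y. f x y - f (x + 1) y) a b))\<^sup>2)"
    by (intro sum_mono2) auto
  also have "\<dots> = 2 * (\<Sum>(a, b)\<in>?D. (norm (dft n (\<lambda>x y. f x y - f (x + 1) y) a b))\<^sup>2)"
    by (simp add: sum_distrib_left split_def)
  finally show ?thesis unfolding sum_fdom_dft[OF n] by simp
qed

text \<open>The mean is the transform at frequency 0, so \<open>total_mass_bound\<close> applies.
  Its far region costs 9 * 2 = 18 and its shears 14 * 28 = 392 times the energies; absorbing half of
  \<open>sqnorm n f\<close> doubles this, whence 784.\<close>

lemma spectral_gap:
  assumes n: "n > 0" and f: "periodic2 n f" and mean: "(\<Sum>x\<in>{0..<int n}. \<Sum>y\<in>{0..<int n}. f x y) = 0"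
  shows "sqnorm n f \<le> 784 * (sqnorm n (\<lambda>x y. f x y - f (x + 1) y) + sqnorm n (\<lambda>x y. f x y - f x (y + 1)) +
     sqnorm n (\<lambda>x y. f x y - f (x + 2 * y) y) + sqnorm n (\<lambda>x y. f x y - f x (y + 2 * x)))"
proof -
  let ?D = "fdom n \<times> fdom n"
  let ?f' = "\<lambda>x y. f y x"
  define \<mu> where "\<mu> = (\<lambda>(a, b). (norm (dft n f a b))\<^sup>2)"
  define d1 d2 d3 d4 where "d1 = sqnorm n (\<lambda>x y. f x y - f (x + 1) y)"
    and "d2 = sqnorm n (\<lambda>x y. f x y - f x (y + 1))"
    and "d3 = sqnorm n (\<lambda>x y. f x y - f (x + 2 * y) y)"
    and "d4 = sqnorm n (\<lambda>x y. f x y - f x (y + 2 * x))"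
  note d_defs = d1_def d2_def d3_def d4_def
  have d0: "d1 \<ge> 0" "d2 \<ge> 0" "d3 \<ge> 0" "d4 \<ge> 0" by (auto simp: d_defs sqnorm_def intro!: sum_nonneg)
  have f': "periodic2 n ?f'" using f by (simp add: periodic2_def)
  have t2: "sqnorm n (\<lambda>x y. ?f' x y - ?f' (x + 1) y) = d2" "sqnorm n (\<lambda>x y. ?f' x y - ?f' (x + 2 * y) y) = d4"
    "sqnorm n ?f' = sqnorm n f"
    unfolding d_defs by (subst sqnorm_transpose[symmetric], rule refl)+
  have tr: "dft n ?f' a b = dft n f b a" for a b by (rule dft_transpose)
  have sw: "(\<Sum>(a, b)\<in>A. g a b) = (\<Sum>(a, b)\<in>B. g b a)"
    if "A = prod.swap ` B" for A B :: "(int \<times> int) set" and g :: "int \<Rightarrow> int \<Rightarrow> real"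
    using that by (simp add: sum.reindex split_def)
  have D: "?D = prod.swap ` ?D" by (auto simp: image_iff)
  define N where "N = (real n)\<^sup>2"
  define E where "E = N * (28 * (d3 + d4) + sqnorm n f / 28)"
  have N0: "N \<ge> 0" by (simp add: N_def)
  have le: "N * (28 * d3 + sqnorm n f / 28) \<le> E" "N * (28 * d4 + sqnorm n f / 28) \<le> E"
    unfolding E_def using d0 N0 by (auto intro!: mult_left_mono)
  have "sum \<mu> ?D \<le> 9 * sum \<mu> (far n) + 14 * E"
  proof (rule total_mass_bound)
    show "\<mu> z \<ge> 0" for z by (cases z) (simp add: \<mu>_def)
    show "\<mu> (0, 0) = 0" using mean by (simp add: \<mu>_def dft_def)
    show "(\<Sum>(a, b)\<in>?D. \<bar>\<mu> (a, b) - \<mu> (a, b - 2 * a)\<bar>) \<le> E"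
      "(\<Sum>(a, b)\<in>?D. \<bar>\<mu> (a, b) - \<mu> (a, b + 2 * a)\<bar>) \<le> E"
      using shear_energy[OF n f] le(1) by (simp_all add: \<mu>_def N_def d_defs)
    show "(\<Sum>(a, b)\<in>?D. \<bar>\<mu> (a, b) - \<mu> (a - 2 * b, b)\<bar>) \<le> E"
      using shear_energy(1)[OF n f'] le(2) sw[OF D, of "\<lambda>a b. \<bar>\<mu> (a, b) - \<mu> (a - 2 * b, b)\<bar>"]
      unfolding t2 tr by (simp add: \<mu>_def N_def)
    show "(\<Sum>(a, b)\<in>?D. \<bar>\<mu> (a, b) - \<mu> (a + 2 * b, b)\<bar>) \<le> E"
      using shear_energy(2)[OF n f'] le(2) sw[OF D, of "\<lambda>a b. \<bar>\<mu> (a, b) - \<mu> (a + 2 * b, b)\<bar>"]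
      unfolding t2 tr by (simp add: \<mu>_def N_def)
  qed
  moreover have "sum \<mu> (far n) \<le> 2 * N * d1 + 2 * N * d2"
  proof -
    let ?A = "{(a, b) \<in> ?D. int n \<le> 8 * \<bar>a\<bar>}" and ?B = "{(a, b) \<in> ?D. int n \<le> 8 * \<bar>b\<bar>}"
    have fin: "finite ?A" "finite ?B" by (rule finite_subset[of _ ?D]; auto)+
    have "far n = ?A \<union> ?B" by (auto simp: far_def)
    then have "sum \<mu> (far n) \<le> sum \<mu> ?A + sum \<mu> ?B"
      using sum.union_inter[OF fin, of \<mu>] sum_nonneg[of "?A \<inter> ?B" \<mu>] by (simp add: \<mu>_def split_def)
    moreover have "sum \<mu> ?A \<le> 2 * N * d1"
      using translation_energy[OF n f] by (simp add: \<mu>_def N_def d_defs)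
    moreover have "sum \<mu> ?B \<le> 2 * N * d2"
    proof -
      have "?B = prod.swap ` ?A" by (auto simp: image_iff)
      from sw[OF this, of "\<lambda>a b. (norm (dft n f a b))\<^sup>2"] show ?thesis
        using translation_energy[OF n f'] unfolding t2 tr by (simp add: \<mu>_def N_def)
    qed
    ultimately show ?thesis by linarith
  qed
  moreover have "sum \<mu> ?D = N * sqnorm n f"
    using sum_fdom_dft[OF n, of f] by (simp add: \<mu>_def N_def)
  moreover have "T \<le> 9 * F' + 14 * E" if "S \<le> 9 * F + 14 * E" "F \<le> F'" "S = T" for S T F F' :: real
    using that by linarith
  ultimately have "N * sqnorm n f \<le> 9 * (2 * N * d1 + 2 * N * d2) + 14 * E" by blast
  also have "\<dots> = N * (18 * (d1 + d2) + 392 * (d3 + d4) + sqnorm n f / 2)"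
    by (simp add: E_def algebra_simps)
  finally have "sqnorm n f \<le> 18 * (d1 + d2) + 392 * (d3 + d4) + sqnorm n f / 2"
    using n by (simp add: N_def)
  then show ?thesis unfolding d_defs[symmetric] using d0 by simp
qed


subsection \<open>Expanders of every size\<close>

definition boundary :: "nat \<Rightarrow> (nat \<Rightarrow> nat) \<Rightarrow> nat set \<Rightarrow> nat" where
  "boundary m s Y = card {l \<in> {..<m}. (l \<in> Y) \<noteq> (s l \<in> Y)}"

text \<open>With l = x * n + y for the point (x, y), the four maps increase x by 1, y by 1, x by 2y
  and y by 2x, in the style of the expanders of Margulis and of Gabber and Galil.\<close>

definition torus_map :: "nat \<Rightarrow> nat \<Rightarrow> nat \<Rightarrow> nat" where
  "torus_map n j l =
     (if j = 0 then ((l div n + 1) mod n) * n + l mod n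
      else if j = 1 then (l div n) * n + (l mod n + 1) mod n
      else if j = 2 then ((l div n + 2 * (l mod n)) mod n) * n + l mod n
      else (l div n) * n + (l mod n + 2 * (l div n)) mod n)"

lemma sum_square:
  fixes g :: "nat \<Rightarrow> 'a :: comm_monoid_add"
  shows "(\<Sum>x\<in>{0..<int n}. \<Sum>y\<in>{0..<int n}. g (nat x * n + nat y)) = (\<Sum>l<n * n. g l)"
proof -
  have "(\<Sum>(x, y)\<in>{0..<int n} \<times> {0..<int n}. g (nat x * n + nat y)) = (\<Sum>l<n * n. g l)"
  proof (rule sum.reindex_bij_witness[where i = "\<lambda>l. (int (l div n), int (l mod n))"
        and j = "\<lambda>(x, y). nat x * n + nat y"])
    fix z assume z: "z \<in> {0..<int n} \<times> {0..<int n}"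
    then obtain x y where xy: "z = (int x, int y)" "x < n" "y < n"
      by (auto elim!: nonneg_int_cases)
    have "x * n + y < n * n"
    proof -
      have "x * n + y < (x + 1) * n" using xy by simp
      also have "\<dots> \<le> n * n" using xy by (intro mult_right_mono) auto
      finally show ?thesis .
    qed
    then show "(case z of (x, y) \<Rightarrow> nat x * n + nat y) \<in> {..<n * n}" using xy by simp
    show "(\<lambda>l. (int (l div n), int (l mod n))) (case z of (x, y) \<Rightarrow> nat x * n + nat y) = z"
      using xy by simp
  next
    fix l assume "l \<in> {..<n * n}"
    then have "l < n * n" by simp
    then have "n > 0" "l div n < n" by (auto simp: less_mult_imp_div_less intro: Nat.gr0I)
    then show "(int (l div n), int (l mod n)) \<in> {0..<int n} \<times> {0..<int n}" by simp
  qed (auto simp: split_def)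
  then show ?thesis by (simp add: sum.cartesian_product)
qed

lemma torus_expansion:
  assumes Y: "Y \<subseteq> {..<n * n}"
  shows "min (card Y) (n * n - card Y) \<le> 1568 * (\<Sum>j<4. boundary (n * n) (torus_map n j) Y)"
proof (cases "n = 0")
  case False
  then have n: "n > 0" by simp
  define p :: real where "p = real (card Y) / real (n * n)"
  define ind :: "nat \<Rightarrow> real" where "ind l = of_bool (l \<in> Y)" for l
  define f :: "int \<Rightarrow> int \<Rightarrow> complex" where
    "f x y = complex_of_real (ind (nat (x mod int n) * n + nat (y mod int n)) - p)" for x y
  have fY: "finite Y" using Y finite_subset by blast
  have cY: "card Y \<le> n * n" using card_mono[OF _ Y] by simp
  have per: "periodic2 n f" by (rule periodic2I) (simp add: f_def)
  have f1: "f x y = complex_of_real (ind (nat x * n + nat y) - p)" if "x \<in> {0..<int n}" "y \<in> {0..<int n}" for x y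
    using that by (simp add: f_def)
  have sum_ind: "(\<Sum>l<n * n. ind l) = real (card Y)"
    using Y by (simp add: ind_def of_bool_def sum.If_cases Int_absorb1)
  have mean: "(\<Sum>x\<in>{0..<int n}. \<Sum>y\<in>{0..<int n}. f x y) = 0"
  proof -
    have "(\<Sum>x\<in>{0..<int n}. \<Sum>y\<in>{0..<int n}. f x y) =
        (\<Sum>x\<in>{0..<int n}. \<Sum>y\<in>{0..<int n}. complex_of_real (ind (nat x * n + nat y) - p))"
      by (intro sum.cong refl f1)
    also have "\<dots> = (\<Sum>l<n * n. complex_of_real (ind l - p))" by (rule sum_square)
    also have "\<dots> = complex_of_real ((\<Sum>l<n * n. ind l) - real (n * n) * p)"
      by (simp only: of_real_sum[symmetric] sum_subtractf) simp
    also have "\<dots> = 0" using n by (simp add: sum_ind p_def)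
    finally show ?thesis .
  qed
  have norm: "sqnorm n f = real (card Y) * real (n * n - card Y) / real (n * n)"
  proof -
    have "sqnorm n f = (\<Sum>x\<in>{0..<int n}. \<Sum>y\<in>{0..<int n}. (\<lambda>l. (ind l - p)\<^sup>2) (nat x * n + nat y))"
      unfolding sqnorm_def by (intro sum.cong refl) (simp only: f1 norm_of_real power2_abs)
    also have "\<dots> = (\<Sum>l<n * n. (ind l - p)\<^sup>2)" by (rule sum_square)
    also have "\<dots> = (\<Sum>l<n * n. ind l * (1 - 2 * p) + p\<^sup>2)"
      by (intro sum.cong refl) (simp add: ind_def power2_eq_square algebra_simps)
    also have "\<dots> = real (card Y) * (1 - 2 * p) + real (n * n) * p\<^sup>2"
      by (simp only: sum.distrib sum_distrib_right[symmetric] sum_ind) simp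
    also have "\<dots> = real (card Y) * real (n * n - card Y) / real (n * n)"
      using n cY by (simp only: p_def of_nat_diff[OF cY]) (simp add: power2_eq_square field_simps)
    finally show ?thesis .
  qed
  have D: "sqnorm n (\<lambda>x y. f x y - f (g x y) (h x y)) = real (boundary (n * n) (torus_map n j) Y)"
    if *: "\<And>x y. x < n \<Longrightarrow> y < n \<Longrightarrow>
      nat (g (int x) (int y) mod int n) * n + nat (h (int x) (int y) mod int n) = torus_map n j (x * n + y)" for g h j
  proof -
    have "sqnorm n (\<lambda>x y. f x y - f (g x y) (h x y)) =
      (\<Sum>x\<in>{0..<int n}. \<Sum>y\<in>{0..<int n}. (\<lambda>l. of_bool ((l \<in> Y) \<noteq> (torus_map n j l \<in> Y))) (nat x * n + nat y))"
      unfolding sqnorm_def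
    proof (intro sum.cong refl)
      fix x y assume xy: "x \<in> {0..<int n}" "y \<in> {0..<int n}"
      have xn: "nat x < n" "nat y < n" using xy by auto
      have "f (g x y) (h x y) = complex_of_real (ind (torus_map n j (nat x * n + nat y)) - p)"
        using *[OF xn] xy by (simp add: f_def)
      then have "f x y - f (g x y) (h x y) =
          complex_of_real (ind (nat x * n + nat y) - ind (torus_map n j (nat x * n + nat y)))"
        using f1[OF xy] by simp
      then have "norm (f x y - f (g x y) (h x y)) = \<bar>ind (nat x * n + nat y) - ind (torus_map n j (nat x * n + nat y))\<bar>"
        by (simp only: norm_of_real)
      then show "(norm (f x y - f (g x y) (h x y)))\<^sup>2 =
          of_bool ((nat x * n + nat y \<in> Y) \<noteq> (torus_map n j (nat x * n + nat y) \<in> Y))"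
        by (simp add: ind_def)
    qed
    also have "\<dots> = (\<Sum>l<n * n. of_bool ((l \<in> Y) \<noteq> (torus_map n j l \<in> Y)))" by (rule sum_square)
    also have "\<dots> = real (boundary (n * n) (torus_map n j) Y)"
      by (simp add: boundary_def of_bool_def sum.If_cases Int_def)
    finally show ?thesis .
  qed
  have m: "nat ((int x + c) mod int n) = (x + nat c) mod n" if "c \<ge> 0" for x c
    using that by (simp add: nat_mod_distrib nat_add_distrib)
  have "sqnorm n f \<le> 784 * (real (boundary (n * n) (torus_map n 0) Y) + real (boundary (n * n) (torus_map n 1) Y) +
     real (boundary (n * n) (torus_map n 2) Y) + real (boundary (n * n) (torus_map n 3) Y))"
    using spectral_gap[OF n per mean]
      D[of "\<lambda>x y. x + 1" "\<lambda>x y. y" 0] D[of "\<lambda>x y. x" "\<lambda>x y. y + 1" 1]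
      D[of "\<lambda>x y. x + 2 * y" "\<lambda>x y. y" 2] D[of "\<lambda>x y. x" "\<lambda>x y. y + 2 * x" 3]
    by (simp add: torus_map_def m nat_mult_distrib)
  also have "\<dots> = real (784 * (\<Sum>j<4. boundary (n * n) (torus_map n j) Y))"
    by (simp add: eval_nat_numeral)
  finally have *: "real (card Y) * real (n * n - card Y) / real (n * n) \<le> real (784 * (\<Sum>j<4. boundary (n * n) (torus_map n j) Y))"
    unfolding norm .
  let ?a = "card Y" and ?b = "n * n - card Y"
  have ab: "real (n * n) = real ?a + real ?b" using cY by linarith
  have "min a b * (a + b) \<le> 2 * (a * b)" if "a \<ge> 0" "b \<ge> 0" for a b :: real
  proof (cases "a \<le> b")
    case True
    then show ?thesis using mult_left_mono[OF True that(1)] by (simp add: algebra_simps)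
  next
    case False
    then have "b * b \<le> b * a" using that by (intro mult_left_mono) auto
    then show ?thesis using False by (simp add: algebra_simps)
  qed
  from this[of "real ?a" "real ?b"]
  have "real (min ?a ?b) * (real ?a + real ?b) \<le> 2 * (real ?a * real ?b)"
    by (simp only: of_nat_min of_nat_0_le_iff)
  then have "real (min ?a ?b) \<le> 2 * (real ?a * real ?b / real (n * n))"
    using n unfolding ab[symmetric] by (simp add: field_simps)
  then have "real (min ?a ?b) \<le> 2 * real (784 * (\<Sum>j<4. boundary (n * n) (torus_map n j) Y))"
    using * by linarith
  then show ?thesis by linarith
qed (use Y in auto)

section \<open>The maps are permutations, and the passage from squares to all sizes\<close>

lemma add_mod_inj:
  fixes x x' c n :: nat
  assumes "x < n" "x' < n" "(x + c) mod n = (x' + c) mod n"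
  shows "x = x'"
proof -
  have "(int x + int c) mod int n = (int x' + int c) mod int n"
    using assms(3) by (metis of_nat_add of_nat_mod)
  then have "int n dvd (int x + int c) - (int x' + int c)" by (simp only: mod_eq_dvd_iff)
  then have d: "int n dvd int x - int x'" by simp
  show ?thesis
  proof (rule ccontr)
    assume "x \<noteq> x'"
    then have "int n \<le> \<bar>int x - int x'\<bar>" using d by (intro zdvd_imp_le) (auto simp: dvd_abs_iff)
    then show False using assms by linarith
  qed
qed

lemma torus_map_less:
  assumes "l < n * n"
  shows "torus_map n j l < n * n"
proof -
  have n: "n > 0" using assms by (auto intro: Nat.gr0I)
  have x: "l div n < n" using assms by (simp add: less_mult_imp_div_less)
  have *: "a * n + b < n * n" if "a < n" "b < n" for a b
  proof -
    have "a * n + b < (a + 1) * n" using that by simp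
    also have "\<dots> \<le> n * n" using that by (intro mult_right_mono) auto
    finally show ?thesis .
  qed
  show ?thesis unfolding torus_map_def using n x by (auto intro!: *)
qed

lemma torus_map_inj: "inj_on (torus_map n j) {..<n * n}"
proof (rule inj_onI)
  fix l l' assume l: "l \<in> {..<n * n}" "l' \<in> {..<n * n}" and eq: "torus_map n j l = torus_map n j l'"
  have n: "n > 0" using l by (auto intro: Nat.gr0I)
  have x: "l div n < n" "l' div n < n" "l mod n < n" "l' mod n < n"
    using l n by (auto simp: less_mult_imp_div_less)
  have dm: "a = a' \<and> b = b'" if "a * n + b = a' * n + b'" "b < n" "b' < n" for a b a' b'
  proof -
    have "(a * n + b) div n = a" "(a' * n + b') div n = a'" using that(2,3) n by auto
    then have "a = a'" using that(1) by metis
    then show ?thesis using that(1) by simp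
  qed
  have "l div n = l' div n \<and> l mod n = l' mod n"
  proof -
    consider "j = 0" | "j = 1" | "j = 2" | "j > 2" by linarith
    then show ?thesis
    proof cases
      case 1
      then have "(l div n + 1) mod n = (l' div n + 1) mod n \<and> l mod n = l' mod n"
        using eq x by (intro dm) (auto simp: torus_map_def)
      then show ?thesis using add_mod_inj x by blast
    next
      case 2
      then have "l div n = l' div n \<and> (l mod n + 1) mod n = (l' mod n + 1) mod n"
        using eq n by (intro dm) (auto simp: torus_map_def)
      then show ?thesis using add_mod_inj x by blast
    next
      case 3
      then have *: "(l div n + 2 * (l mod n)) mod n = (l' div n + 2 * (l' mod n)) mod n \<and> l mod n = l' mod n"
        using eq x by (intro dm) (auto simp: torus_map_def)
      then show ?thesis using add_mod_inj[OF x(1,2), of "2 * (l mod n)"] by metis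
    next
      case 4
      then have *: "l div n = l' div n \<and> (l mod n + 2 * (l div n)) mod n = (l' mod n + 2 * (l' div n)) mod n"
        using eq n by (intro dm) (auto simp: torus_map_def)
      then show ?thesis using add_mod_inj[OF x(3,4), of "2 * (l div n)"] by metis
    qed
  qed
  then show "l = l'" by (metis div_mult_mod_eq)
qed

text \<open>The integer square root, written as a bounded count because this form is definable in
  the expression language.\<close>

definition isqrt :: "nat \<Rightarrow> nat" where
  "isqrt m = (\<Sum>k<m. of_bool (Suc k * Suc k \<le> m))"

lemma isqrt: "isqrt m * isqrt m \<le> m" "m < Suc (isqrt m) * Suc (isqrt m)"
proof -
  define s where "s = Max {k. k * k \<le> m}"
  have fin: "finite {k. k * k \<le> m}"
    by (rule finite_subset[of _ "{..m}"]) (auto intro: le_trans[OF le_square])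
  have "0 \<in> {k. k * k \<le> m}" by simp
  then have "s \<in> {k. k * k \<le> m}" unfolding s_def using Max_in[OF fin] by blast
  then have s: "s * s \<le> m" by simp
  have s': "m < Suc s * Suc s"
  proof (rule ccontr)
    assume "\<not> m < Suc s * Suc s"
    then have "Suc s \<in> {k. k * k \<le> m}" by (simp only: mem_Collect_eq not_less)
    then have "Suc s \<le> s" unfolding s_def using fin by (rule Max_ge[rotated])
    then show False by simp
  qed
  have "Suc k * Suc k \<le> m \<longleftrightarrow> k < s" for k
  proof
    assume "Suc k * Suc k \<le> m"
    then have "Suc k * Suc k < Suc s * Suc s" using s' by linarith
    then have "Suc k < Suc s" by (meson mult_le_mono not_less)
    then show "k < s" by simp
  next
    assume "k < s"
    then have "Suc k * Suc k \<le> s * s" by (intro mult_le_mono) auto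
    then show "Suc k * Suc k \<le> m" using s by linarith
  qed
  then have "isqrt m = (\<Sum>k<m. of_bool (k < s))" unfolding isqrt_def by simp
  also have "\<dots> = card ({..<m} \<inter> {k. k < s})" by (simp add: of_bool_def sum.If_cases)
  also have "{..<m} \<inter> {k. k < s} = {..<s}"
    using s le_trans[OF le_square[of s] s] by auto
  finally have "isqrt m = s" by simp
  then show "isqrt m * isqrt m \<le> m" "m < Suc (isqrt m) * Suc (isqrt m)" using s s' by auto
qed

text \<open>The torus occupies the first \<open>isqrt m * isqrt m\<close> points and the remaining
  points are fixed by its maps. The fifth map is a rotation that carries an initial segment onto
  these remaining points, and so ties each of them to the torus.\<close>

definition cluster_map :: "nat \<Rightarrow> nat \<Rightarrow> nat \<Rightarrow> nat" where
  "cluster_map m j l = (if j < 4 then (if l < isqrt m * isqrt m then torus_map (isqrt m) j l else l)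
     else (l + isqrt m * isqrt m) mod m)"

lemma cluster_map_less: "l < m \<Longrightarrow> cluster_map m j l < m"
  using torus_map_less[of l "isqrt m" j] isqrt(1)[of m] by (auto simp: cluster_map_def)

lemma cluster_map_inj: "inj_on (cluster_map m j) {..<m}"
proof (rule inj_onI)
  fix l l' assume l: "l \<in> {..<m}" "l' \<in> {..<m}" and eq: "cluster_map m j l = cluster_map m j l'"
  let ?n = "isqrt m"
  show "l = l'"
  proof (cases "j < 4")
    case True
    show ?thesis
    proof (cases "l < ?n * ?n \<longleftrightarrow> l' < ?n * ?n")
      case same: True
      then show ?thesis using True eq inj_onD[OF torus_map_inj[of ?n j], of l l']
        by (auto simp: cluster_map_def split: if_splits)
    next
      case False
      then show ?thesis using True eq torus_map_less[of l ?n j] torus_map_less[of l' ?n j]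
        by (auto simp: cluster_map_def split: if_splits)
    qed
  next
    case False
    then show ?thesis using l eq add_mod_inj[of l m l' "?n * ?n"] by (auto simp: cluster_map_def)
  qed
qed

lemma cluster_expansion:
  assumes m: "4 \<le> m" and Y: "Y \<subseteq> {..<m}"
  shows "min (card Y) (m - card Y) \<le> 3137 * (\<Sum>j<5. boundary m (cluster_map m j) Y)"
proof -
  let ?n = "isqrt m"
  let ?N = "?n * ?n"
  have n2: "?n \<ge> 2"
  proof (rule ccontr)
    assume "\<not> ?n \<ge> 2"
    then have "Suc ?n * Suc ?n \<le> 2 * 2" by (intro mult_le_mono) auto
    then show False using isqrt(2)[of m] m by simp
  qed
  have N: "?N \<le> m" by (rule isqrt)
  have "2 * ?n \<le> ?N" using n2 by simp
  moreover have "m < ?N + 2 * ?n + 1" using isqrt(2)[of m] by simp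
  ultimately have m2: "m \<le> 2 * ?N" by linarith
  define Y0 where "Y0 = Y \<inter> {..<?N}"
  have fY: "finite Y" using Y finite_subset by blast
  have core: "boundary ?N (torus_map ?n j) Y0 \<le> boundary m (cluster_map m j) Y" if "j < 4" for j
    unfolding boundary_def
  proof (rule card_mono)
    show "{l \<in> {..<?N}. (l \<in> Y0) \<noteq> (torus_map ?n j l \<in> Y0)} \<subseteq> {l \<in> {..<m}. (l \<in> Y) \<noteq> (cluster_map m j l \<in> Y)}"
      using that N torus_map_less[of _ ?n j] by (auto simp: Y0_def cluster_map_def)
  qed simp
  have s4: "(\<Sum>j<5. boundary m (cluster_map m j) Y) = (\<Sum>j<4. boundary m (cluster_map m j) Y) + boundary m (cluster_map m 4) Y"
    by (simp add: eval_nat_numeral)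
  have "(\<Sum>j<4. boundary ?N (torus_map ?n j) Y0) \<le> (\<Sum>j<4. boundary m (cluster_map m j) Y)"
    by (intro sum_mono core) simp
  then have min0: "min (card Y0) (?N - card Y0) \<le> 1568 * (\<Sum>j<4. boundary m (cluster_map m j) Y)"
    using torus_expansion[of Y0 ?n] by (simp add: Y0_def)
  let ?B = "{l \<in> {..<m}. (l \<in> Y) \<noteq> (cluster_map m 4 l \<in> Y)}"
  have rot: "cluster_map m 4 (l - ?N) = l" if "?N \<le> l" "l < m" for l
    using that by (simp add: cluster_map_def)
  \<comment> \<open>\<open>P\<close> stands for membership in \<open>Y\<close> or in its complement.
    A remaining point with \<open>P\<close> is moved back by the rotation to a torus point that has
    \<open>P\<close> or at which the rotation crosses \<open>Y\<close>.\<close>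
  have extra: "card {l \<in> {..<m} - {..<?N}. P l} \<le> card {l \<in> {..<?N}. P l} + card ?B"
    if P: "P = (\<lambda>l. l \<in> Y) \<or> P = (\<lambda>l. l \<notin> Y)" for P
  proof -
    have "card {l \<in> {..<m} - {..<?N}. P l} = card ((\<lambda>l. l - ?N) ` {l \<in> {..<m} - {..<?N}. P l})"
      by (intro card_image[symmetric] inj_onI) auto
    also have "\<dots> \<le> card ({l \<in> {..<?N}. P l} \<union> ?B)"
    proof (intro card_mono subsetI)
      fix k assume "k \<in> (\<lambda>l. l - ?N) ` {l \<in> {..<m} - {..<?N}. P l}"
      then obtain l where l: "k = l - ?N" "?N \<le> l" "l < m" "P l" by auto
      then have k: "k < ?N" "k < m" "cluster_map m 4 k = l" using m2 rot by auto
      show "k \<in> {l \<in> {..<?N}. P l} \<union> ?B"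
        using k l(4) P by (cases "P k") auto
    qed simp
    also have "\<dots> \<le> card {l \<in> {..<?N}. P l} + card ?B" by (rule card_Un_le)
    finally show ?thesis .
  qed
  have split: "card {l \<in> {..<m}. P l} = card {l \<in> {..<?N}. P l} + card {l \<in> {..<m} - {..<?N}. P l}" for P
  proof -
    have "{l \<in> {..<m}. P l} = {l \<in> {..<?N}. P l} \<union> {l \<in> {..<m} - {..<?N}. P l}" using N by auto
    then have "card {l \<in> {..<m}. P l} = card ({l \<in> {..<?N}. P l} \<union> {l \<in> {..<m} - {..<?N}. P l})"
      by (rule arg_cong)
    also have "\<dots> = card {l \<in> {..<?N}. P l} + card {l \<in> {..<m} - {..<?N}. P l}"
      by (rule card_Un_disjoint) auto
    finally show ?thesis .
  qed
  have YY: "{l \<in> {..<m}. l \<in> Y} = Y" "{l \<in> {..<?N}. l \<in> Y} = Y0" using Y by (auto simp: Y0_def)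
  have NY: "card {l \<in> {..<m}. l \<notin> Y} = m - card Y"
  proof -
    have "{l \<in> {..<m}. l \<notin> Y} = {..<m} - Y" by auto
    then show ?thesis using Y fY by (simp add: card_Diff_subset)
  qed
  have NY0: "card {l \<in> {..<?N}. l \<notin> Y} = ?N - card Y0"
  proof -
    have "{l \<in> {..<?N}. l \<notin> Y} = {..<?N} - Y0" by (auto simp: Y0_def)
    then show ?thesis by (simp add: card_Diff_subset Y0_def)
  qed
  have "card Y \<le> 2 * card Y0 + card ?B"
    using split[of "\<lambda>l. l \<in> Y"] extra[of "\<lambda>l. l \<in> Y"] unfolding YY by simp
  moreover have "m - card Y \<le> 2 * (?N - card Y0) + card ?B"
    using split[of "\<lambda>l. l \<notin> Y"] extra[of "\<lambda>l. l \<notin> Y"] unfolding NY NY0 by simp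
  ultimately have "min (card Y) (m - card Y) \<le> 2 * min (card Y0) (?N - card Y0) + card ?B"
    by (auto simp: min_def)
  also have "card ?B = boundary m (cluster_map m 4) Y" by (simp add: boundary_def)
  finally show ?thesis using min0 s4 by linarith
qed


section \<open>Replacing points by gadgets\<close>

text \<open>
  Six permutations \<open>s 0, \<dots>, s 5\<close> of \<open>{..<m}\<close> become a simple 4-regular graph: the point \<open>z\<close> is replaced
  by the ports \<open>12 * z + p\<close>, \<open>p < 12\<close>, on which a cubic circulant graph with differences \<open>5, 6, 7\<close> is
  placed, and the port \<open>2 * j\<close> of \<open>z\<close> is joined to the port \<open>2 * j + 1\<close> of \<open>s j z\<close>. As consecutive
  ports are not joined within a gadget, fixed points of \<open>s j\<close> do not create parallel edges.
\<close>

definition port_near :: "nat \<Rightarrow> nat \<Rightarrow> bool" where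
  "port_near p q \<longleftrightarrow> (p + 5 \<le> q \<and> q \<le> p + 7) \<or> (q + 5 \<le> p \<and> p \<le> q + 7)"

definition port_link :: "(nat \<Rightarrow> nat \<Rightarrow> nat) \<Rightarrow> nat \<Rightarrow> nat \<Rightarrow> bool" where
  "port_link s w w' \<longleftrightarrow> (w mod 12) mod 2 = 0 \<and> w' mod 12 = w mod 12 + 1 \<and>
     w' div 12 = s (w mod 12 div 2) (w div 12)"

definition port_adj :: "(nat \<Rightarrow> nat \<Rightarrow> nat) \<Rightarrow> nat \<Rightarrow> nat \<Rightarrow> bool" where
  "port_adj s w w' \<longleftrightarrow> (w div 12 = w' div 12 \<and> port_near (w mod 12) (w' mod 12)) \<or>
     port_link s w w' \<or> port_link s w' w"

definition port_graph :: "nat \<Rightarrow> (nat \<Rightarrow> nat \<Rightarrow> nat) \<Rightarrow> nat pair_pre_digraph" where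
  "port_graph m s = \<lparr>pverts = {..<12 * m}, parcs = {(w, w'). w < 12 * m \<and> w' < 12 * m \<and> port_adj s w w'}\<rparr>"

lemma vdeg_conv: "vdeg G v = card {w. (v, w) \<in> parcs G}"
proof -
  have "out_arcs (with_proj G) v = Pair v ` {w. (v, w) \<in> parcs G}"
    by (auto simp: out_arcs_def)
  then show ?thesis by (simp add: vdeg_def out_degree_def card_image inj_on_def)
qed

lemma port_near_sym: "port_near p q \<longleftrightarrow> port_near q p"
  by (auto simp: port_near_def)

lemma port_adj_sym: "port_adj s w w' \<longleftrightarrow> port_adj s w' w"
  by (auto simp: port_adj_def port_near_sym)

lemma port_adj_irrefl: "\<not> port_adj s w w"
  by (simp add: port_adj_def port_near_def port_link_def)

lemma port_graph_simps [simp]: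
  "pverts (port_graph m s) = {..<12 * m}"
  "(w, w') \<in> parcs (port_graph m s) \<longleftrightarrow> w < 12 * m \<and> w' < 12 * m \<and> port_adj s w w'"
  by (simp_all add: port_graph_def)

lemma pair_graph_intro:
  assumes "finite (pverts G)" "parcs G \<subseteq> pverts G \<times> pverts G" "sym (parcs G)" "irrefl (parcs G)"
  shows "pair_graph G"
proof
  show "finite (parcs G)" using assms(1,2) by (meson finite_SigmaI finite_subset)
  show "symmetric (with_proj G)" using assms(3) by (simp add: symmetric_def)
qed (use assms in \<open>auto simp: irrefl_def\<close>)

lemma pair_graph_port_graph: "pair_graph (port_graph m s)"
proof (rule pair_graph_intro)
  show "sym (parcs (port_graph m s))" using port_adj_sym by (auto simp: sym_def)
  show "irrefl (parcs (port_graph m s))" using port_adj_irrefl by (auto simp: irrefl_def)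
qed auto

lemma less_12E:
  assumes "p < (12 :: nat)"
  obtains "p = 0" | "p = 1" | "p = 2" | "p = 3" | "p = 4" | "p = 5" | "p = 6" | "p = 7"
    | "p = 8" | "p = 9" | "p = 10" | "p = 11"
proof -
  have "p = 0 \<or> p = 1 \<or> p = 2 \<or> p = 3 \<or> p = 4 \<or> p = 5 \<or> p = 6 \<or> p = 7 \<or> p = 8 \<or> p = 9 \<or> p = 10 \<or> p = 11"
    using assms by presburger
  then show thesis using that by blast
qed

lemma card_port_near:
  assumes "p < 12"
  shows "card {q. q < 12 \<and> port_near p q} = 3"
proof -
  let ?a = "(p + 5) mod 12" and ?b = "(p + 6) mod 12" and ?c = "(p + 7) mod 12"
  have "port_near p q \<longleftrightarrow> q = ?a \<or> q = ?b \<or> q = ?c" if "q < 12" for q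
    using assms that by (elim less_12E) (simp_all add: port_near_def)
  moreover have "?a < 12" "?b < 12" "?c < 12" by simp_all
  ultimately have S: "{q. q < 12 \<and> port_near p q} = {?a, ?b, ?c}" by blast
  have D: "?a \<noteq> ?b" "?a \<noteq> ?c" "?b \<noteq> ?c"
    using assms by (elim less_12E; simp)+
  have C: "card {a, b, c} = 3" if "a \<noteq> b" "a \<noteq> c" "b \<noteq> c" for a b c :: nat
    using that by simp
  show ?thesis unfolding S by (rule C[OF D])
qed

lemma even_port: "p < 12 \<Longrightarrow> p mod 2 = 0 \<Longrightarrow> p + 1 < (12 :: nat)"
  by presburger

lemma odd_port:
  assumes "p mod 2 \<noteq> (0 :: nat)"
  shows "p - 1 + 1 = p" "(p - 1) mod 2 = 0" "(p - 1) div 2 = p div 2"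
proof -
  have "odd p" using assms by (simp add: odd_iff_mod_2_eq_one)
  then obtain k where "p = 2 * k + 1" by (rule oddE)
  then show "p - 1 + 1 = p" "(p - 1) mod 2 = 0" "(p - 1) div 2 = p div 2" by simp_all
qed

lemma port_link_parity:
  assumes "port_link s w' w"
  shows "(w mod 12) mod 2 \<noteq> 0"
proof -
  have *: "b mod 2 \<noteq> 0" if "a mod 2 = 0" "b = a + 1" for a b :: nat using that by (simp add: mod_Suc)
  show ?thesis by (rule *[of "w' mod 12"]) (use assms in \<open>unfold port_link_def, blast+\<close>)
qed

text \<open>A port has three neighbours in its gadget and one across a link: an even port is joined
  to the image of its point, an odd one to the unique preimage, which is where bijectivity
  enters.\<close>

lemma port_graph_neighbours:
  assumes bij: "\<And>j. j < 6 \<Longrightarrow> bij_betw (s j) {..<m} {..<m}" and w: "w < 12 * m"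
  shows "card {w'. (w, w') \<in> parcs (port_graph m s)} = 4"
proof -
  let ?z = "w div 12" and ?p = "w mod 12"
  have z: "?z < m" using w by (simp add: less_mult_imp_div_less mult.commute)
  have p: "?p < 12" by simp
  have j: "?p div 2 < 6" by simp
  define I where "I = (\<lambda>q. 12 * ?z + q) ` {q. q < 12 \<and> port_near ?p q}"
  have I: "w' \<in> I \<longleftrightarrow> w' < 12 * m \<and> ?z = w' div 12 \<and> port_near ?p (w' mod 12)" for w'
  proof
    assume "w' \<in> I"
    then obtain q where "w' = 12 * ?z + q" "q < 12" "port_near ?p q" by (auto simp: I_def)
    moreover have "12 * ?z + q < 12 * m" using z calculation(2) by linarith
    ultimately show "w' < 12 * m \<and> ?z = w' div 12 \<and> port_near ?p (w' mod 12)" by simp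
  next
    assume "w' < 12 * m \<and> ?z = w' div 12 \<and> port_near ?p (w' mod 12)"
    moreover have "w' = 12 * (w' div 12) + w' mod 12" by simp
    ultimately show "w' \<in> I" unfolding I_def by (intro image_eqI[of _ _ "w' mod 12"]) auto
  qed
  have cI: "card I = 3"
    unfolding I_def using card_port_near[OF p] by (subst card_image) (auto simp: inj_on_def)
  obtain x where x: "x < 12 * m" "\<And>w'. w' < 12 * m \<and> (port_link s w w' \<or> port_link s w' w) \<longleftrightarrow> w' = x"
  proof (cases "?p mod 2 = 0")
    case True
    let ?x = "12 * s (?p div 2) ?z + (?p + 1)"
    have p11: "?p + 1 < 12" using even_port[OF p True] .
    have sz: "s (?p div 2) ?z < m" using bij_betwE[OF bij[OF j]] z by auto
    show ?thesis
    proof (rule that[of ?x])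
      show "?x < 12 * m" using sz p11 by linarith
      fix w'
      have "port_link s w w' \<longleftrightarrow> w' = ?x"
      proof
        assume "port_link s w w'"
        then have "w' div 12 = s (?p div 2) ?z" "w' mod 12 = ?p + 1" by (auto simp: port_link_def)
        then show "w' = ?x" by (metis mult_div_mod_eq)
      next
        assume e: "w' = ?x"
        have "w' div 12 = s (?p div 2) ?z" "w' mod 12 = ?p + 1"
          unfolding e using p11 by simp_all
        then show "port_link s w w'" using True by (simp add: port_link_def)
      qed
      moreover have "\<not> port_link s w' w"
        using True port_link_parity[of s w' w] by auto
      ultimately show "w' < 12 * m \<and> (port_link s w w' \<or> port_link s w' w) \<longleftrightarrow> w' = ?x"
        using \<open>?x < 12 * m\<close> by auto
    qed
  next
    case False
    let ?j = "?p div 2"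
    have p1: "?p - 1 + 1 = ?p" "(?p - 1) mod 2 = 0" "(?p - 1) div 2 = ?j" "?p - 1 < 12"
      using odd_port[OF False] p by auto
    obtain y where y: "y < m" "s ?j y = ?z"
      using bij_betw_imp_surj_on[OF bij[OF j]] z by (metis imageE lessThan_iff)
    have yu: "y' = y" if "y' < m" "s ?j y' = ?z" for y'
      by (rule inj_onD[OF bij_betw_imp_inj_on[OF bij[OF j]]]) (use that y in auto)
    let ?x = "12 * y + (?p - 1)"
    have xd: "?x div 12 = y" "?x mod 12 = ?p - 1" using p1(4) by simp_all
    show ?thesis
    proof (rule that[of ?x])
      show x: "?x < 12 * m" using y p1(4) by linarith
      fix w'
      have "w' < 12 * m \<and> port_link s w' w \<longleftrightarrow> w' = ?x"
      proof
        assume l: "w' < 12 * m \<and> port_link s w' w"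
        then have m': "w' mod 12 = ?p - 1" "s (w' mod 12 div 2) (w' div 12) = ?z" by (auto simp: port_link_def)
        have "w' div 12 < m" using l by (simp add: less_mult_imp_div_less mult.commute)
        then have "w' div 12 = y" using m' p1(3) by (intro yu) auto
        then show "w' = ?x" using m'(1) by (metis mult_div_mod_eq)
      next
        assume e: "w' = ?x"
        show "w' < 12 * m \<and> port_link s w' w"
          unfolding e port_link_def xd using x p1 y(2) by (auto simp only:)
      qed
      moreover have "\<not> port_link s w w'" using False by (simp add: port_link_def)
      ultimately show "w' < 12 * m \<and> (port_link s w w' \<or> port_link s w' w) \<longleftrightarrow> w' = ?x" by blast
    qed
  qed
  have "{w'. (w, w') \<in> parcs (port_graph m s)} = insert x I"
    using w x I by (auto simp: port_adj_def)
  \<comment> \<open>The ends of a link carry consecutive port numbers, which are never near; this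
    covers links that return to the same gadget.\<close>
  moreover have "x \<notin> I"
  proof
    assume "x \<in> I"
    then have "port_near ?p (x mod 12)" using I by blast
    moreover have "x mod 12 = ?p + 1 \<or> ?p = x mod 12 + 1"
      using x by (auto simp: port_link_def)
    ultimately show False by (auto simp: port_near_def)
  qed
  moreover have "finite I" unfolding I_def by simp
  ultimately show ?thesis using cI by simp
qed

lemma regular_port_graph:
  assumes "\<And>j. j < 6 \<Longrightarrow> bij_betw (s j) {..<m} {..<m}"
  shows "regular 4 (port_graph m s)"
  using port_graph_neighbours[OF assms] by (simp add: regular_def vdeg_conv)

lemma vol_regular:
  assumes "regular d G" "S \<subseteq> pverts G"
  shows "vol G S = d * card S"
  using assms by (simp add: vol_def regular_def subset_iff mult.commute)

lemma card_gadgets: "card {w :: nat. w div 12 \<in> Y} = 12 * card Y"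
proof -
  have "bij_betw (\<lambda>(z, p). 12 * z + p) (Y \<times> {..<12}) {w. w div 12 \<in> Y}"
    by (rule bij_betw_byWitness[where f' = "\<lambda>w. (w div 12, w mod 12)"]) auto
  from bij_betw_same_card[OF this] show ?thesis by (simp add: card_cartesian_product)
qed

text \<open>Steps by 5 modulo 12 run through all ports, because 5 and 12 are coprime; each step is a
  difference of 5 or 7.\<close>

lemma port_connected:
  assumes "\<And>p q. p < 12 \<Longrightarrow> q < 12 \<Longrightarrow> port_near p q \<Longrightarrow> P p \<Longrightarrow> P q" "p < 12" "q < 12" "P p"
  shows "P q"
proof -
  have e: "P a = P b" if "a < 12" "b < 12" "port_near a b" for a b
    using assms(1) that port_near_sym by blast
  have "P 5 = P 0" "P 10 = P 5" "P 3 = P 10" "P 8 = P 3" "P 1 = P 8" "P 6 = P 1" "P 11 = P 6"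
    "P 4 = P 11" "P 9 = P 4" "P 2 = P 9" "P 7 = P 2"
    by (rule e; simp add: port_near_def)+
  then have "P a = P 0" if "a < 12" for a using that by (elim less_12E) simp_all
  then show ?thesis using assms(2-4) by blast
qed

text \<open>Port 0 decides for its gadget. A gadget on which \<open>X\<close> is not constant is
  connected, hence contains a crossing arc of its own, so at most \<open>e\<close> gadgets are
  damaged. This costs 12 ports each in the cardinality; a point counted in the boundary is damaged,
  has a damaged image, or has a crossing link, whence the factor 3.\<close>

lemma port_graph_rounding:
  assumes bij: "\<And>j. j < 6 \<Longrightarrow> bij_betw (s j) {..<m} {..<m}" and X: "X \<subseteq> {..<12 * m}"
  defines "Y \<equiv> {z. z < m \<and> 12 * z \<in> X}"
  defines "e \<equiv> crossing (port_graph m s) X"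
  shows "\<And>j. j < 6 \<Longrightarrow> boundary m (s j) Y \<le> 3 * e"
    and "card X \<le> 12 * card Y + 12 * e" and "12 * card Y \<le> card X + 12 * e"
proof -
  define Cr where "Cr = {(u, v) \<in> parcs (port_graph m s). u \<in> X \<and> v \<in> pverts (port_graph m s) - X}"
  have fCr: "finite Cr" by (rule finite_subset[of _ "{..<12 * m} \<times> {..<12 * m}"]) (auto simp: Cr_def)
  have e: "e = card Cr" by (simp add: e_def crossing_def Cr_def)
  define B where "B = {z. z < m \<and> \<not> (\<forall>p<12. 12 * z + p \<in> X \<longleftrightarrow> z \<in> Y)}"
  have fB: "finite B" by (simp add: B_def)
  have z12: "12 * z + p < 12 * m" if "z < m" "p < 12" for z p using that by linarith
  have Beq: "12 * z + p \<in> X \<longleftrightarrow> z \<in> Y" if "z < m" "z \<notin> B" "p < 12" for z p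
    using that by (simp add: B_def)
  have "B \<subseteq> (\<lambda>(w, w'). w div 12) ` Cr"
  proof
    fix z assume "z \<in> B"
    then obtain p where z: "z < m" and p: "p < 12" "12 * z + p \<in> X \<longleftrightarrow> 12 * z \<notin> X"
      by (auto simp: B_def Y_def)
    have "\<exists>a b. a < 12 \<and> b < 12 \<and> port_near a b \<and> 12 * z + a \<in> X \<and> 12 * z + b \<notin> X"
    proof (rule ccontr)
      assume "\<not> ?thesis"
      then have c: "\<And>a b. a < 12 \<Longrightarrow> b < 12 \<Longrightarrow> port_near a b \<Longrightarrow> 12 * z + a \<in> X \<Longrightarrow> 12 * z + b \<in> X" by blast
      have "12 * z + p \<in> X \<longleftrightarrow> 12 * z + 0 \<in> X"
        using port_connected[of "\<lambda>a. 12 * z + a \<in> X" p 0, OF c] port_connected[of "\<lambda>a. 12 * z + a \<in> X" 0 p, OF c] p(1)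
        by auto
      then show False using p(2) by simp
    qed
    then obtain a b where ab: "a < 12" "b < 12" "port_near a b" "12 * z + a \<in> X" "12 * z + b \<notin> X" by blast
    then have "(12 * z + a, 12 * z + b) \<in> Cr"
      using z12[OF z] by (simp add: Cr_def port_adj_def)
    then show "z \<in> (\<lambda>(w, w'). w div 12) ` Cr"
      using ab(1) by (intro image_eqI[of _ _ "(12 * z + a, 12 * z + b)"]) auto
  qed
  then have Be: "card B \<le> e" unfolding e using fCr by (meson card_image_le card_mono finite_imageI le_trans)
  show "boundary m (s j) Y \<le> 3 * e" if j: "j < 6" for j
  proof -
    let ?D = "{z \<in> {..<m}. (z \<in> Y) \<noteq> (s j z \<in> Y)}"
    \<comment> \<open>The crossing arc over a link may run in either direction; \<open>?f\<close>
      recovers the point at its even port, so that distinct points are charged to distinct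
      arcs.\<close>
    let ?f = "\<lambda>(w, w'). if w mod 12 = 2 * j then w div 12 else w' div 12"
    have sm: "s j z < m" if "z < m" for z using bij_betwE[OF bij[OF j]] that by auto
    have "?D \<subseteq> B \<union> {z. z < m \<and> s j z \<in> B} \<union> ?f ` Cr"
    proof
      fix z assume "z \<in> ?D"
      then have z: "z < m" "(z \<in> Y) \<noteq> (s j z \<in> Y)" by auto
      show "z \<in> B \<union> {z. z < m \<and> s j z \<in> B} \<union> ?f ` Cr"
      proof (cases "z \<in> B \<or> s j z \<in> B")
        case False
        let ?w = "12 * z + 2 * j" and ?w' = "12 * s j z + (2 * j + 1)"
        have lt: "2 * j < 12" "2 * j + 1 < 12" using j by auto
        have dm: "?w div 12 = z" "?w mod 12 = 2 * j" "?w' div 12 = s j z" "?w' mod 12 = 2 * j + 1"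
          using lt by simp_all
        have wX: "?w \<in> X \<longleftrightarrow> z \<in> Y" "?w' \<in> X \<longleftrightarrow> s j z \<in> Y"
          using False by (intro Beq z sm lt; blast)+
        have "port_link s ?w ?w'" unfolding port_link_def dm by simp
        then have "port_adj s ?w ?w'" "port_adj s ?w' ?w" unfolding port_adj_def by blast+
        then have "(?w, ?w') \<in> Cr \<or> (?w', ?w) \<in> Cr"
          using wX z(2) z12[OF z(1) lt(1)] z12[OF sm[OF z(1)] lt(2)]
          by (cases "z \<in> Y") (simp_all add: Cr_def)
        then have "z \<in> ?f ` Cr"
        proof
          assume "(?w, ?w') \<in> Cr"
          from imageI[OF this, of ?f] show ?thesis unfolding split dm by simp
        next
          assume "(?w', ?w) \<in> Cr"
          from imageI[OF this, of ?f] show ?thesis unfolding split dm by simp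
        qed
        then show ?thesis by blast
      qed (use z in auto)
    qed
    then have "card ?D \<le> card (B \<union> {z. z < m \<and> s j z \<in> B} \<union> ?f ` Cr)"
      using fB fCr by (intro card_mono) auto
    also have "\<dots> \<le> card B + card {z. z < m \<and> s j z \<in> B} + card (?f ` Cr)"
      by (meson add_le_mono card_Un_le le_trans order_refl)
    also have "card {z. z < m \<and> s j z \<in> B} = card (s j ` {z. z < m \<and> s j z \<in> B})"
      by (rule card_image[symmetric]) (rule inj_on_subset[OF bij_betw_imp_inj_on[OF bij[OF j]]], auto)
    also have "\<dots> \<le> card B" by (rule card_mono[OF fB]) auto
    also have "card (?f ` Cr) \<le> e" unfolding e by (rule card_image_le[OF fCr])
    finally show ?thesis using Be by (simp add: boundary_def)
  qed
  have fX: "finite X" using X finite_subset by blast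
  define XB where "XB = {w \<in> {..<12 * m}. w div 12 \<in> B}"
  have cXB: "card XB \<le> 12 * card B"
  proof -
    have "XB \<subseteq> (\<lambda>(z, p). 12 * z + p) ` (B \<times> {..<12})"
    proof
      fix w assume "w \<in> XB"
      then show "w \<in> (\<lambda>(z, p). 12 * z + p) ` (B \<times> {..<12})"
        by (intro image_eqI[of _ _ "(w div 12, w mod 12)"]) (auto simp: XB_def)
    qed
    then have "card XB \<le> card ((\<lambda>(z, p). 12 * z + p) ` (B \<times> {..<12 :: nat}))"
      using fB by (intro card_mono) auto
    also have "\<dots> \<le> card (B \<times> {..<12 :: nat})" using fB by (intro card_image_le) auto
    finally show ?thesis by (simp add: card_cartesian_product)
  qed
  define XY where "XY = {w \<in> {..<12 * m}. w div 12 \<in> Y}"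
  have cXY: "card XY = 12 * card Y"
  proof -
    have "XY = {w. w div 12 \<in> Y}"
      by (auto simp: XY_def Y_def)
    then show ?thesis by (simp add: card_gadgets)
  qed
  have wB: "w \<in> X \<longleftrightarrow> w \<in> XY" if "w < 12 * m" "w \<notin> XB" for w
  proof -
    have "w div 12 < m" using that(1) by (simp add: less_mult_imp_div_less mult.commute)
    moreover have "w div 12 \<notin> B" using that by (simp add: XB_def)
    moreover have "w = 12 * (w div 12) + w mod 12" by simp
    moreover have "w mod 12 < 12" by simp
    ultimately show ?thesis using that(1) unfolding B_def XY_def by (metis (mono_tags, lifting) lessThan_iff mem_Collect_eq)
  qed
  have fin: "finite XB" "finite XY" by (auto simp: XB_def XY_def)
  have "X \<subseteq> XY \<union> XB" using wB X by blast
  then have "card X \<le> card XY + card XB"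
    by (meson card_Un_le card_mono fin finite_UnI le_trans)
  then show "card X \<le> 12 * card Y + 12 * e" using cXY cXB Be by linarith
  have "XY \<subseteq> X \<union> XB" using wB by (auto simp: XY_def)
  then have "card XY \<le> card X + card XB"
    by (meson card_Un_le card_mono fin fX finite_UnI le_trans)
  then show "12 * card Y \<le> card X + 12 * e" using cXY cXB Be by linarith
qed

text \<open>A union of whole gadgets is crossed by links only, and a link between \<open>z\<close>
  and \<open>s j z\<close> crosses exactly if the map moves \<open>z\<close> across
  \<open>Y\<close>.\<close>

lemma crossing_gadgets:
  assumes Y: "Y \<subseteq> {..<m}"
  defines "X \<equiv> {w \<in> {..<12 * m}. w div 12 \<in> Y}"
  shows "crossing (port_graph m s) X \<le> (\<Sum>j<6. boundary m (s j) Y)"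
    and "card X = 12 * card Y"
proof -
  define Cr where "Cr = {(u, v) \<in> parcs (port_graph m s). u \<in> X \<and> v \<in> pverts (port_graph m s) - X}"
  let ?D = "\<lambda>j. {z \<in> {..<m}. (z \<in> Y) \<noteq> (s j z \<in> Y)}"
  let ?g = "\<lambda>(j, z). if z \<in> Y then (12 * z + 2 * j, 12 * s j z + (2 * j + 1)) else (12 * s j z + (2 * j + 1), 12 * z + 2 * j)"
  have "Cr \<subseteq> ?g ` (SIGMA j:{..<6}. ?D j)"
  proof
    fix a assume "a \<in> Cr"
    then obtain w w' where a: "a = (w, w')" "w < 12 * m" "w' < 12 * m" "port_adj s w w'"
      and c: "w div 12 \<in> Y" "w' div 12 \<notin> Y" by (auto simp: Cr_def X_def)
    then consider "port_link s w w'" | "port_link s w' w" by (auto simp: port_adj_def)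
    then show "a \<in> ?g ` (SIGMA j:{..<6}. ?D j)"
    proof cases
      case 1
      let ?j = "w mod 12 div 2"
      have 1: "w' div 12 = s ?j (w div 12)" "w mod 12 = 2 * ?j" "w' mod 12 = 2 * ?j + 1"
        using 1 by (auto simp: port_link_def)
      have "w = 12 * (w div 12) + 2 * ?j" "w' = 12 * s ?j (w div 12) + (2 * ?j + 1)"
        using 1 by (metis mult_div_mod_eq)+
      moreover have "w div 12 < m" using a(2) by (simp add: less_mult_imp_div_less mult.commute)
      moreover have "?j < 6" by simp
      ultimately show ?thesis
        using c 1 a(1) by (intro image_eqI[of _ _ "(?j, w div 12)"]) (simp_all only: split if_True mem_Sigma_iff lessThan_iff mem_Collect_eq, auto)
    next
      case 2
      let ?j = "w' mod 12 div 2"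
      have 2: "w div 12 = s ?j (w' div 12)" "w' mod 12 = 2 * ?j" "w mod 12 = 2 * ?j + 1"
        using 2 by (auto simp: port_link_def)
      have "w' = 12 * (w' div 12) + 2 * ?j" "w = 12 * s ?j (w' div 12) + (2 * ?j + 1)"
        using 2 by (metis mult_div_mod_eq)+
      moreover have "w' div 12 < m" using a(3) by (simp add: less_mult_imp_div_less mult.commute)
      moreover have "?j < 6" by simp
      ultimately show ?thesis
        using c 2 a(1) by (intro image_eqI[of _ _ "(?j, w' div 12)"]) (simp_all only: split if_False mem_Sigma_iff lessThan_iff mem_Collect_eq, auto)
    qed
  qed
  then have "card Cr \<le> card (SIGMA j:{..<6::nat}. ?D j)"
    by (rule surj_card_le[rotated]) auto
  also have "\<dots> = (\<Sum>j<6. boundary m (s j) Y)"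
    by (simp add: boundary_def)
  finally show "crossing (port_graph m s) X \<le> (\<Sum>j<6. boundary m (s j) Y)"
    by (simp add: crossing_def Cr_def)
  have "X = {w. w div 12 \<in> Y}"
  proof -
    have "w < 12 * m" if "w div 12 \<in> Y" for w
    proof -
      have "w div 12 < m" using that Y by blast
      then show ?thesis by linarith
    qed
    then show ?thesis by (auto simp: X_def)
  qed
  then show "card X = 12 * card Y" by (simp add: card_gadgets)
qed


section \<open>Replacing vertices by clusters\<close>

text \<open>
  A graph on \<open>{..<n}\<close> is given by its adjacency matrix \<open>A\<close>, read row by row. Its arcs are numbered in this
  order; the arc with number \<open>a\<close> gives rise to the points \<open>4 * a, \<dots>, 4 * a + 3\<close>, and the points of the
  arcs with tail \<open>u\<close> form the cluster of \<open>u\<close>.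
\<close>

definition cum :: "(nat \<Rightarrow> bool) \<Rightarrow> nat \<Rightarrow> nat" where
  "cum A t = (\<Sum>i<t. of_bool (A i))"

text \<open>The inverse of the rank function \<open>cum\<close>: the number of positions up to which
  at most \<open>a\<close> arcs have been seen is the position of arc number \<open>a\<close>.
  Counting keeps it definable by a bounded sum.\<close>

definition arc_pos :: "nat \<Rightarrow> (nat \<Rightarrow> bool) \<Rightarrow> nat \<Rightarrow> nat" where
  "arc_pos n A a = (\<Sum>t<n * n. of_bool (cum A (Suc t) \<le> a))"

definition arc_tail :: "nat \<Rightarrow> (nat \<Rightarrow> bool) \<Rightarrow> nat \<Rightarrow> nat" where
  "arc_tail n A a = arc_pos n A a div n"

definition arc_head :: "nat \<Rightarrow> (nat \<Rightarrow> bool) \<Rightarrow> nat \<Rightarrow> nat" where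
  "arc_head n A a = arc_pos n A a mod n"

definition arc_rev :: "nat \<Rightarrow> (nat \<Rightarrow> bool) \<Rightarrow> nat \<Rightarrow> nat" where
  "arc_rev n A a = cum A (arc_head n A a * n + arc_tail n A a)"

definition outdeg :: "nat \<Rightarrow> (nat \<Rightarrow> bool) \<Rightarrow> nat \<Rightarrow> nat" where
  "outdeg n A u = cum A (Suc u * n) - cum A (u * n)"

definition inner_map :: "nat \<Rightarrow> (nat \<Rightarrow> bool) \<Rightarrow> nat \<Rightarrow> nat \<Rightarrow> nat \<Rightarrow> nat" where
  "inner_map n A u j z = 4 * cum A (u * n) + cluster_map (4 * outdeg n A u) j (z - 4 * cum A (u * n))"

definition point_map :: "nat \<Rightarrow> (nat \<Rightarrow> bool) \<Rightarrow> nat \<Rightarrow> nat \<Rightarrow> nat" where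
  "point_map n A j z = (if j < 5 then inner_map n A (arc_tail n A (z div 4)) j z
     else 4 * arc_rev n A (z div 4) + z mod 4)"

lemma cum_Suc: "cum A (Suc t) = cum A t + of_bool (A t)"
  by (simp add: cum_def)

lemma cum_mono: "s \<le> t \<Longrightarrow> cum A s \<le> cum A t"
  unfolding cum_def by (rule sum_mono2) auto

lemma cum_le_iff: "A t \<Longrightarrow> cum A s \<le> cum A t \<longleftrightarrow> s \<le> t"
  using cum_mono[of s t A] cum_mono[of "Suc t" s A] cum_Suc[of A t] by (cases "s \<le> t") auto

lemma div_4_less_iff: "z div 4 < m \<longleftrightarrow> z < 4 * (m :: nat)"
  by (simp add: div_less_iff_less_mult mult.commute)

lemma card_fours: "card {z. z < 4 * m \<and> P (z div 4)} = 4 * card {a :: nat. a < m \<and> P a}"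
proof -
  have "bij_betw (\<lambda>(a, k). 4 * a + k) ({a :: nat. a < m \<and> P a} \<times> {..<4}) {z. z < 4 * m \<and> P (z div 4)}"
    by (rule bij_betw_byWitness[where f' = "\<lambda>z. (z div 4, z mod 4)"]) auto
  from bij_betw_same_card[OF this] show ?thesis by (simp add: card_cartesian_product)
qed

locale adjacency =
  fixes n :: nat and A :: "nat \<Rightarrow> bool"
  assumes A_less: "A t \<Longrightarrow> t < n * n"
    and A_sym: "u < n \<Longrightarrow> v < n \<Longrightarrow> A (u * n + v) \<Longrightarrow> A (v * n + u)"
begin

abbreviation N :: nat where "N \<equiv> cum A (n * n)"

lemma cum_less: "A t \<Longrightarrow> cum A t < N"
  using cum_mono[of "Suc t" "n * n" A] A_less[of t] cum_Suc[of A t] by simp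

lemma arc_pos_cum: "A t \<Longrightarrow> arc_pos n A (cum A t) = t"
proof -
  assume A: "A t"
  have "cum A (Suc s) \<le> cum A t \<longleftrightarrow> s < t" for s
    using cum_le_iff[of A t "Suc s", OF A] by (simp add: Suc_le_eq)
  then have "arc_pos n A (cum A t) = (\<Sum>s<n * n. of_bool (s < t))"
    unfolding arc_pos_def by simp
  also have "\<dots> = card ({..<n * n} \<inter> {s. s < t})"
    by (simp add: of_bool_def sum.If_cases)
  also have "{..<n * n} \<inter> {s. s < t} = {..<t}" using A_less[OF A] by auto
  finally show ?thesis by simp
qed

lemma arcE:
  assumes "a < N"
  obtains t where "A t" "cum A t = a" "arc_pos n A a = t"
proof -
  have "\<exists>t. A t \<and> cum A t = a"
  proof -
    define t where "t = (LEAST t. a < cum A (Suc t))"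
    have "a < cum A (Suc (n * n))" using assms cum_mono[of "n * n" "Suc (n * n)" A] by linarith
    then have 1: "a < cum A (Suc t)" unfolding t_def by (rule LeastI)
    have 2: "cum A t \<le> a"
    proof (cases t)
      case (Suc s)
      then show ?thesis using not_less_Least[of s "\<lambda>t. a < cum A (Suc t)"] unfolding t_def[symmetric] by simp
    qed (simp add: cum_def)
    then show ?thesis using 1 cum_Suc[of A t] by (intro exI[of _ t]) (cases "A t"; simp)
  qed
  then show thesis using that arc_pos_cum by blast
qed

lemma arc_less:
  assumes "a < N"
  shows "arc_tail n A a < n" "arc_head n A a < n"
proof -
  obtain t where t: "A t" "arc_pos n A a = t" using arcE[OF assms] by blast
  then have "t < n * n" using A_less by blast
  then have "n > 0" "t div n < n" by (auto simp: less_mult_imp_div_less intro: Nat.gr0I)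
  then show "arc_tail n A a < n" "arc_head n A a < n"
    unfolding arc_tail_def arc_head_def t(2) by auto
qed

lemma A_arc:
  assumes "a < N"
  shows "A (arc_tail n A a * n + arc_head n A a)" "cum A (arc_tail n A a * n + arc_head n A a) = a"
  using arcE[OF assms] by (auto simp: arc_tail_def arc_head_def)

lemma arc_of_pair:
  assumes "u < n" "v < n" "A (u * n + v)"
  shows "cum A (u * n + v) < N" "arc_tail n A (cum A (u * n + v)) = u" "arc_head n A (cum A (u * n + v)) = v"
  using assms by (simp_all add: cum_less arc_pos_cum arc_tail_def arc_head_def)

lemma arc_rev:
  assumes "a < N"
  shows "arc_rev n A a < N" "arc_tail n A (arc_rev n A a) = arc_head n A a"
    "arc_head n A (arc_rev n A a) = arc_tail n A a" "arc_rev n A (arc_rev n A a) = a"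
proof -
  have "A (arc_head n A a * n + arc_tail n A a)"
    using A_sym A_arc(1) arc_less assms by blast
  from arc_of_pair[OF arc_less(2,1)[OF assms] this]
  show 1: "arc_rev n A a < N" "arc_tail n A (arc_rev n A a) = arc_head n A a"
    "arc_head n A (arc_rev n A a) = arc_tail n A a" by (simp_all add: arc_rev_def)
  show "arc_rev n A (arc_rev n A a) = a"
    unfolding arc_rev_def[of n A "arc_rev n A a"] 1 using A_arc(2)[OF assms] .
qed

text \<open>Reading the matrix row by row numbers the arcs with a common tail consecutively, so
  every cluster is an interval.\<close>

lemma arc_tail_iff:
  assumes "a < N" "u < n"
  shows "arc_tail n A a = u \<longleftrightarrow> cum A (u * n) \<le> a \<and> a < cum A (Suc u * n)"
proof -
  obtain t where t: "A t" "cum A t = a" "arc_pos n A a = t" using arcE[OF assms(1)] by blast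
  have n: "n > 0" using assms(2) by simp
  have "cum A (u * n) \<le> a \<and> a < cum A (Suc u * n) \<longleftrightarrow> u * n \<le> t \<and> t < Suc u * n"
    using cum_le_iff[of A t, OF t(1)] unfolding t(2)[symmetric] by (metis not_less)
  also have "\<dots> \<longleftrightarrow> t div n = u"
    using less_eq_div_iff_mult_less_eq[OF n, of u t] div_less_iff_less_mult[OF n, of t "Suc u"] by auto
  finally show ?thesis by (simp add: arc_tail_def t(3))
qed

lemma start_le: "u < n \<Longrightarrow> cum A (Suc u * n) \<le> N"
  by (intro cum_mono mult_le_mono1 Suc_leI)

lemma cum_outdeg: "cum A (u * n) + outdeg n A u = cum A (Suc u * n)"
  unfolding outdeg_def using cum_mono[of "u * n" "Suc u * n" A] by simp

definition cluster :: "nat \<Rightarrow> nat set" where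
  "cluster u = {4 * cum A (u * n) ..< 4 * cum A (u * n) + 4 * outdeg n A u}"

lemma cluster_conv: "cluster u = {4 * cum A (u * n) ..< 4 * cum A (Suc u * n)}"
  unfolding cluster_def cum_outdeg[symmetric] by simp

lemma in_cluster_iff:
  assumes "u < n"
  shows "z \<in> cluster u \<longleftrightarrow> z < 4 * N \<and> arc_tail n A (z div 4) = u"
proof -
  have "z \<in> cluster u \<longleftrightarrow> cum A (u * n) \<le> z div 4 \<and> z div 4 < cum A (Suc u * n)"
    unfolding cluster_conv by auto
  then show ?thesis
    using arc_tail_iff[of "z div 4" u] assms start_le[OF assms] div_4_less_iff[of z N] by (meson less_le_trans)
qed

lemma point_cluster:
  assumes "z < 4 * N"
  shows "z \<in> cluster (arc_tail n A (z div 4))" "arc_tail n A (z div 4) < n"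
proof -
  show u: "arc_tail n A (z div 4) < n" using assms div_4_less_iff by (intro arc_less) blast
  show "z \<in> cluster (arc_tail n A (z div 4))" using in_cluster_iff[OF u] assms by blast
qed

lemma inner_map_cluster: "z \<in> cluster u \<Longrightarrow> inner_map n A u j z \<in> cluster u"
  using cluster_map_less[of "z - 4 * cum A (u * n)" "4 * outdeg n A u" j]
  by (auto simp: cluster_def inner_map_def)

lemma point_map_inner: "z \<in> cluster u \<Longrightarrow> u < n \<Longrightarrow> j < 5 \<Longrightarrow> point_map n A j z = inner_map n A u j z"
  using in_cluster_iff by (simp add: point_map_def)

text \<open>The inner maps permute each cluster, and the last map is the involution that reverses
  the arc and keeps the index among its four points.\<close>

lemma bij_point_map: "bij_betw (point_map n A j) {..<4 * N} {..<4 * N}"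
proof -
  have "point_map n A j ` {..<4 * N} \<subseteq> {..<4 * N}"
  proof
    fix y assume "y \<in> point_map n A j ` {..<4 * N}"
    then obtain z where z: "z < 4 * N" "y = point_map n A j z" by auto
    show "y \<in> {..<4 * N}"
    proof (cases "j < 5")
      case True
      then have "y \<in> cluster (arc_tail n A (z div 4))"
        using z point_map_inner[OF point_cluster] inner_map_cluster point_cluster(1) by metis
      then show ?thesis using in_cluster_iff[OF point_cluster(2)[OF z(1)]] by auto
    next
      case False
      have "arc_rev n A (z div 4) < N" using z div_4_less_iff by (intro arc_rev) blast
      moreover have "z mod 4 < 4" by simp
      ultimately have "4 * arc_rev n A (z div 4) + z mod 4 < 4 * N" by linarith
      then show ?thesis using False z by (simp add: point_map_def)
    qed
  qed
  moreover have "inj_on (point_map n A j) {..<4 * N}"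
  proof (rule inj_onI)
    fix y z assume y: "y \<in> {..<4 * N}" and z: "z \<in> {..<4 * N}" and eq: "point_map n A j y = point_map n A j z"
    show "y = z"
    proof (cases "j < 5")
      case True
      let ?u = "arc_tail n A (y div 4)" and ?v = "arc_tail n A (z div 4)"
      have u: "y \<in> cluster ?u" "?u < n" "z \<in> cluster ?v" "?v < n" using y z point_cluster by auto
      have e: "inner_map n A ?u j y = inner_map n A ?v j z"
        using eq point_map_inner u True by simp
      have "inner_map n A ?u j y \<in> cluster ?u" "inner_map n A ?v j z \<in> cluster ?v"
        using u inner_map_cluster by auto
      then have uv: "?u = ?v" using e in_cluster_iff u by metis
      have "cluster_map (4 * outdeg n A ?u) j (y - 4 * cum A (?u * n)) =
          cluster_map (4 * outdeg n A ?u) j (z - 4 * cum A (?u * n))"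
        using e uv by (simp add: inner_map_def)
      then have "y - 4 * cum A (?u * n) = z - 4 * cum A (?u * n)"
        by (rule inj_onD[OF cluster_map_inj]) (use u uv in \<open>auto simp: cluster_def less_diff_conv2 add.commute\<close>)
      moreover have "4 * cum A (?u * n) \<le> y" "4 * cum A (?u * n) \<le> z"
        using u uv by (auto simp: cluster_def)
      ultimately show ?thesis by (simp only: eq_diff_iff)
    next
      case False
      have "(4 * arc_rev n A (y div 4) + y mod 4) div 4 = (4 * arc_rev n A (z div 4) + z mod 4) div 4"
        "(4 * arc_rev n A (y div 4) + y mod 4) mod 4 = (4 * arc_rev n A (z div 4) + z mod 4) mod 4"
        using eq False by (simp_all add: point_map_def)
      then have 1: "arc_rev n A (y div 4) = arc_rev n A (z div 4)" "y mod 4 = z mod 4" by simp_all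
      have "y div 4 < N" "z div 4 < N" using y z div_4_less_iff by auto
      then have "y div 4 = z div 4" using 1(1) arc_rev(4) by metis
      then show ?thesis using 1(2) by (metis mult_div_mod_eq)
    qed
  qed
  ultimately show ?thesis by (simp add: bij_betw_def endo_inj_surj)
qed

text \<open>\<open>S\<close> is the majority vote in each cluster. The misclassified points of a
  cluster are then its minority, which the expansion of the cluster bounds; clusters are disjoint,
  so their boundaries add up to at most the whole boundary.\<close>

lemma cluster_rounding:
  assumes Y: "Y \<subseteq> {..<4 * N}"
  defines "Yc \<equiv> \<lambda>u. {l. l < 4 * outdeg n A u \<and> 4 * cum A (u * n) + l \<in> Y}"
  defines "S \<equiv> {u. u < n \<and> 4 * outdeg n A u < 2 * card (Yc u)}"
  shows "card {z. z < 4 * N \<and> (z \<in> Y) \<noteq> (arc_tail n A (z div 4) \<in> S)} \<le>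
    3137 * (\<Sum>j<5. boundary (4 * N) (point_map n A j) Y)"
proof -
  let ?bad = "{z. z < 4 * N \<and> (z \<in> Y) \<noteq> (arc_tail n A (z div 4) \<in> S)}"
  let ?M = "\<lambda>u. 4 * outdeg n A u"
  let ?sh = "\<lambda>u l. 4 * cum A (u * n) + l"
  have fYc: "finite (Yc u)" for u by (simp add: Yc_def)
  have bad_u: "card (?bad \<inter> cluster u) \<le> 3137 * (\<Sum>j<5. boundary (?M u) (cluster_map (?M u) j) (Yc u))"
    if u: "u < n" for u
  proof -
    let ?L = "{l. l < ?M u \<and> (l \<in> Yc u) \<noteq> (u \<in> S)}"
    have "?bad \<inter> cluster u \<subseteq> ?sh u ` ?L"
    proof
      fix z assume z: "z \<in> ?bad \<inter> cluster u"
      then have t: "arc_tail n A (z div 4) = u" using in_cluster_iff[OF u] by auto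
      have l: "z - 4 * cum A (u * n) < ?M u" "z = ?sh u (z - 4 * cum A (u * n))"
        using z by (auto simp: cluster_def)
      then show "z \<in> ?sh u ` ?L"
        using z t by (intro image_eqI[of _ _ "z - 4 * cum A (u * n)"]) (auto simp: Yc_def)
    qed
    then have "card (?bad \<inter> cluster u) \<le> card (?sh u ` ?L)" by (intro card_mono) auto
    also have "\<dots> \<le> card ?L" by (intro card_image_le) auto
    also have "card ?L \<le> min (card (Yc u)) (?M u - card (Yc u))"
    proof (cases "u \<in> S")
      case True
      then have "?L = {..<?M u} - Yc u" by auto
      then have "card ?L = ?M u - card (Yc u)"
        using fYc by (simp add: card_Diff_subset Yc_def subset_iff)
      moreover have "4 * outdeg n A u < 2 * card (Yc u)" using True by (simp add: S_def)
      ultimately show ?thesis by linarith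
    next
      case False
      then have "?L = Yc u" by (auto simp: Yc_def)
      then show ?thesis using False u by (simp add: S_def)
    qed
    also have "\<dots> \<le> 3137 * (\<Sum>j<5. boundary (?M u) (cluster_map (?M u) j) (Yc u))"
    proof (cases "outdeg n A u = 0")
      \<comment> \<open>A positive degree gives at least four points, the smallest size for which
        clusters are known to expand.\<close>
      case False
      then show ?thesis by (intro cluster_expansion) (auto simp: Yc_def)
    qed (simp add: Yc_def)
    finally show ?thesis .
  qed
  have bd: "(\<Sum>u<n. boundary (?M u) (cluster_map (?M u) j) (Yc u)) \<le> boundary (4 * N) (point_map n A j) Y"
    if j: "j < 5" for j
  proof -
    let ?D = "\<lambda>u. {l \<in> {..<?M u}. (l \<in> Yc u) \<noteq> (cluster_map (?M u) j l \<in> Yc u)}"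
    have sub: "?sh u ` ?D u \<subseteq> cluster u" for u by (auto simp: cluster_def)
    have "(\<Sum>u<n. boundary (?M u) (cluster_map (?M u) j) (Yc u)) = (\<Sum>u<n. card (?sh u ` ?D u))"
      by (intro sum.cong refl) (simp add: boundary_def card_image)
    also have "\<dots> = card (\<Union>u<n. ?sh u ` ?D u)"
    proof (rule card_UN_disjoint[symmetric])
      show "\<forall>u\<in>{..<n}. \<forall>v\<in>{..<n}. u \<noteq> v \<longrightarrow> ?sh u ` ?D u \<inter> ?sh v ` ?D v = {}"
      proof (intro ballI impI)
        fix u v assume uv: "u \<in> {..<n}" "v \<in> {..<n}" "u \<noteq> v"
        then have "cluster u \<inter> cluster v = {}" using in_cluster_iff by auto
        then show "?sh u ` ?D u \<inter> ?sh v ` ?D v = {}" using sub[of u] sub[of v] by blast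
      qed
    qed auto
    also have "\<dots> \<le> card {z \<in> {..<4 * N}. (z \<in> Y) \<noteq> (point_map n A j z \<in> Y)}"
    proof (intro card_mono UN_least subsetI)
      fix u z assume u: "u \<in> {..<n}" and "z \<in> ?sh u ` ?D u"
      then obtain l where l: "z = ?sh u l" "l < ?M u" "(l \<in> Yc u) \<noteq> (cluster_map (?M u) j l \<in> Yc u)" by auto
      then have z: "z \<in> cluster u" by (simp add: cluster_def)
      then have "point_map n A j z = ?sh u (cluster_map (?M u) j l)"
        using point_map_inner[OF z _ j] u l by (simp add: inner_map_def)
      moreover have "z < 4 * N" using z u in_cluster_iff by auto
      moreover have "cluster_map (?M u) j l < ?M u" using l(2) by (rule cluster_map_less)
      ultimately show "z \<in> {z \<in> {..<4 * N}. (z \<in> Y) \<noteq> (point_map n A j z \<in> Y)}"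
        using l by (simp add: Yc_def)
    qed simp
    finally show ?thesis by (simp add: boundary_def)
  qed
  have "?bad \<subseteq> (\<Union>u<n. ?bad \<inter> cluster u)"
  proof
    fix z assume z: "z \<in> ?bad"
    then have "z \<in> cluster (arc_tail n A (z div 4))" "arc_tail n A (z div 4) < n" using point_cluster by auto
    then show "z \<in> (\<Union>u<n. ?bad \<inter> cluster u)" using z by blast
  qed
  then have "card ?bad \<le> card (\<Union>u<n. ?bad \<inter> cluster u)" by (intro card_mono) auto
  also have "\<dots> \<le> (\<Sum>u<n. card (?bad \<inter> cluster u))" by (rule card_UN_le) simp
  also have "\<dots> \<le> (\<Sum>u<n. 3137 * (\<Sum>j<5. boundary (?M u) (cluster_map (?M u) j) (Yc u)))"
    by (intro sum_mono bad_u) simp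
  also have "\<dots> = 3137 * (\<Sum>j<5. \<Sum>u<n. boundary (?M u) (cluster_map (?M u) j) (Yc u))"
    unfolding sum_distrib_left[symmetric] by (subst sum.swap) (rule refl)
  also have "\<dots> \<le> 3137 * (\<Sum>j<5. boundary (4 * N) (point_map n A j) Y)"
    by (intro mult_left_mono sum_mono bd) auto
  finally show ?thesis .
qed

definition cluster_graph :: "nat pair_pre_digraph" where
  "cluster_graph = port_graph (4 * N) (point_map n A)"

text \<open>
  Here \<open>47055 = 3137 * 5 * 3\<close> combines \<open>cluster_expansion\<close> for five maps with the factor 3 lost in
  \<open>port_graph_rounding\<close>, and \<open>564672 = 12 + 12 * 47055\<close>.
\<close>

lemma cluster_graph_sound:
  assumes X: "X \<subseteq> {..<48 * N}"
  defines "e \<equiv> crossing cluster_graph X"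
  obtains S where "S \<subseteq> {..<n}"
    and "card X \<le> 48 * card {a. a < N \<and> arc_tail n A a \<in> S} + 564672 * e"
    and "48 * card {a. a < N \<and> arc_tail n A a \<in> S} \<le> card X + 564672 * e"
    and "4 * card {a. a < N \<and> arc_tail n A a \<in> S \<and> arc_head n A a \<notin> S} \<le> 564672 * e"
proof -
  have X': "X \<subseteq> {..<12 * (4 * N)}" using X by simp
  define Y where "Y = {z. z < 4 * N \<and> 12 * z \<in> X}"
  note r = port_graph_rounding[of "point_map n A" "4 * N" X, OF bij_point_map X', folded Y_def cluster_graph_def e_def]
  define S where "S = {u. u < n \<and> 4 * outdeg n A u < 2 * card {l. l < 4 * outdeg n A u \<and> 4 * cum A (u * n) + l \<in> Y}}"
  let ?bad = "{z. z < 4 * N \<and> (z \<in> Y) \<noteq> (arc_tail n A (z div 4) \<in> S)}"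
  have Y4: "Y \<subseteq> {..<4 * N}" by (auto simp: Y_def)
  have "card ?bad \<le> 3137 * (\<Sum>j<5. boundary (4 * N) (point_map n A j) Y)"
    using cluster_rounding[OF Y4] by (simp add: S_def)
  also have "(\<Sum>j<5. boundary (4 * N) (point_map n A j) Y) \<le> (\<Sum>j<5::nat. 3 * e)"
    by (intro sum_mono r(1)) simp
  finally have bad: "card ?bad \<le> 47055 * e" by simp
  let ?T = "{z. z < 4 * N \<and> arc_tail n A (z div 4) \<in> S}"
  have T: "card ?T = 4 * card {a. a < N \<and> arc_tail n A a \<in> S}" by (rule card_fours)
  have fin: "finite Y" "finite ?bad" "finite ?T" using finite_subset[OF Y4] by auto
  have "card Y \<le> card (?T \<union> ?bad)" "card ?T \<le> card (Y \<union> ?bad)"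
    using fin Y4 by (intro card_mono; auto)+
  then have YT: "card Y \<le> card ?T + card ?bad" "card ?T \<le> card Y + card ?bad"
    using card_Un_le[of ?T ?bad] card_Un_le[of Y ?bad] by linarith+
  let ?Z = "{z. z < 4 * N \<and> (arc_tail n A (z div 4) \<in> S \<and> arc_head n A (z div 4) \<notin> S)}"
  let ?p = "point_map n A 5"
  have p5: "?p z < 4 * N \<and> arc_tail n A (?p z div 4) = arc_head n A (z div 4)" if "z < 4 * N" for z
  proof -
    have "z div 4 < N" using that div_4_less_iff by blast
    note r = arc_rev[OF this]
    moreover have "z mod 4 < 4" by simp
    ultimately have "4 * arc_rev n A (z div 4) + z mod 4 < 4 * N" by linarith
    then show ?thesis using r by (simp add: point_map_def)
  qed
  let ?B5 = "{z \<in> {..<4 * N}. (z \<in> Y) \<noteq> (?p z \<in> Y)}"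
  \<comment> \<open>If the arc leaves \<open>S\<close>, then \<open>Y\<close> separates the point
    from its partner on the reversed arc, unless one of the two is misclassified.\<close>
  have "?Z \<subseteq> ?B5 \<union> ?bad \<union> {z. z < 4 * N \<and> ?p z \<in> ?bad}"
  proof
    fix z assume z: "z \<in> ?Z"
    then have "z < 4 * N" by simp
    from p5[OF this] z show "z \<in> ?B5 \<union> ?bad \<union> {z. z < 4 * N \<and> ?p z \<in> ?bad}" by auto
  qed
  then have "card ?Z \<le> card (?B5 \<union> ?bad \<union> {z. z < 4 * N \<and> ?p z \<in> ?bad})" by (intro card_mono) auto
  also have "\<dots> \<le> card ?B5 + card ?bad + card {z. z < 4 * N \<and> ?p z \<in> ?bad}"
    by (meson add_le_mono card_Un_le le_trans order_refl)
  also have "card {z. z < 4 * N \<and> ?p z \<in> ?bad} = card (?p ` {z. z < 4 * N \<and> ?p z \<in> ?bad})"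
    by (rule card_image[symmetric]) (rule inj_on_subset[OF bij_betw_imp_inj_on[OF bij_point_map]], auto)
  also have "\<dots> \<le> card ?bad" by (rule card_mono[OF fin(2)]) auto
  finally have Z: "card ?Z \<le> 3 * e + 2 * (47055 * e)"
    using bad r(1)[of 5] by (simp add: boundary_def)
  have Z4: "card ?Z = 4 * card {a. a < N \<and> (arc_tail n A a \<in> S \<and> arc_head n A a \<notin> S)}"
    by (rule card_fours)
  show thesis
  proof (rule that[of S])
    show "S \<subseteq> {..<n}" by (auto simp: S_def)
    show "card X \<le> 48 * card {a. a < N \<and> arc_tail n A a \<in> S} + 564672 * e"
      using r(2) YT(1) T bad by linarith
    show "48 * card {a. a < N \<and> arc_tail n A a \<in> S} \<le> card X + 564672 * e"
      using r(3) YT(2) T bad by linarith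
    show "4 * card {a. a < N \<and> arc_tail n A a \<in> S \<and> arc_head n A a \<notin> S} \<le> 564672 * e"
      using Z Z4 by linarith
  qed
qed

text \<open>The inner maps preserve whole clusters, so only the map that reverses arcs crosses. Each
  crossing arc contributes its four points and their four partners, whence the factor 8.\<close>

lemma cluster_graph_complete:
  assumes "S \<subseteq> {..<n}"
  defines "X \<equiv> {w \<in> {..<48 * N}. arc_tail n A (w div 12 div 4) \<in> S}"
  shows "card X = 48 * card {a. a < N \<and> arc_tail n A a \<in> S}"
    and "crossing cluster_graph X \<le> 8 * card {a. a < N \<and> arc_tail n A a \<in> S \<and> arc_head n A a \<notin> S}"
proof -
  define Y where "Y = {z. z < 4 * N \<and> arc_tail n A (z div 4) \<in> S}"
  have Y4: "Y \<subseteq> {..<4 * N}" by (auto simp: Y_def)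
  have X: "X = {w \<in> {..<12 * (4 * N)}. w div 12 \<in> Y}" by (auto simp: X_def Y_def)
  note c = crossing_gadgets(1)[OF Y4, of "point_map n A", folded X cluster_graph_def]
    crossing_gadgets(2)[OF Y4, folded X]
  have "card Y = 4 * card {a. a < N \<and> arc_tail n A a \<in> S}" unfolding Y_def by (rule card_fours)
  then show "card X = 48 * card {a. a < N \<and> arc_tail n A a \<in> S}" using c(2) by simp
  have inner: "boundary (4 * N) (point_map n A j) Y = 0" if "j < 5" for j
  proof -
    have "z \<in> Y \<longleftrightarrow> point_map n A j z \<in> Y" if z: "z < 4 * N" for z
    proof -
      let ?u = "arc_tail n A (z div 4)"
      have "point_map n A j z \<in> cluster ?u"
        using point_map_inner[OF point_cluster[OF z] \<open>j < 5\<close>] inner_map_cluster point_cluster(1)[OF z] by simp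
      then have "point_map n A j z < 4 * N \<and> arc_tail n A (point_map n A j z div 4) = ?u"
        using in_cluster_iff point_cluster(2)[OF z] by blast
      then show ?thesis using z by (simp add: Y_def)
    qed
    then show ?thesis by (simp add: boundary_def)
  qed
  let ?p = "point_map n A 5"
  have p5: "?p z < 4 * N \<and> arc_tail n A (?p z div 4) = arc_head n A (z div 4) \<and> ?p (?p z) = z" if "z < 4 * N" for z
  proof -
    have "z div 4 < N" using that div_4_less_iff by blast
    note r = arc_rev[OF this]
    moreover have "z mod 4 < 4" by simp
    ultimately have "4 * arc_rev n A (z div 4) + z mod 4 < 4 * N" by linarith
    then show ?thesis using r by (simp add: point_map_def)
  qed
  let ?Z = "{z. z < 4 * N \<and> (arc_tail n A (z div 4) \<in> S \<and> arc_head n A (z div 4) \<notin> S)}"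
  have "{z \<in> {..<4 * N}. (z \<in> Y) \<noteq> (?p z \<in> Y)} \<subseteq> ?Z \<union> ?p ` ?Z"
  proof
    fix z assume "z \<in> {z \<in> {..<4 * N}. (z \<in> Y) \<noteq> (?p z \<in> Y)}"
    then have z: "z < 4 * N" "(z \<in> Y) \<noteq> (?p z \<in> Y)" by auto
    then have z: "z < 4 * N" "(arc_tail n A (z div 4) \<in> S) \<noteq> (arc_head n A (z div 4) \<in> S)"
      using p5[OF z(1)] by (simp_all add: Y_def)
    show "z \<in> ?Z \<union> ?p ` ?Z"
    proof (cases "arc_tail n A (z div 4) \<in> S")
      case False
      have "arc_head n A (?p z div 4) = arc_tail n A (z div 4)"
        using p5[of "?p z"] p5[OF z(1)] by simp
      then have "?p z \<in> ?Z" using z False p5[OF z(1)] by simp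
      then have "?p (?p z) \<in> ?p ` ?Z" by (rule imageI)
      then show ?thesis using p5[OF z(1)] by simp
    qed (use z in auto)
  qed
  then have "boundary (4 * N) ?p Y \<le> card (?Z \<union> ?p ` ?Z)"
    unfolding boundary_def by (intro card_mono) auto
  also have "\<dots> \<le> card ?Z + card ?Z"
    using card_Un_le[of ?Z "?p ` ?Z"] card_image_le[of ?Z ?p] by simp
  also have "card ?Z = 4 * card {a. a < N \<and> (arc_tail n A a \<in> S \<and> arc_head n A a \<notin> S)}"
    by (rule card_fours)
  finally have "boundary (4 * N) ?p Y \<le> 8 * card {a. a < N \<and> arc_tail n A a \<in> S \<and> arc_head n A a \<notin> S}"
    by simp
  moreover have "(\<Sum>j<6. boundary (4 * N) (point_map n A j) Y) = boundary (4 * N) ?p Y"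
    using inner by (simp add: eval_nat_numeral)
  ultimately show "crossing cluster_graph X \<le> 8 * card {a. a < N \<and> arc_tail n A a \<in> S \<and> arc_head n A a \<notin> S}"
    using c(1) by simp
qed

end


section \<open>The reduction on graphs\<close>

text \<open>Vertex sets are represented by arc sets: a bound on the volume bounds the number of
  arcs, but not the number of vertices.\<close>

definition in_tails :: "nat \<Rightarrow> (nat \<Rightarrow> bool) \<Rightarrow> nat set \<Rightarrow> nat \<Rightarrow> bool" where
  "in_tails n A F u \<longleftrightarrow> (\<exists>a < cum A (n * n). a \<in> F \<and> arc_tail n A a = u)"

definition tail_volume :: "nat \<Rightarrow> (nat \<Rightarrow> bool) \<Rightarrow> nat set \<Rightarrow> nat" where
  "tail_volume n A F = card {a. a < cum A (n * n) \<and> in_tails n A F (arc_tail n A a)}"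

definition tail_crossing :: "nat \<Rightarrow> (nat \<Rightarrow> bool) \<Rightarrow> nat set \<Rightarrow> nat" where
  "tail_crossing n A F =
     card {a. a < cum A (n * n) \<and> in_tails n A F (arc_tail n A a) \<and> \<not> in_tails n A F (arc_head n A a)}"

definition adj_bit :: "nat pair_pre_digraph \<Rightarrow> nat \<Rightarrow> bool" where
  "adj_bit G t \<longleftrightarrow> (t div card (pverts G), t mod card (pverts G)) \<in> parcs G"

definition degree_reduction :: "nat \<Rightarrow> (nat \<Rightarrow> bool) \<Rightarrow> nat pair_pre_digraph" where
  "degree_reduction n A = port_graph (4 * cum A (n * n)) (point_map n A)"

lemma input_graph_verts:
  assumes "G \<in> input_graphs"
  shows "v \<in> pverts G \<longleftrightarrow> v < card (pverts G)"
proof -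
  obtain n where "pverts G = {..<n}" using assms unfolding input_graphs_def by blast
  then show ?thesis by simp
qed

lemma input_graph_arcs:
  assumes "G \<in> input_graphs"
  shows "sym (parcs G)" "irrefl (parcs G)" "parcs G \<subseteq> pverts G \<times> pverts G" "finite (parcs G)"
proof -
  interpret pair_graph G using assms by (simp add: input_graphs_def)
  show "sym (parcs G)" using pair_sym_arcs by (simp add: symmetric_def)
  show "irrefl (parcs G)" using pair_no_loops by (force simp: irrefl_def)
  show "parcs G \<subseteq> pverts G \<times> pverts G" using wellformed' by auto
  show "finite (parcs G)" by (rule pair_finite_arcs)
qed

lemma adjacency_of_graph:
  assumes "G \<in> input_graphs"
  shows "adjacency (card (pverts G)) (adj_bit G)"
proof
  let ?n = "card (pverts G)"
  note V = input_graph_verts[OF assms] and a = input_graph_arcs[OF assms]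
  fix t assume "adj_bit G t"
  then have "t div ?n < ?n" "t mod ?n < ?n" using a(3) V by (auto simp: adj_bit_def)
  then show "t < ?n * ?n" using div_less_iff_less_mult[of ?n t ?n] by simp
next
  let ?n = "card (pverts G)"
  fix u v assume "u < ?n" "v < ?n" "adj_bit G (u * ?n + v)"
  then show "adj_bit G (v * ?n + u)"
    using symD[OF input_graph_arcs(1)[OF assms]] by (simp add: adj_bit_def)
qed

section \<open>Volumes and crossings expressed through arc numbers\<close>

locale input_graph =
  fixes G :: "nat pair_pre_digraph"
  assumes G: "G \<in> input_graphs"
begin

abbreviation n :: nat where "n \<equiv> card (pverts G)"
abbreviation A :: "nat \<Rightarrow> bool" where "A \<equiv> adj_bit G"

sublocale adjacency n A
  by (rule adjacency_of_graph[OF G])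

lemmas V = input_graph_verts[OF G]

lemma subset_verts: "S \<subseteq> pverts G \<longleftrightarrow> S \<subseteq> {..<n}"
  using V by (meson lessThan_iff subset_iff)

lemmas arcs = input_graph_arcs[OF G]

lemma card_arcs:
  "card {(u, v) \<in> parcs G. P u v} = card {a. a < N \<and> P (arc_tail n A a) (arc_head n A a)}"
proof -
  have "bij_betw (\<lambda>a. (arc_tail n A a, arc_head n A a)) {a. a < N \<and> P (arc_tail n A a) (arc_head n A a)}
      {(u, v) \<in> parcs G. P u v}"
  proof (rule bij_betw_byWitness[where f' = "\<lambda>(u, v). cum A (u * n + v)"])
    show "\<forall>a\<in>{a. a < N \<and> P (arc_tail n A a) (arc_head n A a)}.
      (\<lambda>(u, v). cum A (u * n + v)) (arc_tail n A a, arc_head n A a) = a"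
      using A_arc(2) by auto
    have uv: "u < n \<and> v < n \<and> A (u * n + v)" if "(u, v) \<in> parcs G" for u v
    proof -
      have "u < n" "v < n" using that arcs(3) V by auto
      then show ?thesis using that by (simp add: adj_bit_def)
    qed
    show "\<forall>e\<in>{(u, v) \<in> parcs G. P u v}. (arc_tail n A ((\<lambda>(u, v). cum A (u * n + v)) e),
      arc_head n A ((\<lambda>(u, v). cum A (u * n + v)) e)) = e"
      using uv arc_of_pair by auto
    show "(\<lambda>(u, v). cum A (u * n + v)) ` {(u, v) \<in> parcs G. P u v} \<subseteq> {a. a < N \<and> P (arc_tail n A a) (arc_head n A a)}"
      using uv arc_of_pair by auto
    show "(\<lambda>a. (arc_tail n A a, arc_head n A a)) ` {a. a < N \<and> P (arc_tail n A a) (arc_head n A a)} \<subseteq> {(u, v) \<in> parcs G. P u v}"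
    proof (rule image_subsetI)
      fix a assume "a \<in> {a. a < N \<and> P (arc_tail n A a) (arc_head n A a)}"
      then have a: "a < N" "P (arc_tail n A a) (arc_head n A a)" by auto
      have "(arc_tail n A a, arc_head n A a) \<in> parcs G"
        using A_arc(1)[OF a(1)] arc_less[OF a(1)] by (simp add: adj_bit_def)
      then show "(arc_tail n A a, arc_head n A a) \<in> {(u, v) \<in> parcs G. P u v}" using a by simp
    qed
  qed
  then show ?thesis by (simp add: bij_betw_same_card)
qed

lemma fin_verts: "S \<subseteq> pverts G \<Longrightarrow> finite S"
  using subset_verts finite_subset by blast

lemma vol_arcs:
  assumes "S \<subseteq> pverts G"
  shows "vol G S = card {(u, v) \<in> parcs G. u \<in> S}"
proof -
  have "vol G S = (\<Sum>u\<in>S. card {v. (u, v) \<in> parcs G})"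
    by (simp add: vol_def vdeg_conv)
  also have "\<dots> = card (SIGMA u:S. {v. (u, v) \<in> parcs G})"
  proof (rule card_SigmaI[symmetric])
    have "{v. (u, v) \<in> parcs G} \<subseteq> snd ` parcs G" for u by force
    then show "\<forall>u\<in>S. finite {v. (u, v) \<in> parcs G}" using arcs(4) finite_subset finite_imageI by metis
  qed (rule fin_verts[OF assms])
  also have "(SIGMA u:S. {v. (u, v) \<in> parcs G}) = {(u, v) \<in> parcs G. u \<in> S}" by auto
  finally show ?thesis .
qed

lemma vol_conv: "S \<subseteq> pverts G \<Longrightarrow> vol G S = card {a. a < N \<and> arc_tail n A a \<in> S}"
  using vol_arcs card_arcs[of "\<lambda>u v. u \<in> S"] by simp

lemma crossing_conv: "crossing G S = card {a. a < N \<and> arc_tail n A a \<in> S \<and> arc_head n A a \<notin> S}"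
proof -
  have "crossing G S = card {(u, v) \<in> parcs G. u \<in> S \<and> v \<notin> S}"
    unfolding crossing_def using arcs(3) by (intro arg_cong[where f = card]) auto
  then show ?thesis using card_arcs[of "\<lambda>u v. u \<in> S \<and> v \<notin> S"] by simp
qed

lemma vol_verts: "vol G (pverts G) = N"
proof -
  have "{a. a < N \<and> arc_tail n A a \<in> pverts G} = {..<N}" using arc_less(1) V by auto
  then show ?thesis by (simp add: vol_conv)
qed

text \<open>Arcs into \<open>R\<close> are counted by their reversals, which start in
  \<open>R\<close>.\<close>

lemma arcs_between_le:
  assumes "R \<subseteq> pverts G"
  shows "card {(u, v) \<in> parcs G. u \<in> T \<and> v \<in> R} \<le> vol G R"
proof -
  have "card {(u, v) \<in> parcs G. u \<in> T \<and> v \<in> R} = card (prod.swap ` {(u, v) \<in> parcs G. u \<in> T \<and> v \<in> R})"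
    by (rule card_image[symmetric]) simp
  also have "\<dots> \<le> card {(u, v) \<in> parcs G. u \<in> R}"
  proof (rule card_mono)
    show "finite {(u, v) \<in> parcs G. u \<in> R}" by (rule finite_subset[OF _ arcs(4)]) auto
    show "prod.swap ` {(u, v) \<in> parcs G. u \<in> T \<and> v \<in> R} \<subseteq> {(u, v) \<in> parcs G. u \<in> R}"
      using symD[OF arcs(1)] by auto
  qed
  finally show ?thesis using vol_arcs[OF assms] by simp
qed

lemma vol_disjoint:
  assumes "R \<subseteq> S" "S \<subseteq> pverts G"
  shows "vol G S = vol G R + vol G (S - R)"
  unfolding vol_def using sum.subset_diff[OF assms(1) fin_verts[OF assms(2)]] by (simp add: add.commute)

lemma crossing_le_vol:
  assumes "S \<subseteq> pverts G"
  shows "crossing G S \<le> vol G S"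
  unfolding vol_conv[OF assms] crossing_conv by (intro card_mono) auto

end

text \<open>Adding elements one at a time, the first sum to reach \<open>x\<close> overshoots it by
  at most the weight \<open>t\<close> of a single element.\<close>

lemma greedy_subset:
  fixes d :: "'a \<Rightarrow> nat" and x t :: real
  assumes "finite L" "\<And>v. v \<in> L \<Longrightarrow> real (d v) \<le> t" "0 \<le> x" "0 \<le> t" "x \<le> real (sum d L)"
  shows "\<exists>R \<subseteq> L. x \<le> real (sum d R) \<and> real (sum d R) \<le> x + t"
  using assms
proof (induction L rule: finite_induct)
  case empty
  then show ?case by auto
next
  case (insert v L)
  show ?case
  proof (cases "x \<le> real (sum d L)")
    case True
    then obtain R where "R \<subseteq> L" "x \<le> real (sum d R)" "real (sum d R) \<le> x + t"
      using insert by auto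
    then show ?thesis by blast
  next
    case False
    have "real (sum d (insert v L)) = real (d v) + real (sum d L)" using insert(1,2) by simp
    moreover have "real (d v) \<le> t" using insert.prems(1) by blast
    ultimately have "real (sum d (insert v L)) \<le> x + t" using False by linarith
    then show ?thesis using insert.prems(4) by blast
  qed
qed

context input_graph
begin

text \<open>
  A set that is slightly too large for the NO condition and expands badly: either it can be trimmed
  greedily, or most of its volume sits on few vertices of huge degree, which have too few arcs among
  themselves because the graph is simple.
\<close>

lemma slightly_too_large_set:
  fixes \<beta> \<delta> :: real
  assumes \<beta>: "0 < \<beta>" "\<beta> < 1" and \<delta>: "0 < \<delta>"
    and no: "\<And>T. T \<subseteq> pverts G \<Longrightarrow> vol G T > 0 \<Longrightarrow> real (vol G T) \<le> \<delta> * real N \<Longrightarrow>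
      \<beta> * real (vol G T) \<le> real (crossing G T)"
    and S: "S \<subseteq> pverts G" "\<delta> * real N < real (vol G S)"
      "real (vol G S) \<le> \<delta> * real N + \<beta> / 16 * real (vol G S)"
      "real (crossing G S) \<le> \<beta> / 16 * real (vol G S)"
  shows "real N < 512 / (\<beta>\<^sup>2 * \<delta>)"
proof -
  define W where "W = real (vol G S)"
  define \<epsilon> where "\<epsilon> = \<beta> / 16"
  have \<epsilon>: "0 < \<epsilon>" "\<epsilon> < 1 / 16" using \<beta> by (auto simp: \<epsilon>_def)
  have "0 \<le> \<delta> * real N" using \<delta> by simp
  then have W: "W > 0" using S(2) unfolding W_def by linarith
  \<comment> \<open>The vertices light enough to be removed one by one without overshooting by more
    than \<epsilon>W.\<close>
  define L where "L = {v \<in> S. real (vdeg G v) \<le> \<epsilon> * W}"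
  have LS: "L \<subseteq> S" and LV: "L \<subseteq> pverts G" using S(1) by (auto simp: L_def)
  note fS = fin_verts[OF S(1)]
  have volL: "vol G L = sum (vdeg G) L" by (simp add: vol_def)
  have "W < 2 / \<epsilon>\<^sup>2"
  proof (cases "\<epsilon> * W \<le> real (vol G L)")
    case True
    define x where "x = W - \<delta> * real N"
    have x: "0 \<le> x" "x \<le> \<epsilon> * W" using S(2,3) by (auto simp: x_def W_def \<epsilon>_def)
    have "\<exists>R \<subseteq> L. x \<le> real (sum (vdeg G) R) \<and> real (sum (vdeg G) R) \<le> x + \<epsilon> * W"
    proof (rule greedy_subset)
      show "finite L" by (rule finite_subset[OF LS fS])
      show "real (vdeg G v) \<le> \<epsilon> * W" if "v \<in> L" for v using that by (simp add: L_def)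
      show "0 \<le> x" "0 \<le> \<epsilon> * W" using x W \<epsilon> by simp_all
      show "x \<le> real (sum (vdeg G) L)" using x(2) True unfolding volL by linarith
    qed
    then obtain R where R: "R \<subseteq> L" "x \<le> real (sum (vdeg G) R)" "real (sum (vdeg G) R) \<le> x + \<epsilon> * W"
      by blast
    have RS: "R \<subseteq> S" and RV: "R \<subseteq> pverts G" using R(1) LS LV by auto
    let ?T = "S - R"
    have vR: "x \<le> real (vol G R)" "real (vol G R) \<le> 2 * (\<epsilon> * W)" using R(2,3) x by (auto simp: vol_def)
    have vT: "real (vol G ?T) = W - real (vol G R)"
      using vol_disjoint[OF RS S(1)] by (simp add: W_def)
    have eW: "\<epsilon> * W \<le> W / 16" using \<epsilon> W by simp
    have "real (vol G ?T) > 0" using vT vR(2) eW W by linarith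
    moreover have "real (vol G ?T) \<le> \<delta> * real N" using vT vR(1) by (simp add: x_def)
    ultimately have b: "\<beta> * real (vol G ?T) \<le> real (crossing G ?T)" using no[of ?T] S(1) by auto
    have "crossing G ?T \<le> crossing G S + card {(u, v) \<in> parcs G. u \<in> ?T \<and> v \<in> R}"
    proof -
      have "{(u, v) \<in> parcs G. u \<in> ?T \<and> v \<in> pverts G - ?T} \<subseteq>
        {(u, v) \<in> parcs G. u \<in> S \<and> v \<in> pverts G - S} \<union> {(u, v) \<in> parcs G. u \<in> ?T \<and> v \<in> R}" by auto
      moreover have "finite ({(u, v) \<in> parcs G. u \<in> S \<and> v \<in> pverts G - S} \<union> {(u, v) \<in> parcs G. u \<in> ?T \<and> v \<in> R})"
        by (rule finite_subset[OF _ arcs(4)]) auto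
      ultimately have "crossing G ?T \<le> card ({(u, v) \<in> parcs G. u \<in> S \<and> v \<in> pverts G - S} \<union> {(u, v) \<in> parcs G. u \<in> ?T \<and> v \<in> R})"
        unfolding crossing_def by (rule card_mono[rotated])
      also have "\<dots> \<le> crossing G S + card {(u, v) \<in> parcs G. u \<in> ?T \<and> v \<in> R}"
        unfolding crossing_def by (rule card_Un_le)
      finally show ?thesis .
    qed
    then have "crossing G ?T \<le> crossing G S + vol G R"
      using arcs_between_le[OF RV, of ?T] by linarith
    then have "real (crossing G ?T) \<le> real (crossing G S) + real (vol G R)" by linarith
    moreover have "real (crossing G S) \<le> \<epsilon> * W" using S(4) by (simp add: W_def \<epsilon>_def)
    moreover have "\<epsilon> * W + 2 * (\<epsilon> * W) = \<beta> * (3 / 16 * W)" by (simp add: \<epsilon>_def)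
    \<comment> \<open>The crossing of the trimmed set is at most that of \<open>S\<close> plus the
      removed volume, altogether 3\<epsilon>W = 3\<beta>W/16. The NO promise then gives volume at
      most 3W/16, but at least 14W/16 is left.\<close>
    ultimately have "\<beta> * real (vol G ?T) \<le> \<beta> * (3 / 16 * W)" using b vR(2) by linarith
    then have "real (vol G ?T) \<le> 3 / 16 * W" using \<beta>(1) by (simp only: mult_le_cancel_left_pos)
    then have False using vT vR(2) eW W by linarith
    then show ?thesis ..
  next
    case False
    let ?B = "S - L"
    have BV: "?B \<subseteq> pverts G" using S(1) by auto
    have fB: "finite ?B" using fS by auto
    have vB: "real (vol G ?B) = W - real (vol G L)"
      using vol_disjoint[OF LS S(1)] by (simp add: W_def)
    \<comment> \<open>Each heavy vertex has degree above \<epsilon>W, so there are at most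
      1/\<epsilon> of them.\<close>
    have "real (card ?B) * (\<epsilon> * W) \<le> (\<Sum>v\<in>?B. real (vdeg G v))"
      by (rule sum_bounded_below) (auto simp: L_def)
    also have "\<dots> = real (vol G ?B)" by (simp add: vol_def)
    also have "\<dots> \<le> W" using vB by simp
    finally have "(real (card ?B) * \<epsilon>) * W \<le> 1 * W" by (simp add: mult.assoc)
    then have cB: "real (card ?B) * \<epsilon> \<le> 1" using W by (simp only: mult_le_cancel_right_pos)
    then have "(real (card ?B) * \<epsilon>)\<^sup>2 \<le> 1" using \<epsilon> by (simp add: power_le_one)
    then have cB2: "(real (card ?B))\<^sup>2 \<le> 1 / \<epsilon>\<^sup>2" using \<epsilon> by (simp add: power_mult_distrib field_simps)
    let ?a1 = "{(u, v) \<in> parcs G. u \<in> ?B \<and> v \<in> ?B}" and ?a2 = "{(u, v) \<in> parcs G. u \<in> ?B \<and> v \<in> L}"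
      and ?a3 = "{(u, v) \<in> parcs G. u \<in> S \<and> v \<in> pverts G - S}"
    have fin: "finite (?a1 \<union> ?a2 \<union> ?a3)" by (rule finite_subset[OF _ arcs(4)]) auto
    have "vol G ?B = card {(u, v) \<in> parcs G. u \<in> ?B}" by (rule vol_arcs[OF BV])
    also have "\<dots> \<le> card (?a1 \<union> ?a2 \<union> ?a3)"
      by (rule card_mono[OF fin]) (use arcs(3) in auto)
    also have "\<dots> \<le> card ?a1 + card ?a2 + card ?a3"
      by (meson add_le_mono card_Un_le le_trans order_refl)
    also have "card ?a1 \<le> card (?B \<times> ?B)" by (rule card_mono) (use fB in auto)
    also have "card (?B \<times> ?B) = (card ?B)\<^sup>2" by (simp add: card_cartesian_product power2_eq_square)
    also have "card ?a2 \<le> vol G L" by (rule arcs_between_le[OF LV])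
    finally have "vol G ?B \<le> (card ?B)\<^sup>2 + vol G L + crossing G S" by (simp add: crossing_def)
    then have "real (vol G ?B) \<le> real ((card ?B)\<^sup>2 + vol G L + crossing G S)" by (simp only: of_nat_le_iff)
    then have "W - real (vol G L) \<le> 1 / \<epsilon>\<^sup>2 + real (vol G L) + \<epsilon> * W"
      using cB2 vB S(4) by (simp add: W_def \<epsilon>_def)
    moreover have "\<epsilon> * W \<le> W / 16" using \<epsilon> W by simp
    ultimately have "W * 13 / 16 < 1 / \<epsilon>\<^sup>2" using False by argo
    moreover have "0 < 1 / \<epsilon>\<^sup>2" using \<epsilon> by simp
    ultimately have "W < 2 * (1 / \<epsilon>\<^sup>2)" by argo
    then show ?thesis by simp
  qed
  then have "\<delta> * real N < 512 / \<beta>\<^sup>2"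
    using S(2) by (simp add: W_def \<epsilon>_def power_divide)
  then show ?thesis using \<delta> \<beta> by (simp add: field_simps)
qed

lemma degree_reduction_conv: "degree_reduction n A = cluster_graph"
  by (simp add: degree_reduction_def cluster_graph_def)

section \<open>YES and NO instances under the degree reduction\<close>

lemma degree_reduction_regular: "cluster_graph \<in> regular_input_graphs 4"
proof -
  have "regular 4 cluster_graph"
    unfolding cluster_graph_def by (rule regular_port_graph) (rule bij_point_map)
  then show ?thesis
    by (auto simp: regular_input_graphs_def input_graphs_def cluster_graph_def pair_graph_port_graph)
qed

lemma pverts_cluster_graph: "pverts cluster_graph = {..<48 * N}"
  by (simp add: cluster_graph_def)

lemma vol_cluster_graph: "X \<subseteq> {..<48 * N} \<Longrightarrow> vol cluster_graph X = 4 * card X"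
  using vol_regular[of 4 cluster_graph X] degree_reduction_regular pverts_cluster_graph
  by (simp add: regular_input_graphs_def)

text \<open>All volumes grow by 4 * 48 = 192, so relative volumes are kept, while crossings grow at
  most by 8. The expansion can only decrease, in graphs of every size.\<close>

lemma degree_reduction_yes:
  assumes "G \<in> yes_set (SSE input_graphs \<delta> c s)"
  shows "cluster_graph \<in> yes_set (SSE (regular_input_graphs 4) \<delta> c s')"
proof -
  obtain S where S: "S \<subseteq> pverts G" "vol G S > 0" "\<delta> * real N / 2 \<le> real (vol G S)"
    "real (vol G S) \<le> \<delta> * real N" "real (crossing G S) / real (vol G S) < 1 - c"
    using assms by (auto simp: SSE_def expansion_sets_def vol_verts expansion_def)
  define X where "X = {w \<in> {..<48 * N}. arc_tail n A (w div 12 div 4) \<in> S}"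
  have Sn: "S \<subseteq> {..<n}" using S(1) subset_verts by simp
  note comp = cluster_graph_complete[OF Sn, folded X_def vol_conv[OF S(1)] crossing_conv]
  have XV: "X \<subseteq> {..<48 * N}" by (auto simp: X_def)
  have vX: "vol cluster_graph X = 192 * vol G S" using vol_cluster_graph[OF XV] comp(1) by simp
  have vV: "vol cluster_graph (pverts cluster_graph) = 192 * N"
    using vol_cluster_graph[of "{..<48 * N}"] by (simp add: pverts_cluster_graph)
  have "expansion cluster_graph X \<le> real (8 * crossing G S) / real (192 * vol G S)"
    unfolding expansion_def vX using comp(2) by (intro divide_right_mono) (simp_all only: of_nat_le_iff of_nat_0_le_iff)
  also have "\<dots> \<le> real (crossing G S) / real (vol G S)" using S(2) by (simp add: field_simps)
  finally have "expansion cluster_graph X < 1 - c" using S(5) by simp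
  moreover have "X \<in> expansion_sets cluster_graph"
    using XV vX S(2) by (auto simp: expansion_sets_def pverts_cluster_graph vol_def)
  moreover have "\<delta> * real (192 * N) / 2 \<le> real (192 * vol G S)" "real (192 * vol G S) \<le> \<delta> * real (192 * N)"
    using S(3,4) by simp_all
  ultimately have "\<exists>X \<in> expansion_sets cluster_graph.
      \<delta> * real (vol cluster_graph (pverts cluster_graph)) / 2 \<le> real (vol cluster_graph X) \<and>
      real (vol cluster_graph X) \<le> \<delta> * real (vol cluster_graph (pverts cluster_graph)) \<and>
      expansion cluster_graph X < 1 - c"
    unfolding vV by (intro bexI[of _ X]) (simp_all only: vX)
  then show ?thesis
    using degree_reduction_regular by (simp add: SSE_def)
qed

text \<open>
  The constant is \<open>1024 * 564672\<close>: it makes the rounding error at most \<open>\<beta> / 256\<close> of the set, well below the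
  slack \<open>\<beta> / 16\<close> of \<open>slightly_too_large_set\<close>.
\<close>

lemma degree_reduction_no:
  fixes \<beta> \<delta> :: real
  assumes \<beta>: "0 < \<beta>" "\<beta> < 1" and \<delta>: "0 < \<delta>"
    and no: "G \<in> no_set (SSE input_graphs \<delta> c (1 - \<beta>))"
    and N: "512 / (\<beta>\<^sup>2 * \<delta>) \<le> real N"
  shows "cluster_graph \<in> no_set (SSE (regular_input_graphs 4) \<delta> c' (1 - \<beta> / 578224128))"
proof -
  have no': "\<beta> * real (vol G T) \<le> real (crossing G T)"
    if "T \<subseteq> pverts G" "vol G T > 0" "real (vol G T) \<le> \<delta> * real N" for T
  proof -
    have "T \<in> expansion_sets G" using that by (auto simp: expansion_sets_def vol_def)
    then have "\<beta> \<le> expansion G T" using no that by (auto simp: SSE_def vol_verts)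
    then show ?thesis using that(2) by (simp add: expansion_def field_simps)
  qed
  have "\<beta> / 578224128 \<le> expansion cluster_graph X"
    if X: "X \<in> expansion_sets cluster_graph"
      "real (vol cluster_graph X) \<le> \<delta> * real (vol cluster_graph (pverts cluster_graph))" for X
  proof (rule ccontr)
    assume neg: "\<not> ?thesis"
    have XV: "X \<subseteq> {..<48 * N}" using X(1) by (auto simp: expansion_sets_def pverts_cluster_graph)
    have vX: "vol cluster_graph X = 4 * card X" by (rule vol_cluster_graph[OF XV])
    have cX: "card X > 0" using X(1) vX by (auto simp: expansion_sets_def)
    have "vol cluster_graph (pverts cluster_graph) = 192 * N"
      using vol_cluster_graph[of "{..<48 * N}"] by (simp add: pverts_cluster_graph)
    then have XN: "real (card X) \<le> 48 * (\<delta> * real N)" using X(2) vX by simp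
    define e where "e = crossing cluster_graph X"
    have "real e < \<beta> / 578224128 * (4 * real (card X))"
      using neg cX unfolding expansion_def vX e_def by (simp add: field_simps)
    then have ke: "real (564672 * e) \<le> \<beta> / 256 * real (card X)" by simp
    obtain S where S: "S \<subseteq> {..<n}" "card X \<le> 48 * card {a. a < N \<and> arc_tail n A a \<in> S} + 564672 * e"
      "48 * card {a. a < N \<and> arc_tail n A a \<in> S} \<le> card X + 564672 * e"
      "4 * card {a. a < N \<and> arc_tail n A a \<in> S \<and> arc_head n A a \<notin> S} \<le> 564672 * e"
      using cluster_graph_sound[OF XV] unfolding e_def by blast
    have SV: "S \<subseteq> pverts G" using S(1) subset_verts by simp
    define W where "W = real (vol G S)"
    have 1: "real (card X) \<le> 48 * W + real (564672 * e)" "48 * W \<le> real (card X) + real (564672 * e)"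
      "4 * real (crossing G S) \<le> real (564672 * e)"
      using S(2-4) unfolding vol_conv[OF SV, symmetric] crossing_conv[symmetric] W_def
      by (simp_all only: of_nat_le_iff[where 'a = real, symmetric] of_nat_add of_nat_mult of_nat_numeral)
    define x where "x = real (card X)"
    have x: "0 < x" using cX by (simp add: x_def)
    have bx: "\<beta> / 256 * x \<le> x / 256" using \<beta> x by simp
    have "0 \<le> W" by (simp add: W_def)
    \<comment> \<open>The rounding error is at most x/256, so 48W \<ge> 255x/256; the factor 49
      leaves room.\<close>
    then have xW: "x \<le> 49 * W" using 1(1) ke bx unfolding x_def by argo
    have W: "W > 0" using xW x by linarith
    have bW: "\<beta> / 256 * x \<le> \<beta> / 256 * (49 * W)" using xW \<beta> by (intro mult_left_mono) auto
    have "4 * real (crossing G S) \<le> \<beta> / 256 * (49 * W)" using 1(3) ke bW unfolding x_def by linarith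
    moreover have "\<beta> / 256 * (49 * W) \<le> 4 * (\<beta> / 16 * W)" using \<beta> W by simp
    ultimately have cr: "real (crossing G S) \<le> \<beta> / 16 * W" by linarith
    have Wx: "48 * W \<le> 48 * (\<delta> * real N) + \<beta> / 256 * (49 * W)"
      using 1(2) ke XN bW unfolding x_def by linarith
    define bw where "bw = \<beta> * W"
    have bw: "bw > 0" using \<beta> W by (simp add: bw_def)
    have bw': "\<beta> / 256 * (49 * W) = 49 / 256 * bw" "\<beta> / 16 * W = bw / 16" by (simp_all add: bw_def)
    have Wd: "W \<le> \<delta> * real N + \<beta> / 16 * W" using Wx bw unfolding bw' by argo
    show False
    \<comment> \<open>Within the bound the NO promise for \<open>S\<close> is violated directly.
      Above it, \<open>S\<close> exceeds the bound by at most \<beta>W/16 and the trimming lemma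
      bounds the volume of the graph.\<close>
    proof (cases "W \<le> \<delta> * real N")
      case True
      then have "\<beta> * W \<le> real (crossing G S)" using no'[OF SV] W by (simp add: W_def)
      then show False using cr bw unfolding bw' bw_def[symmetric] by argo
    next
      case False
      have "real N < 512 / (\<beta>\<^sup>2 * \<delta>)"
        using False Wd cr unfolding W_def by (intro slightly_too_large_set[OF \<beta> \<delta> no' SV]) auto
      then show False using N by simp
    qed
  qed
  then show ?thesis using degree_reduction_regular by (simp add: SSE_def)
qed

text \<open>
  Small graphs are decided by brute force. As isolated vertices do not matter, it suffices to consider
  the sets of tails of sets \<open>F\<close> of arcs, and these are given by their numbers.
\<close>

lemma yes_iff_arc_set:
  assumes "N \<le> B"
  shows "G \<in> yes_set (SSE input_graphs \<delta> c s) \<longleftrightarrow>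
    (\<exists>F \<in> Pow {..<B}. \<exists>v \<in> {1..B}. \<exists>k \<in> {..B}. \<exists>m \<in> {..B}.
       (\<delta> * real m / 2 \<le> real v \<and> real v \<le> \<delta> * real m \<and> real k / real v < 1 - c) \<and>
       N = m \<and> tail_volume n A F = v \<and> tail_crossing n A F = k)"
  (is "_ \<longleftrightarrow> ?R")
proof -
  define T where "T F = {u. in_tails n A F u}" for F
  have TV: "T F \<subseteq> pverts G" for F using arc_less(1) V by (auto simp: T_def in_tails_def)
  have tv: "tail_volume n A F = vol G (T F)" for F
    unfolding vol_conv[OF TV] tail_volume_def by (simp add: T_def)
  have tc: "tail_crossing n A F = crossing G (T F)" for F
    unfolding crossing_conv tail_crossing_def by (simp add: T_def)
  show ?thesis
  proof
    assume "G \<in> yes_set (SSE input_graphs \<delta> c s)"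
    then obtain S where S: "S \<subseteq> pverts G" "vol G S > 0" "\<delta> * real N / 2 \<le> real (vol G S)"
      "real (vol G S) \<le> \<delta> * real N" "real (crossing G S) / real (vol G S) < 1 - c"
      by (auto simp: SSE_def expansion_sets_def vol_verts expansion_def)
    define F where "F = {a. a < N \<and> arc_tail n A a \<in> S}"
    have t: "arc_tail n A a \<in> T F \<longleftrightarrow> arc_tail n A a \<in> S" if "a < N" for a
      using that by (auto simp: T_def F_def in_tails_def)
    \<comment> \<open>Heads are tails of reversed arcs. Hence \<open>S\<close> and the set of tails
      agree at both ends of every arc, and thus in volume and crossing.\<close>
    have h: "arc_head n A a \<in> T F \<longleftrightarrow> arc_head n A a \<in> S" if "a < N" for a
      using t[OF arc_rev(1)[OF that]] arc_rev(2)[OF that] by simp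
    have v: "vol G (T F) = vol G S"
      unfolding vol_conv[OF TV] vol_conv[OF S(1)] using t by (intro arg_cong[where f = card]) auto
    have k: "crossing G (T F) = crossing G S"
      unfolding crossing_conv using t h by (intro arg_cong[where f = card]) auto
    have "vol G S \<le> N"
      using card_mono[of "{..<N}" "{a. a < N \<and> arc_tail n A a \<in> S}"] unfolding vol_conv[OF S(1)] by auto
    moreover have "F \<in> Pow {..<B}" using assms by (auto simp: F_def)
    ultimately show ?R
      using S(2-5) crossing_le_vol[OF S(1)] assms tv[of F] tc[of F] v k
      by (intro bexI[of _ F] bexI[of _ "vol G S"] bexI[of _ "crossing G S"] bexI[of _ N]) auto
  next
    assume ?R
    then obtain F v k where F: "v \<ge> 1" "\<delta> * real N / 2 \<le> real v" "real v \<le> \<delta> * real N"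
      "real k / real v < 1 - c" "vol G (T F) = v" "crossing G (T F) = k"
      unfolding tv tc by auto
    have "T F \<in> expansion_sets G" using TV[of F] F(1,5) by (auto simp: expansion_sets_def vol_def)
    then show "G \<in> yes_set (SSE input_graphs \<delta> c s)"
      using F G by (auto simp: SSE_def vol_verts expansion_def intro!: bexI[of _ "T F"])
  qed
qed

end

text \<open>The target for small graphs that fail the YES promise: none of its vertex sets has an
  expansion.\<close>

definition null_graph :: "nat pair_pre_digraph" where
  "null_graph = \<lparr>pverts = {}, parcs = {}\<rparr>"

lemma null_graph_regular: "null_graph \<in> regular_input_graphs d"
proof -
  have "pair_graph null_graph"
    by (rule pair_graph_intro) (auto simp: null_graph_def sym_def irrefl_def)
  then show ?thesis
    by (auto simp: null_graph_def regular_input_graphs_def input_graphs_def regular_def)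
qed

lemma null_graph_no: "null_graph \<in> no_set (SSE (regular_input_graphs d) \<delta> c s)"
  using null_graph_regular by (auto simp: SSE_def expansion_sets_def null_graph_def)


section \<open>Instances that satisfy both promises\<close>

text \<open>
  For \<open>\<beta> < \<gamma>\<close> the two promises are compatible, and disjoint copies of the square of a cycle of length about
  \<open>8 / \<beta>\<close> satisfy both: sets of the relevant size contain no copy, hence they have at least one outgoing
  edge, whereas half of a copy has only a bounded number of outgoing edges.
\<close>

definition cycle_adj :: "nat \<Rightarrow> nat \<Rightarrow> nat \<Rightarrow> bool" where
  "cycle_adj k x y \<longleftrightarrow> y = (x + 1) mod k \<or> y = (x + 2) mod k \<or> y = (x + (k - 1)) mod k \<or> y = (x + (k - 2)) mod k"

definition cycles_graph :: "nat \<Rightarrow> nat \<Rightarrow> nat pair_pre_digraph" where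
  "cycles_graph m k = \<lparr>pverts = {..<m * k},
     parcs = {(i, j). i < m * k \<and> j < m * k \<and> i div k = j div k \<and> cycle_adj k (i mod k) (j mod k)}\<rparr>"

lemma add_mod_cancel:
  assumes "x < k" "a + b = k" "y = (x + a) mod k"
  shows "x = (y + b) mod (k :: nat)"
proof -
  have "(y + b) mod k = (x + a + b) mod k" unfolding assms(3) by (rule mod_add_left_eq)
  also have "\<dots> = (x + k) mod k" using assms(2) by (simp add: add.assoc)
  also have "\<dots> = x" using assms(1) by simp
  finally show ?thesis by simp
qed

lemma cycle_adj_sym:
  assumes "x < k" "k \<ge> 2" "cycle_adj k x y"
  shows "cycle_adj k y x"
proof -
  have k: "1 + (k - 1) = k" "2 + (k - 2) = k" "(k - 1) + 1 = k" "(k - 2) + 2 = k" using assms(2) by auto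
  from assms(3) show ?thesis unfolding cycle_adj_def
    using add_mod_cancel[OF assms(1) k(1)] add_mod_cancel[OF assms(1) k(2)]
      add_mod_cancel[OF assms(1) k(3)] add_mod_cancel[OF assms(1) k(4)] by blast
qed

lemma add_mod_ne:
  assumes "x < k" "a < k" "b < k" "a \<noteq> b"
  shows "(x + a) mod k \<noteq> (x + b) mod (k :: nat)"
  using add_mod_inj[OF assms(2,3), of x] assms(4) by (auto simp: add.commute)

lemma cycle_adj_irrefl:
  assumes "x < k" "k \<ge> 5"
  shows "\<not> cycle_adj k x x"
proof -
  have "(x + a) mod k \<noteq> x" if "0 < a" "a < k" for a
    using add_mod_ne[of x k a 0] assms that by simp
  from this[of 1] this[of 2] this[of "k - 1"] this[of "k - 2"] show ?thesis
    using assms(2) by (auto simp: cycle_adj_def)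
qed

text \<open>For k \<ge> 5 the differences 1, 2, -1, -2 are distinct modulo k.\<close>

lemma cycles_neighbours:
  assumes k: "k \<ge> 5" and i: "i < m * k"
  shows "card {j. (i, j) \<in> parcs (cycles_graph m k)} = 4"
proof -
  let ?x = "i mod k" and ?q = "i div k"
  have x: "?x < k" using k by simp
  have q: "?q < m" using i by (simp add: less_mult_imp_div_less)
  define C where "C = {(?x + 1) mod k, (?x + 2) mod k, (?x + (k - 1)) mod k, (?x + (k - 2)) mod k}"
  have "card {a, b, c, d} = 4" if "a \<noteq> b" "a \<noteq> c" "a \<noteq> d" "b \<noteq> c" "b \<noteq> d" "c \<noteq> d" for a b c d :: nat
    using that by simp
  moreover have "(?x + 1) mod k \<noteq> (?x + 2) mod k" "(?x + 1) mod k \<noteq> (?x + (k - 1)) mod k"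
    "(?x + 1) mod k \<noteq> (?x + (k - 2)) mod k" "(?x + 2) mod k \<noteq> (?x + (k - 1)) mod k"
    "(?x + 2) mod k \<noteq> (?x + (k - 2)) mod k" "(?x + (k - 1)) mod k \<noteq> (?x + (k - 2)) mod k"
    by (rule add_mod_ne[OF x]; use k in linarith)+
  ultimately have cC: "card C = 4" unfolding C_def by blast
  have Ck: "C \<subseteq> {..<k}" using k by (auto simp: C_def)
  have "{j. (i, j) \<in> parcs (cycles_graph m k)} = (\<lambda>y. ?q * k + y) ` C"
  proof (intro set_eqI iffI)
    fix j assume "j \<in> {j. (i, j) \<in> parcs (cycles_graph m k)}"
    then have "?q = j div k" "j mod k \<in> C" by (auto simp: cycles_graph_def cycle_adj_def C_def)
    then show "j \<in> (\<lambda>y. ?q * k + y) ` C"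
      by (intro image_eqI[of _ _ "j mod k"]) simp_all
  next
    fix j assume "j \<in> (\<lambda>y. ?q * k + y) ` C"
    then obtain y where y: "y \<in> C" "j = ?q * k + y" by blast
    then have yk: "y < k" using Ck by auto
    have "?q * k + y < (?q + 1) * k" using yk by simp
    also have "\<dots> \<le> m * k" using q by (intro mult_le_mono1) simp
    finally have "j < m * k" using y by simp
    moreover have "j div k = ?q" "j mod k = y" using y yk by auto
    ultimately show "j \<in> {j. (i, j) \<in> parcs (cycles_graph m k)}"
      using i y(1) by (auto simp: cycles_graph_def cycle_adj_def C_def)
  qed
  then show ?thesis using cC by (simp add: card_image inj_on_def)
qed

lemma cycles_graph_regular:
  assumes "k \<ge> 5"
  shows "cycles_graph m k \<in> regular_input_graphs 4"
proof -
  have k0: "i mod k < k" for i using assms by simp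
  have "pair_graph (cycles_graph m k)"
  proof (rule pair_graph_intro)
    show "sym (parcs (cycles_graph m k))"
      using cycle_adj_sym[OF k0] assms by (auto simp: sym_def cycles_graph_def)
    show "irrefl (parcs (cycles_graph m k))"
      using cycle_adj_irrefl[OF k0 assms] by (auto simp: irrefl_def cycles_graph_def)
  qed (auto simp: cycles_graph_def)
  moreover have "regular 4 (cycles_graph m k)"
    unfolding regular_def vdeg_conv using cycles_neighbours[OF assms] by (simp add: cycles_graph_def)
  ultimately show ?thesis
    by (auto simp: regular_input_graphs_def input_graphs_def cycles_graph_def)
qed

text \<open>A nonempty set without outgoing arcs is closed under the successor in the copy of any of
  its elements, so it contains this whole copy of k vertices.\<close>

lemma cycles_graph_expands:
  assumes k: "k \<ge> 5" and X: "X \<subseteq> {..<m * k}" "X \<noteq> {}" "card X < k"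
  shows "crossing (cycles_graph m k) X \<ge> 1"
proof (rule ccontr)
  assume "\<not> ?thesis"
  moreover have fin: "finite {(u, v) \<in> parcs (cycles_graph m k). u \<in> X \<and> v \<in> pverts (cycles_graph m k) - X}"
    by (rule finite_subset[of _ "{..<m * k} \<times> {..<m * k}"]) (auto simp: cycles_graph_def)
  ultimately have none: "{(u, v) \<in> parcs (cycles_graph m k). u \<in> X \<and> v \<in> pverts (cycles_graph m k) - X} = {}"
    unfolding crossing_def by (metis (no_types, lifting) card_0_eq less_one not_le)
  obtain i where i: "i \<in> X" using X(2) by blast
  let ?q = "i div k"
  have q: "?q < m" using i X(1) by (auto simp: less_mult_imp_div_less)
  have lt: "?q * k + y < m * k" if "y < k" for y
  proof -
    have "?q * k + y < (?q + 1) * k" using that by simp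
    also have "\<dots> \<le> m * k" using q by (intro mult_le_mono1) simp
    finally show ?thesis .
  qed
  have step: "?q * k + (y + 1) mod k \<in> X" if "?q * k + y \<in> X" "y < k" for y
  proof (rule ccontr)
    assume "?q * k + (y + 1) mod k \<notin> X"
    moreover have y': "(y + 1) mod k < k" using k by simp
    moreover have "(?q * k + y, ?q * k + (y + 1) mod k) \<in> parcs (cycles_graph m k)"
      using lt[OF that(2)] lt[OF y'] that(2) y' by (simp add: cycles_graph_def cycle_adj_def)
    moreover have "?q * k + (y + 1) mod k \<in> pverts (cycles_graph m k)" using lt[OF y'] by (simp add: cycles_graph_def)
    ultimately show False using none that(1) by blast
  qed
  have "?q * k + (i mod k + t) mod k \<in> X" for t
  proof (induction t)
    case (Suc t)
    have "((i mod k + t) mod k + 1) mod k = (i mod k + Suc t) mod k"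
      using mod_add_left_eq[of "i mod k + t" k 1] by simp
    then show ?case using step[OF Suc] k by simp
  qed (use i in simp)
  note reach = this
  have "(\<lambda>y. ?q * k + y) ` {..<k} \<subseteq> X"
  proof
    fix j assume "j \<in> (\<lambda>y. ?q * k + y) ` {..<k}"
    then obtain y where y: "y < k" "j = ?q * k + y" by auto
    have "i mod k < k" using k by simp
    then have "i mod k + (k - i mod k + y) = k + y" by linarith
    then have "(i mod k + (k - i mod k + y)) mod k = (k + y) mod k" by (rule arg_cong)
    then show "j \<in> X" using reach[of "k - i mod k + y"] y by simp
  qed
  then have "card ((\<lambda>y. ?q * k + y) ` {..<k}) \<le> card X"
    using X(1) by (intro card_mono) (auto intro: finite_subset)
  then show False using X(3) by (simp add: card_image inj_on_def)
qed

text \<open>Differences of at most 2 leave the half cycle only from its two outermost vertices at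
  either end; four vertices of degree 4 have 16 outgoing arcs.\<close>

lemma half_cycle_crossing:
  assumes h: "h \<ge> 3" and m: "m \<ge> 1"
  shows "crossing (cycles_graph m (2 * h)) {..<h} \<le> 16"
proof -
  let ?k = "2 * h" and ?G = "cycles_graph m (2 * h)"
  let ?E = "{0, 1, h - 2, h - 1}"
  have hk: "h \<le> m * ?k" using m by (cases m) auto
  have "{(u, v) \<in> parcs ?G. u \<in> {..<h} \<and> v \<in> pverts ?G - {..<h}} \<subseteq> (SIGMA u:?E. {v. (u, v) \<in> parcs ?G})"
  proof
    fix a assume "a \<in> {(u, v) \<in> parcs ?G. u \<in> {..<h} \<and> v \<in> pverts ?G - {..<h}}"
    then obtain u v where a: "a = (u, v)" and uv: "(u, v) \<in> parcs ?G" "u \<in> {..<h}" "v \<notin> {..<h}" by blast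
    have "u \<in> ?E"
    proof (rule ccontr)
      assume "u \<notin> ?E"
      then have u: "2 \<le> u" "u + 2 < h" using uv(2) by auto
      have "u mod ?k = u" "u div ?k = 0" using u by auto
      then have d: "v div ?k = 0" "cycle_adj ?k u (v mod ?k)" using uv(1) by (auto simp: cycles_graph_def)
      then have "v < ?k" using h by (simp add: div_eq_0_iff)
      then have "cycle_adj ?k u v" using d(2) by simp
      moreover have "(u + 1) mod ?k = u + 1" "(u + 2) mod ?k = u + 2" using u by auto
      moreover have "(u + (?k - 1)) mod ?k = u - 1" "(u + (?k - 2)) mod ?k = u - 2"
      proof -
        have e: "u + (?k - 1) = (u - 1) + ?k" "u + (?k - 2) = (u - 2) + ?k" using u by auto
        show "(u + (?k - 1)) mod ?k = u - 1" "(u + (?k - 2)) mod ?k = u - 2"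
          unfolding e mod_add_self2 by (rule mod_less, use u in simp)+
      qed
      ultimately have "v < h" using u by (auto simp: cycle_adj_def)
      then show False using uv(3) by simp
    qed
    then show "a \<in> (SIGMA u:?E. {v. (u, v) \<in> parcs ?G})" using uv(1) a by blast
  qed
  moreover have fin: "finite {v. (u, v) \<in> parcs ?G}" for u
    by (rule finite_subset[of _ "{..<m * ?k}"]) (auto simp: cycles_graph_def)
  ultimately have "crossing ?G {..<h} \<le> card (SIGMA u:?E. {v. (u, v) \<in> parcs ?G})"
    unfolding crossing_def by (intro card_mono) auto
  also have "\<dots> = (\<Sum>u\<in>?E. card {v. (u, v) \<in> parcs ?G})"
    using fin by (intro card_SigmaI) auto
  also have "\<dots> = (\<Sum>u\<in>?E. 4)"
  proof (intro sum.cong refl cycles_neighbours)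
    fix u assume "u \<in> ?E"
    then have "u < h" using h by auto
    then show "u < m * ?k" using hk by linarith
  qed (use h in simp)
  also have "\<dots> \<le> 16" by (simp add: card_insert_if)
  finally show ?thesis .
qed

text \<open>The witness for YES is half of one copy. For NO, an admissible set is smaller than a
  copy, so it has an outgoing arc; as it has at most 10/\<beta> vertices of degree 4, its expansion
  is at least \<beta>/40.\<close>

lemma compatible_promises:
  fixes \<beta> \<gamma> \<delta> :: real
  assumes \<beta>: "0 < \<beta>" "\<beta> < \<gamma>" and \<delta>: "0 < \<delta>" "\<delta> < 1" and "\<beta> < 1"
  shows "\<exists>Z. Z \<in> yes_set (SSE (regular_input_graphs 4) \<delta> (1 - \<gamma>) s) \<and>
    Z \<in> no_set (SSE (regular_input_graphs 4) \<delta> c (1 - \<beta> / 578224128))"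
proof -
  \<comment> \<open>The number of copies. With 2h vertices in each, half a copy has an admissible
    volume iff 1/2 \<le> \<delta>m \<le> 1, and strictness on the right makes admissible sets
    smaller than a copy.\<close>
  obtain m :: nat where m: "m \<ge> 1" "1 / 2 \<le> \<delta> * real m" "\<delta> * real m < 1"
  proof (cases "\<delta> < 1 / 2")
    case True
    define m where "m = nat \<lfloor>1 / (2 * \<delta>)\<rfloor> + 1"
    have "real (nat \<lfloor>1 / (2 * \<delta>)\<rfloor>) = of_int \<lfloor>1 / (2 * \<delta>)\<rfloor>" using \<delta> by simp
    then have m: "1 / (2 * \<delta>) \<le> real m" "real m \<le> 1 / (2 * \<delta>) + 1" unfolding m_def by linarith+
    have "\<delta> * (1 / (2 * \<delta>)) \<le> \<delta> * real m" "\<delta> * real m \<le> \<delta> * (1 / (2 * \<delta>) + 1)"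
      by (rule mult_left_mono[OF m(1)], use \<delta> in simp) (rule mult_left_mono[OF m(2)], use \<delta> in simp)
    moreover have "\<delta> * (1 / (2 * \<delta>)) = 1 / 2" using \<delta> by simp
    moreover have "\<delta> * (1 / (2 * \<delta>) + 1) = 1 / 2 + \<delta>" using \<delta> by (simp add: distrib_left)
    ultimately have "1 / 2 \<le> \<delta> * real m" "\<delta> * real m < 1" using True by linarith+
    then show ?thesis by (intro that[of m]) (simp_all add: m_def)
  qed (use \<delta> that[of 1] in auto)
  \<comment> \<open>Half a copy has volume 4h and at most 16 outgoing arcs, so h \<ge> 4/\<beta>
    makes its expansion at most \<beta> < \<gamma>.\<close>
  define h where "h = nat \<lceil>4 / \<beta>\<rceil>"
  have "4 < 4 / \<beta>" using \<beta> \<open>\<beta> < 1\<close> by (simp add: field_simps)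
  then have h: "4 / \<beta> \<le> real h" "real h \<le> 4 / \<beta> + 1" "h \<ge> 4" unfolding h_def by linarith+
  let ?k = "2 * h"
  let ?G = "cycles_graph m ?k"
  have k: "?k \<ge> 5" using h by simp
  note reg = cycles_graph_regular[OF k, of m]
  have pv: "pverts ?G = {..<m * ?k}" by (simp add: cycles_graph_def)
  have vol: "vol ?G X = 4 * card X" if "X \<subseteq> {..<m * ?k}" for X
    using reg that vol_regular[of 4 ?G X] by (simp add: regular_input_graphs_def pv)
  have hm: "h \<le> m * ?k" using m by (cases m) auto
  have vV: "vol ?G (pverts ?G) = 4 * (m * ?k)" using vol[of "pverts ?G"] by (simp add: pv)
  have vH: "vol ?G {..<h} = 4 * h" using vol[of "{..<h}"] hm by simp
  have "?G \<in> yes_set (SSE (regular_input_graphs 4) \<delta> (1 - \<gamma>) s)"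
  proof -
    have "expansion ?G {..<h} \<le> 16 / real (4 * h)"
      unfolding expansion_def vH using half_cycle_crossing[of h m] h m by (intro divide_right_mono) auto
    also have "\<dots> \<le> \<beta>" using h \<beta> by (simp add: field_simps)
    finally have "expansion ?G {..<h} < 1 - (1 - \<gamma>)" using \<beta> by simp
    moreover have "{..<h} \<in> expansion_sets ?G"
      using hm vH h by (auto simp: expansion_sets_def pv lessThan_empty_iff)
    moreover have "\<delta> * real (4 * (m * ?k)) / 2 \<le> real (4 * h)"
    proof -
      have "(\<delta> * real m) * real h \<le> 1 * real h" using m by (intro mult_right_mono) auto
      then show ?thesis by (simp add: algebra_simps)
    qed
    moreover have "real (4 * h) \<le> \<delta> * real (4 * (m * ?k))"
    proof -
      have "(1 / 2) * real h \<le> (\<delta> * real m) * real h" using m by (intro mult_right_mono) auto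
      then show ?thesis by (simp add: algebra_simps)
    qed
    ultimately have "\<exists>X\<in>expansion_sets ?G. \<delta> * real (vol ?G (pverts ?G)) / 2 \<le> real (vol ?G X) \<and>
      real (vol ?G X) \<le> \<delta> * real (vol ?G (pverts ?G)) \<and> expansion ?G X < 1 - (1 - \<gamma>)"
      unfolding vV by (intro bexI[of _ "{..<h}"]) (simp_all only: vH)
    then show ?thesis using reg by (simp add: SSE_def)
  qed
  moreover have "?G \<in> no_set (SSE (regular_input_graphs 4) \<delta> c (1 - \<beta> / 578224128))"
  proof -
    have "1 - (1 - \<beta> / 578224128) \<le> expansion ?G X"
      if X: "X \<in> expansion_sets ?G" "real (vol ?G X) \<le> \<delta> * real (vol ?G (pverts ?G))" for X
    proof -
      have XV: "X \<subseteq> {..<m * ?k}" "X \<noteq> {}" using X(1) by (auto simp: expansion_sets_def pv)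
      have vX: "vol ?G X = 4 * card X" by (rule vol[OF XV(1)])
      have cX: "card X > 0" using X(1) vX by (auto simp: expansion_sets_def)
      have "real (card X) \<le> (\<delta> * real m) * real ?k" using X(2) unfolding vX vV by (simp add: algebra_simps)
      also have "\<dots> < 1 * real ?k" using m h by (intro mult_strict_right_mono) auto
      finally have ck: "card X < ?k" by simp
      have "real (card X) \<le> 8 / \<beta> + 2" using ck h(2) by linarith
      also have "\<dots> \<le> 10 / \<beta>" using \<beta> \<open>\<beta> < 1\<close> by (simp add: field_simps)
      finally have "\<beta> * real (card X) \<le> 10" using \<beta> by (simp add: field_simps)
      then have "\<beta> / 578224128 * real (4 * card X) \<le> 1" by simp
      also have "1 \<le> real (crossing ?G X)" using cycles_graph_expands[OF k XV ck] by simp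
      finally have "\<beta> / 578224128 \<le> expansion ?G X"
        unfolding expansion_def vX using cX by (simp add: field_simps)
      then show ?thesis by simp
    qed
    then show ?thesis using reg by (simp add: SSE_def)
  qed
  ultimately show ?thesis by blast
qed


section \<open>Structured programs on tapes\<close>

datatype com =
    Act "nat list \<Rightarrow> (nat \<times> move) list"
  | Seq com com (infixr \<open>;;\<close> 60)
  | While "nat list \<Rightarrow> bool" com

text \<open>The time is the exact number of machine steps after assembly: a completed iteration of a
  loop pays one step for the test and one for the jump back, and sequencing is free.\<close>

inductive exec :: "com \<Rightarrow> tape list \<Rightarrow> nat \<Rightarrow> tape list \<Rightarrow> bool" where
  exec_Act: "exec (Act h) s 1 (map2 tape_act (h (map scanned s)) s)"
| exec_Seq: "exec a s t1 s' \<Longrightarrow> exec b s' t2 s'' \<Longrightarrow> exec (a ;; b) s (t1 + t2) s''"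
| exec_WhileF: "\<not> P (map scanned s) \<Longrightarrow> exec (While P c) s 1 s"
| exec_WhileT: "P (map scanned s) \<Longrightarrow> exec c s t1 s' \<Longrightarrow> exec (While P c) s' t2 s'' \<Longrightarrow>
    exec (While P c) s (t1 + t2 + 2) s''"

definition stay :: "nat list \<Rightarrow> (nat \<times> move) list" where
  "stay as = map (\<lambda>a. (a, MStay)) as"

lemma length_stay [simp]: "length (stay as) = length as"
  by (simp add: stay_def)

lemma map2_stay [simp]: "map2 tape_act (stay (map scanned s)) s = s"
proof (rule nth_equalityI)
  fix i assume "i < length (map2 tape_act (stay (map scanned s)) s)"
  then show "map2 tape_act (stay (map scanned s)) s ! i = s ! i"
    by (cases "s ! i") (auto simp: stay_def)
qed simp

lemma exec_While_iterate:
  assumes "\<And>i. i < k \<Longrightarrow> P (map scanned (s i))"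
    and "\<And>i. i < k \<Longrightarrow> exec c (s i) (t i) (s (Suc i))"
    and "\<not> P (map scanned (s k))"
  shows "exec (While P c) (s 0) ((\<Sum>i<k. t i + 2) + 1) (s k)"
  using assms
proof (induction k arbitrary: s t)
  case 0
  then show ?case using exec_WhileF[of P "s 0" c] by simp
next
  case (Suc k)
  have "exec (While P c) (s (Suc 0)) ((\<Sum>i<k. t (Suc i) + 2) + 1) (s (Suc k))"
    using Suc.IH[of "\<lambda>i. s (Suc i)" "\<lambda>i. t (Suc i)"] Suc.prems by simp
  from exec_WhileT[OF _ _ this] have
    "exec (While P c) (s 0) (t 0 + ((\<Sum>i<k. t (Suc i) + 2) + 1) + 2) (s (Suc k))"
    using Suc.prems by blast
  moreover have "t 0 + ((\<Sum>i<k. t (Suc i) + 2) + 1) + 2 = (\<Sum>i<Suc k. t i + 2) + 1"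
    by (simp add: sum.lessThan_Suc_shift del: sum.lessThan_Suc)
  ultimately show ?case by simp
qed


subsection \<open>Compilation to Turing machines\<close>

type_synonym tm_instr = "nat list \<Rightarrow> nat \<times> (nat \<times> move) list"

fun code_size :: "com \<Rightarrow> nat" where
  "code_size (Act h) = 1"
| "code_size (a ;; b) = code_size a + code_size b"
| "code_size (While P c) = code_size c + 2"

text \<open>\<open>p\<close> is the state of the first instruction; every fragment hands over
  control by entering the state just behind its own code.\<close>

fun assemble :: "nat \<Rightarrow> com \<Rightarrow> tm_instr list" where
  "assemble p (Act h) = [\<lambda>as. (p + 1, h as)]"
| "assemble p (a ;; b) = assemble p a @ assemble (p + code_size a) b"
| "assemble p (While P c) =
     [\<lambda>as. (if P as then p + 1 else p + code_size c + 2, stay as)] @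
     assemble (p + 1) c @ [\<lambda>as. (p, stay as)]"

lemma length_assemble [simp]: "length (assemble p c) = code_size c"
  by (induction c arbitrary: p) auto

text \<open>State 0 has to be initial and state 1 halting, so the code proper starts at state 2.\<close>

definition tm_code :: "com \<Rightarrow> tm_instr list" where
  "tm_code c = [\<lambda>as. (2, stay as), \<lambda>as. (1, stay as)] @ assemble 2 c @ [\<lambda>as. (1, stay as)]"

definition tm_of :: "nat \<Rightarrow> com \<Rightarrow> tm" where
  "tm_of k c = \<lparr>tm_tapes = k, tm_states = length (tm_code c), tm_symbols = 3,
     tm_trans = (\<lambda>q. tm_code c ! q)\<rparr>"

fun wf_com :: "nat \<Rightarrow> com \<Rightarrow> bool" where
  "wf_com k (Act h) \<longleftrightarrow> (\<forall>as. length as = k \<and> set as \<subseteq> {..<3} \<longrightarrow>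
      length (h as) = k \<and> fst ` set (h as) \<subseteq> {..<3})"
| "wf_com k (a ;; b) \<longleftrightarrow> wf_com k a \<and> wf_com k b"
| "wf_com k (While P c) \<longleftrightarrow> wf_com k c"

lemma fst_stay: "fst ` set (stay as) = set as"
  by (auto simp: stay_def image_image)

lemma assemble_wf:
  assumes "wf_com k c" "i < code_size c" "length as = k" "set as \<subseteq> {..<3}"
  shows "fst ((assemble p c ! i) as) \<le> p + code_size c \<and>
         length (snd ((assemble p c ! i) as)) = k \<and>
         fst ` set (snd ((assemble p c ! i) as)) \<subseteq> {..<3}"
  using assms
proof (induction c arbitrary: p i)
  case (Seq a b)
  show ?case
  proof (cases "i < code_size a")
    case True
    then have "assemble p (a ;; b) ! i = assemble p a ! i" by (simp add: nth_append)
    moreover have "wf_com k a" using Seq.prems(1) by simp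
    ultimately show ?thesis
      using Seq.IH(1)[OF _ True Seq.prems(3,4), of p] by simp
  next
    case False
    then have "assemble p (a ;; b) ! i = assemble (p + code_size a) b ! (i - code_size a)"
      by (simp add: nth_append)
    moreover have "wf_com k b" "i - code_size a < code_size b" using Seq.prems(1,2) False by auto
    ultimately show ?thesis
      using Seq.IH(2)[OF _ _ Seq.prems(3,4), of "i - code_size a" "p + code_size a"]
      by (simp add: add.assoc)
  qed
next
  case (While P c)
  show ?case
  proof (cases "i = 0 \<or> i = Suc (code_size c)")
    case True
    then show ?thesis using While.prems(3,4) by (elim disjE) (simp_all add: fst_stay nth_append)
  next
    case False
    then obtain j where j: "i = Suc j" "j < code_size c"
      using While.prems(2) by (cases i) simp_all
    then have "assemble p (While P c) ! i = assemble (p + 1) c ! j" by (simp add: nth_append)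
    moreover have "wf_com k c" using While.prems(1) by simp
    ultimately show ?thesis
      using While.IH[OF _ j(2) While.prems(3,4), of "p + 1"] by simp
  qed
qed simp

lemma wf_tm_of:
  assumes "wf_com k c" "k \<ge> 1"
  shows "wf_tm (tm_of k c)"
  unfolding wf_tm_def
proof (intro conjI allI impI)
  fix q as assume q: "q < tm_states (tm_of k c)"
    and as: "length as = tm_tapes (tm_of k c) \<and> set as \<subseteq> {..<tm_symbols (tm_of k c)}"
  have len: "length (tm_code c) = code_size c + 3" by (simp add: tm_code_def)
  have as': "length as = k" "set as \<subseteq> {..<3}" using as by (auto simp: tm_of_def)
  show "case tm_trans (tm_of k c) q as of (q', acts) \<Rightarrow>
     q' < tm_states (tm_of k c) \<and> length acts = tm_tapes (tm_of k c) \<and>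
     fst ` set acts \<subseteq> {..<tm_symbols (tm_of k c)}"
  proof (cases "q = 0 \<or> q = 1 \<or> q = code_size c + 2")
    case True
    then show ?thesis using as'
      by (elim disjE) (simp_all add: tm_of_def tm_code_def nth_append fst_stay)
  next
    case False
    then obtain j where j: "q = j + 2" "j < code_size c"
      using q that[of "q - 2"] by (auto simp: tm_of_def len)
    have "tm_trans (tm_of k c) q = assemble 2 c ! j"
      using j by (simp add: tm_of_def tm_code_def nth_append)
    moreover obtain q' acts where "(assemble 2 c ! j) as = (q', acts)"
      by (cases "(assemble 2 c ! j) as") blast
    ultimately show ?thesis
      using assemble_wf[OF assms(1) j(2) as', of 2] by (simp add: tm_of_def len)
  qed
qed (use assms in \<open>auto simp: tm_of_def tm_code_def\<close>)

text \<open>The surrounding code \<open>pre\<close> and \<open>post\<close> is part of the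
  induction, since subprograms sit in the middle of the table. The bound on \<open>p\<close> keeps
  their states away from the halting state 1, on which steps are void.\<close>

lemma exec_simulated:
  assumes "exec c s t s'"
    and "tm_code c0 = pre @ assemble p c @ post" "length pre = p" "p \<ge> 2"
  shows "(tm_step (tm_of k c0) ^^ t) (p, s) = (p + code_size c, s')"
  using assms
proof (induction arbitrary: pre p post rule: exec.induct)
  case (exec_Act h s)
  then show ?case by (simp add: tm_of_def nth_append)
next
  case (exec_Seq a s t1 s' b t2 s'')
  have "(tm_step (tm_of k c0) ^^ t1) (p, s) = (p + code_size a, s')"
    using exec_Seq.IH(1)[of pre p "assemble (p + code_size a) b @ post"] exec_Seq.prems by simp
  moreover have "(tm_step (tm_of k c0) ^^ t2) (p + code_size a, s') =
      (p + code_size a + code_size b, s'')"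
    using exec_Seq.IH(2)[of "pre @ assemble p a" "p + code_size a" post] exec_Seq.prems by simp
  ultimately show ?case
    by (simp add: funpow_add add.commute[of t1] add.assoc)
next
  case (exec_WhileF P s c)
  then show ?case by (simp add: tm_of_def nth_append)
next
  case (exec_WhileT P s c t1 s' t2 s'')
  let ?M = "tm_of k c0"
  have 1: "tm_step ?M (p, s) = (p + 1, s)"
    using exec_WhileT by (simp add: tm_of_def nth_append)
  have 2: "(tm_step ?M ^^ t1) (p + 1, s) = (p + 1 + code_size c, s')"
    using exec_WhileT.IH(1)[of "pre @ [\<lambda>as. (if P as then p + 1 else p + code_size c + 2, stay as)]"
        "p + 1" "[\<lambda>as. (p, stay as)] @ post"] exec_WhileT.prems by simp
  have "tm_code c0 ! (p + 1 + code_size c) = (\<lambda>as. (p, stay as))"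
    using exec_WhileT.prems by (simp add: nth_append)
  then have 3: "tm_step ?M (p + 1 + code_size c, s') = (p, s')"
    using exec_WhileT.prems by (simp add: tm_of_def)
  have 4: "(tm_step ?M ^^ t2) (p, s') = (p + code_size (While P c), s'')"
    using exec_WhileT by blast
  have "t1 + t2 + 2 = t2 + (1 + (t1 + 1))" by simp
  then have "(tm_step ?M ^^ (t1 + t2 + 2)) (p, s) =
      (tm_step ?M ^^ t2) ((tm_step ?M ^^ 1) ((tm_step ?M ^^ t1) ((tm_step ?M ^^ 1) (p, s))))"
    by (simp only: funpow_add o_apply)
  then show ?case using 1 2 3 4 by simp
qed

text \<open>Two steps are added: from the initial state 0 into the code, and from the instruction
  behind the code to the halting state.\<close>

lemma exec_tm_outputs:
  assumes "exec c (snd (tm_init (tm_of k c) w)) t s'" "fst (last s') = word_contents v" "t + 2 \<le> T"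
  shows "tm_outputs_within (tm_of k c) w v T"
proof -
  let ?M = "tm_of k c" and ?s = "snd (tm_init (tm_of k c) w)"
  have i: "tm_init ?M w = (0, ?s)" by (simp add: tm_init_def)
  have 1: "tm_step ?M (0, ?s) = (2, ?s)"
    by (simp add: tm_of_def tm_code_def)
  have 2: "(tm_step ?M ^^ t) (2, ?s) = (2 + code_size c, s')"
    using exec_simulated[OF assms(1), of c "[\<lambda>as. (2, stay as), \<lambda>as. (1, stay as)]" 2 "[\<lambda>as. (1, stay as)]" k]
    by (simp add: tm_code_def)
  have 3: "tm_step ?M (2 + code_size c, s') = (1, s')"
    by (simp add: tm_of_def tm_code_def nth_append)
  have "t + 2 = 1 + (t + 1)" by simp
  then have "(tm_step ?M ^^ (t + 2)) (0, ?s) =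
      (tm_step ?M ^^ 1) ((tm_step ?M ^^ t) ((tm_step ?M ^^ 1) (0, ?s)))"
    by (simp only: funpow_add o_apply)
  then have "(tm_step ?M ^^ (t + 2)) (tm_init ?M w) = (1, s')"
    using 1 2 3 i by simp
  then show ?thesis unfolding tm_outputs_within_def using assms(2,3) by (intro exI[of _ "t + 2"]) auto
qed


section \<open>Registers\<close>

text \<open>
  A register is a tape whose only non-blank cell is cell 0; its value is the head position.
\<close>

definition marker :: "int \<Rightarrow> nat" where
  "marker p = (if p = 0 then 1 else 0)"

text \<open>Tape 0 is the input with its head at \<open>p\<close>, register \<open>r\<close> is tape
  \<open>Suc r\<close>, and the head of the output tape stands on the first cell behind the word
  written so far.\<close>

definition conf :: "nat \<Rightarrow> bool list \<Rightarrow> int \<Rightarrow> (nat \<Rightarrow> nat) \<Rightarrow> bool list \<Rightarrow> tape list" where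
  "conf k w p \<rho> v = (word_contents w, p) # map (\<lambda>r. (marker, int (\<rho> r))) [0..<k] @
     [(word_contents v, int (length v))]"

lemma length_conf [simp]: "length (conf k w p \<rho> v) = k + 2"
  by (simp add: conf_def)

lemma conf_nth_0: "conf k w p \<rho> v ! 0 = (word_contents w, p)"
  by (simp add: conf_def)

lemma conf_nth_reg: "r < k \<Longrightarrow> conf k w p \<rho> v ! Suc r = (marker, int (\<rho> r))"
  by (simp add: conf_def nth_append)

lemma conf_nth_out: "conf k w p \<rho> v ! Suc k = (word_contents v, int (length v))"
  by (simp add: conf_def nth_append)

lemmas conf_nth = conf_nth_0 conf_nth_reg conf_nth_out

lemma conf_upd_0: "(conf k w p \<rho> v)[0 := (word_contents w, q)] = conf k w q \<rho> v"
  by (simp add: conf_def)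

lemma conf_upd_reg: "r < k \<Longrightarrow> (conf k w p \<rho> v)[Suc r := (marker, int x)] = conf k w p (\<rho>(r := x)) v"
  by (rule nth_equalityI) (auto simp: conf_def nth_append nth_list_update nth_Cons split: nat.split)

lemma conf_upd_out:
  "(conf k w p \<rho> v)[Suc k := (word_contents v', int (length v'))] = conf k w p \<rho> v'"
  by (rule nth_equalityI) (auto simp: conf_def nth_append nth_list_update nth_Cons split: nat.split)

definition act1 :: "nat \<Rightarrow> (nat list \<Rightarrow> nat \<times> move) \<Rightarrow> com" where
  "act1 t g = Act (\<lambda>as. (stay as)[t := g as])"

lemma exec_act1:
  assumes "t < length s"
  shows "exec (act1 t g) s 1 (s[t := tape_act (g (map scanned s)) (s ! t)])"
proof -
  have "map2 tape_act ((stay (map scanned s))[t := g (map scanned s)]) s =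
      s[t := tape_act (g (map scanned s)) (s ! t)]"
  proof (rule nth_equalityI)
    fix i assume "i < length (map2 tape_act ((stay (map scanned s))[t := g (map scanned s)]) s)"
    then have i: "i < length s" by simp
    obtain f h where "s ! i = (f, h)" by fastforce
    then have "tape_act (stay (map scanned s) ! i) (s ! i) = s ! i"
      using i by (simp add: stay_def)
    then show "map2 tape_act ((stay (map scanned s))[t := g (map scanned s)]) s ! i =
      s[t := tape_act (g (map scanned s)) (s ! t)] ! i"
      using i by (cases "i = t") (simp_all del: tape_act.simps)
  qed simp
  then show ?thesis using exec_Act[of "\<lambda>as. (stay as)[t := g as]" s] by (simp add: act1_def)
qed

lemma wf_act1:
  assumes "\<And>as. length as = k \<Longrightarrow> set as \<subseteq> {..<3} \<Longrightarrow> fst (g as) < 3"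
  shows "wf_com k (act1 t g)"
proof -
  have "fst ` set ((stay as)[t := g as]) \<subseteq> {..<3}" if "length as = k" "set as \<subseteq> {..<3}" for as
  proof -
    have "fst ` set ((stay as)[t := g as]) \<subseteq> insert (fst (g as)) (fst ` set (stay as))"
      using set_update_subset_insert[of "stay as" t "g as"] by auto
    then show ?thesis using assms[OF that] that by (auto simp: fst_stay)
  qed
  then show ?thesis by (simp add: act1_def)
qed

definition INC :: "nat \<Rightarrow> com" where
  "INC r = act1 (Suc r) (\<lambda>as. (as ! Suc r, MRight))"

text \<open>The head stays put on the marker, which makes this the truncated predecessor of natural
  numbers.\<close>

definition DEC :: "nat \<Rightarrow> com" where
  "DEC r = act1 (Suc r) (\<lambda>as. (as ! Suc r, if as ! Suc r = 1 then MStay else MLeft))"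

definition GO :: "move \<Rightarrow> com" where
  "GO m = act1 0 (\<lambda>as. (as ! 0, m))"

text \<open>Adds the scanned symbol 0, 1 or 2 to the register, as one increment for symbols at least
  1 and another one for symbol 2.\<close>

definition READ :: "nat \<Rightarrow> com" where
  "READ r = act1 (Suc r) (\<lambda>as. (as ! Suc r, if as ! 0 \<ge> 1 then MRight else MStay)) ;;
            act1 (Suc r) (\<lambda>as. (as ! Suc r, if as ! 0 = 2 then MRight else MStay))"

definition OUT :: "nat \<Rightarrow> nat \<Rightarrow> com" where
  "OUT k r = act1 (Suc k) (\<lambda>as. (if as ! Suc r = 1 then 1 else 2, MRight))"

definition LOOP :: "nat \<Rightarrow> com \<Rightarrow> com" where
  "LOOP r c = While (\<lambda>as. as ! Suc r \<noteq> 1) (DEC r ;; c)"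

lemma nth_lt: "set as \<subseteq> {..<3::nat} \<Longrightarrow> i < length as \<Longrightarrow> as ! i < 3"
  using nth_mem by blast

lemma wf_INC: "r < k \<Longrightarrow> wf_com (k + 2) (INC r)"
  and wf_DEC: "r < k \<Longrightarrow> wf_com (k + 2) (DEC r)"
  and wf_GO: "wf_com (k + 2) (GO m)"
  and wf_READ: "r < k \<Longrightarrow> wf_com (k + 2) (READ r)"
  and wf_OUT: "wf_com (k + 2) (OUT k r)"
  unfolding INC_def DEC_def GO_def READ_def OUT_def wf_com.simps
  by (auto intro!: wf_act1 nth_lt)

lemma wf_LOOP: "r < k \<Longrightarrow> wf_com (k + 2) c \<Longrightarrow> wf_com (k + 2) (LOOP r c)"
  using wf_DEC[of r k] by (simp add: LOOP_def)

lemma scanned_conf: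
  "map scanned (conf k w p \<rho> v) ! 0 = word_contents w p"
  "r < k \<Longrightarrow> map scanned (conf k w p \<rho> v) ! Suc r = (if \<rho> r = 0 then 1 else 0)"
  by (simp_all add: conf_nth marker_def)

lemma exec_INC:
  assumes "r < k"
  shows "exec (INC r) (conf k w p \<rho> v) 1 (conf k w p (\<rho>(r := Suc (\<rho> r))) v)"
proof -
  have *: "tape_act (marker (int x), MRight) (marker, int x) = (marker, int (Suc x))" for x
    by simp
  show ?thesis
    using exec_act1[of "Suc r" "conf k w p \<rho> v" "\<lambda>as. (as ! Suc r, MRight)"] assms
      conf_upd_reg[OF assms, of w p \<rho> v "Suc (\<rho> r)"]
    by (simp add: INC_def conf_nth * del: tape_act.simps)
qed

lemma exec_DEC:
  assumes "r < k"
  shows "exec (DEC r) (conf k w p \<rho> v) 1 (conf k w p (\<rho>(r := \<rho> r - 1)) v)"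
proof -
  have *: "tape_act (marker (int x), if marker (int x) = 1 then MStay else MLeft) (marker, int x) =
      (marker, int (x - 1))" for x
    by (cases x) (auto simp: marker_def)
  show ?thesis
    using exec_act1[of "Suc r" "conf k w p \<rho> v" "\<lambda>as. (as ! Suc r, if as ! Suc r = 1 then MStay else MLeft)"] assms
      conf_upd_reg[OF assms, of w p \<rho> v "\<rho> r - 1"]
    by (simp add: DEC_def conf_nth * del: tape_act.simps One_nat_def)
qed

lemma exec_GO:
  "exec (GO m) (conf k w p \<rho> v) 1 (conf k w (p + head_shift m) \<rho> v)"
  using exec_act1[of 0 "conf k w p \<rho> v" "\<lambda>as. (as ! 0, m)"] conf_upd_0[of k w p \<rho> v "p + head_shift m"]
  by (simp add: GO_def conf_nth)

lemma exec_READ: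
  assumes "r < k"
  shows "exec (READ r) (conf k w p \<rho> v) 2 (conf k w p (\<rho>(r := \<rho> r + word_contents w p)) v)"
proof -
  have s: "exec (act1 (Suc r) (\<lambda>as. (as ! Suc r, if Q (as ! 0) then MRight else MStay)))
      (conf k w p \<rho> v) 1 (conf k w p (\<rho>(r := \<rho> r + (if Q (word_contents w p) then 1 else 0))) v)" for Q \<rho>
  proof -
    have *: "tape_act (marker (int x), if Q y then MRight else MStay) (marker, int x) =
      (marker, int (x + (if Q y then 1 else 0)))" for x y
      by (auto simp: marker_def)
    show ?thesis
      using exec_act1[of "Suc r" "conf k w p \<rho> v" "\<lambda>as. (as ! Suc r, if Q (as ! 0) then MRight else MStay)"] assms
        conf_upd_reg[OF assms, of w p \<rho> v "\<rho> r + (if Q (word_contents w p) then 1 else 0)"]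
      by (simp add: conf_nth * del: tape_act.simps)
  qed
  have "exec (READ r) (conf k w p \<rho> v) (1 + 1) (conf k w p (\<rho>(r := \<rho> r +
      (if word_contents w p \<ge> 1 then 1 else 0) + (if word_contents w p = 2 then 1 else 0))) v)"
    unfolding READ_def
    using exec_Seq[OF s[of "\<lambda>x. x \<ge> 1" \<rho>] s[of "\<lambda>x. x = 2"]] by (simp add: add.assoc)
  moreover have "(if word_contents w p \<ge> 1 then 1 else 0) + (if word_contents w p = 2 then 1 else 0) =
      word_contents w p"
    by (simp add: word_contents_def)
  ultimately show ?thesis by (simp add: add.assoc numeral_2_eq_2)
qed

lemma exec_OUT:
  assumes "r < k"
  shows "exec (OUT k r) (conf k w p \<rho> v) 1 (conf k w p \<rho> (v @ [\<rho> r \<noteq> 0]))"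
proof -
  let ?c = "conf k w p \<rho> v"
  define g :: "nat list \<Rightarrow> nat \<times> move" where "g as = (if as ! Suc r = 1 then 1 else 2, MRight)" for as
  have "map scanned ?c ! Suc r = 1 \<longleftrightarrow> \<rho> r = 0"
    unfolding scanned_conf(2)[OF assms] by simp
  then have "g (map scanned ?c) = (if \<rho> r = 0 then 1 else 2, MRight)"
    unfolding g_def by (simp del: nth_map)
  moreover have "tape_act (if \<rho> r = 0 then 1 else 2, MRight) (word_contents v, int (length v)) =
     (word_contents (v @ [\<rho> r \<noteq> 0]), int (length (v @ [\<rho> r \<noteq> 0])))"
    by (auto simp: word_contents_def fun_eq_iff nth_append)
  moreover have "exec (act1 (Suc k) g) ?c 1 (?c[Suc k := tape_act (g (map scanned ?c)) (?c ! Suc k)])"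
    by (rule exec_act1) simp
  moreover have "OUT k r = act1 (Suc k) g" by (simp add: OUT_def g_def[abs_def])
  ultimately show ?thesis
    by (simp only: conf_nth_out conf_upd_out)
qed

text \<open>The sequences \<open>p\<close>, \<open>R\<close>, \<open>v\<close> give the
  configuration before each iteration; the body starts after the counter has been decreased. The
  overhead 3 is the decrement, the test and the jump.\<close>

lemma exec_LOOP:
  assumes "r < k" "\<And>i. i \<le> n \<Longrightarrow> R i r = n - i"
    and "\<And>i. i < n \<Longrightarrow> exec c (conf k w (p i) ((R i)(r := n - Suc i)) (v i)) (t i)
      (conf k w (p (Suc i)) (R (Suc i)) (v (Suc i)))"
  shows "exec (LOOP r c) (conf k w (p 0) (R 0) (v 0)) ((\<Sum>i<n. t i + 3) + 1) (conf k w (p n) (R n) (v n))"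
proof -
  have "exec (DEC r ;; c) (conf k w (p i) (R i) (v i)) (1 + t i)
      (conf k w (p (Suc i)) (R (Suc i)) (v (Suc i)))" if "i < n" for i
  proof -
    have "exec (DEC r) (conf k w (p i) (R i) (v i)) 1 (conf k w (p i) ((R i)(r := n - Suc i)) (v i))"
      using exec_DEC[OF assms(1), of w "p i" "R i" "v i"] assms(2)[of i] that by simp
    then show ?thesis using assms(3)[OF that] by (rule exec_Seq)
  qed
  moreover have "map scanned (conf k w (p i) (R i) (v i)) ! Suc r \<noteq> 1" if "i < n" for i
    using assms(2)[of i] that by (simp only: scanned_conf(2)[OF assms(1)]) simp
  moreover have "\<not> map scanned (conf k w (p n) (R n) (v n)) ! Suc r \<noteq> 1"
    using assms(2)[of n] by (simp only: scanned_conf(2)[OF assms(1)]) simp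
  ultimately have "exec (LOOP r c) (conf k w (p 0) (R 0) (v 0)) ((\<Sum>i<n. 1 + t i + 2) + 1)
      (conf k w (p n) (R n) (v n))"
    unfolding LOOP_def
    by (intro exec_While_iterate[of n _ "\<lambda>i. conf k w (p i) (R i) (v i)"])
  moreover have "(\<Sum>i<n. 1 + t i + 2) = (\<Sum>i<n. t i + 3)"
    by (rule sum.cong) simp_all
  ultimately show ?thesis by simp
qed


section \<open>A language of polynomial-time expressions\<close>

text \<open>
  \<open>SumE a b\<close> is \<open>\<Sum>k<a. b\<close> with \<open>k\<close> as variable 0 of \<open>b\<close>; bounded summation subsumes bounded
  quantification, division and counting, while values and running times stay polynomial.
\<close>

datatype expr =
    Var nat
  | Const nat
  | Add expr expr
  | Sub expr expr
  | SumE expr expr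
  | Inp expr
  | Len

fun eval :: "bool list \<Rightarrow> (nat \<Rightarrow> nat) \<Rightarrow> expr \<Rightarrow> nat" where
  "eval w \<rho> (Var i) = \<rho> i"
| "eval w \<rho> (Const n) = n"
| "eval w \<rho> (Add a b) = eval w \<rho> a + eval w \<rho> b"
| "eval w \<rho> (Sub a b) = eval w \<rho> a - eval w \<rho> b"
| "eval w \<rho> (SumE a b) = (\<Sum>k<eval w \<rho> a. eval w (case_nat k \<rho>) b)"
| "eval w \<rho> (Inp a) = word_contents w (int (eval w \<rho> a))"
| "eval w \<rho> Len = length w"

text \<open>One argument bounds the input length and all variables. Under a sum the new variable is
  smaller than the value of the range, so this argument grows to m plus the bound for the range.
  Coefficients are natural numbers, hence the bounds are monotone.\<close>

fun val_bound :: "expr \<Rightarrow> nat poly" where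
  "val_bound (Var i) = [:0, 1:]"
| "val_bound (Const n) = [:n:]"
| "val_bound (Add a b) = val_bound a + val_bound b"
| "val_bound (Sub a b) = val_bound a"
| "val_bound (SumE a b) = val_bound a * pcompose (val_bound b) ([:0, 1:] + val_bound a)"
| "val_bound (Inp a) = [:2:]"
| "val_bound Len = [:0, 1:]"

lemma eval_le_val_bound:
  assumes "length w \<le> m" "\<And>i. \<rho> i \<le> m"
  shows "eval w \<rho> e \<le> poly (val_bound e) m"
  using assms
proof (induction e arbitrary: \<rho> m)
  case (Sub a b)
  then show ?case by (simp add: le_diff_conv trans_le_add1)
next
  case (SumE a b)
  let ?n = "poly (val_bound a) m"
  have a: "eval w \<rho> a \<le> ?n" using SumE by blast
  have b: "eval w (case_nat k \<rho>) b \<le> poly (val_bound b) (m + ?n)" if "k < eval w \<rho> a" for k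
  proof (rule SumE.IH(2))
    show "length w \<le> m + ?n" using SumE.prems(1) by simp
    show "case_nat k \<rho> i \<le> m + ?n" for i
      using that a SumE.prems(2)[of "i - 1"] by (cases i) auto
  qed
  have "eval w \<rho> (SumE a b) \<le> (\<Sum>k<eval w \<rho> a. poly (val_bound b) (m + ?n))"
    unfolding eval.simps by (intro sum_mono b) simp
  also have "\<dots> \<le> ?n * poly (val_bound b) (m + ?n)"
    using a by (simp add: mult_right_mono)
  finally show ?case by (simp add: poly_pcompose)
qed (auto simp: word_contents_def intro: add_mono)


subsection \<open>Compilation to programs\<close>

text \<open>
  The value of an expression ends up in register \<open>b\<close>; registers above \<open>b\<close> serve as scratch space.
  Register 1 holds the length of the input, and \<open>\<sigma>\<close> maps variables to registers below \<open>b\<close>.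
\<close>

definition MOVE :: "nat \<Rightarrow> nat \<Rightarrow> com" where
  "MOVE r s = LOOP r (INC s)"

definition SKIP :: com where
  "SKIP = GO MStay"

definition CLEAR :: "nat \<Rightarrow> com" where
  "CLEAR r = LOOP r SKIP"

text \<open>A register is read by counting it down, which destroys it; a second copy in the scratch
  register \<open>Suc s\<close> restores it.\<close>

definition COPY :: "nat \<Rightarrow> nat \<Rightarrow> com" where
  "COPY r s = LOOP r (INC s ;; INC (Suc s)) ;; MOVE (Suc s) r"

fun INCS :: "nat \<Rightarrow> nat \<Rightarrow> com" where
  "INCS r 0 = SKIP"
| "INCS r (Suc n) = INC r ;; INCS r n"

text \<open>For sums, \<open>b\<close> accumulates, \<open>b + 1\<close> counts down the range,
  \<open>b + 2\<close> holds the index (which becomes variable 0 of the body) and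
  \<open>b + 3\<close> receives the summand. For inputs, \<open>b + 2\<close> records the distance
  travelled so that the head can return to cell 0.\<close>

fun compile :: "(nat \<Rightarrow> nat) \<Rightarrow> nat \<Rightarrow> expr \<Rightarrow> com" where
  "compile \<sigma> b (Var i) = COPY (\<sigma> i) b"
| "compile \<sigma> b (Const n) = INCS b n"
| "compile \<sigma> b (Add e f) = compile \<sigma> b e ;; compile \<sigma> (Suc b) f ;; MOVE (Suc b) b"
| "compile \<sigma> b (Sub e f) = compile \<sigma> b e ;; compile \<sigma> (Suc b) f ;; LOOP (Suc b) (DEC b)"
| "compile \<sigma> b (SumE e f) =
     compile \<sigma> (b + 1) e ;;
     LOOP (b + 1) (compile (case_nat (b + 2) \<sigma>) (b + 3) f ;; MOVE (b + 3) b ;; INC (b + 2)) ;;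
     CLEAR (b + 2)"
| "compile \<sigma> b (Inp e) =
     compile \<sigma> (b + 1) e ;; LOOP (b + 1) (GO MRight ;; INC (b + 2)) ;; READ b ;; LOOP (b + 2) (GO MLeft)"
| "compile \<sigma> b Len = COPY 1 b"

fun num_regs :: "expr \<Rightarrow> nat" where
  "num_regs (Var i) = 2"
| "num_regs (Const n) = 1"
| "num_regs (Add e f) = num_regs e + num_regs f + 1"
| "num_regs (Sub e f) = num_regs e + num_regs f + 1"
| "num_regs (SumE e f) = num_regs e + num_regs f + 3"
| "num_regs (Inp e) = num_regs e + 3"
| "num_regs Len = 2"

text \<open>Moving or clearing costs 4 steps per unit and copying 5 + 4 = 9. In a sum, the 5
  consists of the loop overhead 3, the exit from moving the summand, and the increment of the
  index.\<close>

fun time_bound :: "expr \<Rightarrow> nat poly" where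
  "time_bound (Var i) = [:2, 9:]"
| "time_bound (Const n) = [:n + 1:]"
| "time_bound (Add e f) = time_bound e + time_bound f + smult 4 (val_bound f) + 1"
| "time_bound (Sub e f) = time_bound e + time_bound f + smult 4 (val_bound f) + 1"
| "time_bound (SumE e f) = time_bound e +
     val_bound e * (pcompose (time_bound f + smult 4 (val_bound f)) ([:0, 1:] + val_bound e) + [:5:]) +
     1 + smult 4 (val_bound e) + 1"
| "time_bound (Inp e) = time_bound e + smult 9 (val_bound e) + [:4:]"
| "time_bound Len = [:2, 9:]"

lemma num_regs_pos: "num_regs e \<ge> 1"
  by (cases e) auto

lemma exec_SKIP: "exec SKIP (conf k w p \<rho> v) 1 (conf k w p \<rho> v)"
  using exec_GO[of MStay k w p \<rho> v] by (simp add: SKIP_def)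

lemma exec_MOVE:
  assumes "r < k" "s < k" "r \<noteq> s"
  shows "exec (MOVE r s) (conf k w p \<rho> v) (4 * \<rho> r + 1) (conf k w p (\<rho>(r := 0, s := \<rho> s + \<rho> r)) v)"
proof -
  let ?R = "\<lambda>i. \<rho>(r := \<rho> r - i, s := \<rho> s + i)"
  have "exec (LOOP r (INC s)) (conf k w p (?R 0) v) ((\<Sum>i<\<rho> r. 1 + 3) + 1) (conf k w p (?R (\<rho> r)) v)"
  proof (rule exec_LOOP[of r k "\<rho> r" ?R "INC s" w "\<lambda>_. p" "\<lambda>_. v"])
    fix i assume "i < \<rho> r"
    have "((?R i)(r := \<rho> r - Suc i))(s := Suc (((?R i)(r := \<rho> r - Suc i)) s)) = ?R (Suc i)"
      using assms by (auto simp: fun_eq_iff)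
    then show "exec (INC s) (conf k w p ((?R i)(r := \<rho> r - Suc i)) v) 1 (conf k w p (?R (Suc i)) v)"
      using exec_INC[OF assms(2), of w p "(?R i)(r := \<rho> r - Suc i)" v] by (simp only:)
  qed (use assms in auto)
  then show ?thesis using assms by (simp add: MOVE_def fun_upd_twist mult.commute)
qed

lemma exec_CLEAR:
  assumes "r < k"
  shows "exec (CLEAR r) (conf k w p \<rho> v) (4 * \<rho> r + 1) (conf k w p (\<rho>(r := 0)) v)"
proof -
  let ?R = "\<lambda>i. \<rho>(r := \<rho> r - i)"
  have "exec (LOOP r SKIP) (conf k w p (?R 0) v) ((\<Sum>i<\<rho> r. 1 + 3) + 1) (conf k w p (?R (\<rho> r)) v)"
  proof (rule exec_LOOP[of r k "\<rho> r" ?R SKIP w "\<lambda>_. p" "\<lambda>_. v"])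
    fix i assume "i < \<rho> r"
    show "exec SKIP (conf k w p ((?R i)(r := \<rho> r - Suc i)) v) 1 (conf k w p (?R (Suc i)) v)"
      using exec_SKIP[of k w p "?R (Suc i)" v] by simp
  qed (use assms in auto)
  then show ?thesis by (simp add: CLEAR_def mult.commute)
qed

lemma exec_COPY:
  assumes "r < s" "Suc s < k" "\<rho> (Suc s) = 0"
  shows "exec (COPY r s) (conf k w p \<rho> v) (9 * \<rho> r + 2) (conf k w p (\<rho>(s := \<rho> s + \<rho> r)) v)"
proof -
  let ?R = "\<lambda>i. \<rho>(r := \<rho> r - i, s := \<rho> s + i, Suc s := i)"
  have "exec (LOOP r (INC s ;; INC (Suc s))) (conf k w p (?R 0) v) ((\<Sum>i<\<rho> r. 2 + 3) + 1)
     (conf k w p (?R (\<rho> r)) v)"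
  proof (rule exec_LOOP[of r k "\<rho> r" ?R "INC s ;; INC (Suc s)" w "\<lambda>_. p" "\<lambda>_. v"])
    fix i assume "i < \<rho> r"
    let ?A = "(?R i)(r := \<rho> r - Suc i)"
    have A: "exec (INC s) (conf k w p ?A v) 1 (conf k w p (?A(s := Suc (?A s))) v)"
      by (rule exec_INC) (use assms in auto)
    have B: "exec (INC (Suc s)) (conf k w p (?A(s := Suc (?A s))) v) 1
      (conf k w p (?A(s := Suc (?A s), Suc s := Suc ((?A(s := Suc (?A s))) (Suc s)))) v)"
      by (rule exec_INC) (use assms in auto)
    have "?A(s := Suc (?A s), Suc s := Suc ((?A(s := Suc (?A s))) (Suc s))) = ?R (Suc i)"
      using assms by (auto simp: fun_eq_iff)
    then show "exec (INC s ;; INC (Suc s)) (conf k w p ?A v) 2 (conf k w p (?R (Suc i)) v)"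
      using exec_Seq[OF A B] by (simp only: one_add_one)
  qed (use assms in auto)
  moreover have "?R 0 = \<rho>" using assms by (auto simp: fun_eq_iff)
  ultimately have 1: "exec (LOOP r (INC s ;; INC (Suc s))) (conf k w p \<rho> v) (5 * \<rho> r + 1)
     (conf k w p (?R (\<rho> r)) v)" by (simp add: mult.commute)
  have 2: "exec (MOVE (Suc s) r) (conf k w p (?R (\<rho> r)) v) (4 * (?R (\<rho> r)) (Suc s) + 1)
     (conf k w p ((?R (\<rho> r))(Suc s := 0, r := (?R (\<rho> r)) r + (?R (\<rho> r)) (Suc s))) v)"
    by (rule exec_MOVE) (use assms in auto)
  have 3: "(?R (\<rho> r))(Suc s := 0, r := (?R (\<rho> r)) r + (?R (\<rho> r)) (Suc s)) = \<rho>(s := \<rho> s + \<rho> r)"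
    using assms by (auto simp: fun_eq_iff)
  have 4: "5 * \<rho> r + 1 + (4 * (?R (\<rho> r)) (Suc s) + 1) = 9 * \<rho> r + 2" by simp
  show ?thesis
    using exec_Seq[OF 1 2] unfolding 3 4 COPY_def .
qed

lemma exec_INCS:
  assumes "r < k"
  shows "exec (INCS r n) (conf k w p \<rho> v) (n + 1) (conf k w p (\<rho>(r := \<rho> r + n)) v)"
proof (induction n arbitrary: \<rho>)
  case 0
  then show ?case using exec_SKIP by simp
next
  case (Suc n)
  from exec_Seq[OF exec_INC[OF assms] Suc[of "\<rho>(r := Suc (\<rho> r))"]] show ?case
    by (simp del: fun_upd_apply add: fun_upd_same fun_upd_other)
qed

lemma wf_compile:
  assumes "b + num_regs e \<le> k" "\<And>i. \<sigma> i < b" "2 \<le> b"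
  shows "wf_com (k + 2) (compile \<sigma> b e)"
proof -
  have [simp]: "wf_com (Suc (Suc k)) (INC r)" "wf_com (Suc (Suc k)) (DEC r)"
    "wf_com (Suc (Suc k)) (READ r)" if "r < k" for r
    using wf_INC[of r k] wf_DEC[of r k] wf_READ[of r k] that by simp_all
  have [simp]: "wf_com (Suc (Suc k)) (GO m)" "wf_com (Suc (Suc k)) SKIP" for m
    using wf_GO[of k m] wf_GO[of k MStay] by (simp_all add: SKIP_def)
  have [simp]: "wf_com (Suc (Suc k)) (LOOP r c)" if "r < k" "wf_com (Suc (Suc k)) c" for r c
    using wf_LOOP that by simp
  have [simp]: "wf_com (Suc (Suc k)) (CLEAR r)" if "r < k" for r
    using that by (simp add: CLEAR_def)
  have [simp]: "wf_com (Suc (Suc k)) (MOVE r s)" if "r < k" "s < k" for r s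
    using that by (simp add: MOVE_def)
  have [simp]: "wf_com (Suc (Suc k)) (COPY r s)" if "r < k" "Suc s < k" for r s
    using that by (simp add: COPY_def)
  have [simp]: "wf_com (Suc (Suc k)) (INCS r n)" if "r < k" for r n
    using that by (induction n) auto
  show ?thesis using assms
  proof (induction e arbitrary: b \<sigma>)
    case (Var i)
    have "\<sigma> i < k" using Var(1) Var(2)[of i] by simp
    then show ?case using Var(1) by simp
  next
    case (SumE e f)
    have "wf_com (k + 2) (compile \<sigma> (b + 1) e)"
      using SumE.prems by (intro SumE.IH(1)) (auto simp: less_Suc_eq)
    moreover have "wf_com (k + 2) (compile (case_nat (b + 2) \<sigma>) (b + 3) f)"
      using SumE.prems by (intro SumE.IH(2)) (auto simp: less_SucI trans_less_add1 numeral_3_eq_3 split: nat.split)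
    ultimately show ?case using SumE.prems num_regs_pos[of e] num_regs_pos[of f] by simp
  next
    case (Inp e)
    have "wf_com (k + 2) (compile \<sigma> (b + 1) e)"
      using Inp.prems by (intro Inp.IH(1)) (auto simp: less_Suc_eq)
    then show ?case using Inp.prems num_regs_pos[of e] by simp
  next
    case (Add e f)
    have "wf_com (k + 2) (compile \<sigma> (Suc b) f)" "wf_com (k + 2) (compile \<sigma> b e)"
      using Add.prems by (intro Add.IH; auto simp: less_Suc_eq)+
    then show ?case using Add.prems num_regs_pos[of f] by simp
  next
    case (Sub e f)
    have "wf_com (k + 2) (compile \<sigma> (Suc b) f)" "wf_com (k + 2) (compile \<sigma> b e)"
      using Sub.prems by (intro Sub.IH; auto simp: less_Suc_eq)+
    then show ?case using Sub.prems num_regs_pos[of f] by simp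
  qed auto
qed

text \<open>The invariant that makes fragments compose: registers from \<open>b\<close> on are 0,
  register 1 is the input length and the input head is on cell 0; the run changes register
  \<open>b\<close> only.\<close>

lemma exec_compile:
  assumes "b + num_regs e \<le> k" "\<And>i. \<sigma> i < b" "2 \<le> b" "\<rho> 1 = length w"
    and "\<And>r. r \<ge> b \<Longrightarrow> \<rho> r = 0" "length w \<le> m" "\<And>i. \<rho> (\<sigma> i) \<le> m"
  shows "\<exists>t \<le> poly (time_bound e) m. exec (compile \<sigma> b e) (conf k w 0 \<rho> v) t
    (conf k w 0 (\<rho>(b := eval w (\<lambda>i. \<rho> (\<sigma> i)) e)) v)"
  using assms
proof (induction e arbitrary: b \<sigma> \<rho> v m)
  case (Var i)
  have "exec (COPY (\<sigma> i) b) (conf k w 0 \<rho> v) (9 * \<rho> (\<sigma> i) + 2)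
      (conf k w 0 (\<rho>(b := \<rho> b + \<rho> (\<sigma> i))) v)"
    using Var by (intro exec_COPY) auto
  then show ?case using Var(5)[of b] Var(7)[of i]
    by (intro exI[of _ "9 * \<rho> (\<sigma> i) + 2"]) (simp del: fun_upd_apply add: fun_upd_same fun_upd_other)
next
  case (Const n)
  have "exec (INCS b n) (conf k w 0 \<rho> v) (n + 1) (conf k w 0 (\<rho>(b := \<rho> b + n)) v)"
    using Const by (intro exec_INCS) auto
  then show ?case using Const(5)[of b] by (intro exI[of _ "n + 1"]) (simp del: fun_upd_apply add: fun_upd_same fun_upd_other)
next
  case (Add e f)
  let ?x = "eval w (\<lambda>i. \<rho> (\<sigma> i)) e" and ?y = "eval w (\<lambda>i. \<rho> (\<sigma> i)) f"
  obtain t1 where t1: "t1 \<le> poly (time_bound e) m"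
    "exec (compile \<sigma> b e) (conf k w 0 \<rho> v) t1 (conf k w 0 (\<rho>(b := ?x)) v)"
    using Add.IH(1)[of b \<sigma> \<rho> m v] Add.prems by (auto simp del: fun_upd_apply)
  let ?\<rho> = "\<rho>(b := ?x)"
  have \<sigma>: "\<sigma> i \<noteq> b" for i using Add.prems(2)[of i] by simp
  have "\<exists>t \<le> poly (time_bound f) m. exec (compile \<sigma> (Suc b) f) (conf k w 0 ?\<rho> v) t
    (conf k w 0 (?\<rho>(Suc b := eval w (\<lambda>i. ?\<rho> (\<sigma> i)) f)) v)"
    using Add.prems by (intro Add.IH(2)) (auto simp: less_Suc_eq)
  then obtain t2 where t2: "t2 \<le> poly (time_bound f) m"
    "exec (compile \<sigma> (Suc b) f) (conf k w 0 ?\<rho> v) t2 (conf k w 0 (?\<rho>(Suc b := ?y)) v)"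
    by (auto simp: \<sigma> fun_upd_other simp del: fun_upd_apply)
  let ?\<rho>' = "?\<rho>(Suc b := ?y)"
  have t3: "exec (MOVE (Suc b) b) (conf k w 0 ?\<rho>' v) (4 * ?\<rho>' (Suc b) + 1)
      (conf k w 0 (?\<rho>'(Suc b := 0, b := ?\<rho>' b + ?\<rho>' (Suc b))) v)"
    using Add.prems(1) num_regs_pos[of f] by (intro exec_MOVE) auto
  have "?\<rho>'(Suc b := 0, b := ?\<rho>' b + ?\<rho>' (Suc b)) = \<rho>(b := ?x + ?y)"
    using Add.prems(5)[of "Suc b"] by (auto simp: fun_eq_iff)
  with exec_Seq[OF t1(2) exec_Seq[OF t2(2) t3]]
  have "exec (compile \<sigma> b (Add e f)) (conf k w 0 \<rho> v) (t1 + (t2 + (4 * ?y + 1)))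
      (conf k w 0 (\<rho>(b := ?x + ?y)) v)" by simp
  moreover have "?y \<le> poly (val_bound f) m"
    using Add.prems by (intro eval_le_val_bound)
  ultimately show ?case using t1(1) t2(1)
    by (intro exI[of _ "t1 + (t2 + (4 * ?y + 1))"]) (simp del: fun_upd_apply add: fun_upd_same fun_upd_other)
next
  case (Sub e f)
  let ?x = "eval w (\<lambda>i. \<rho> (\<sigma> i)) e" and ?y = "eval w (\<lambda>i. \<rho> (\<sigma> i)) f"
  obtain t1 where t1: "t1 \<le> poly (time_bound e) m"
    "exec (compile \<sigma> b e) (conf k w 0 \<rho> v) t1 (conf k w 0 (\<rho>(b := ?x)) v)"
    using Sub.IH(1)[of b \<sigma> \<rho> m v] Sub.prems by (auto simp del: fun_upd_apply)
  let ?\<rho> = "\<rho>(b := ?x)"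
  have \<sigma>: "\<sigma> i \<noteq> b" for i using Sub.prems(2)[of i] by simp
  have "\<exists>t \<le> poly (time_bound f) m. exec (compile \<sigma> (Suc b) f) (conf k w 0 ?\<rho> v) t
    (conf k w 0 (?\<rho>(Suc b := eval w (\<lambda>i. ?\<rho> (\<sigma> i)) f)) v)"
    using Sub.prems by (intro Sub.IH(2)) (auto simp: less_Suc_eq)
  then obtain t2 where t2: "t2 \<le> poly (time_bound f) m"
    "exec (compile \<sigma> (Suc b) f) (conf k w 0 ?\<rho> v) t2 (conf k w 0 (?\<rho>(Suc b := ?y)) v)"
    by (auto simp: \<sigma> fun_upd_other simp del: fun_upd_apply)
  let ?R = "\<lambda>i. \<rho>(b := ?x - i, Suc b := ?y - i)"
  have bk: "Suc b < k" using Sub.prems(1) num_regs_pos[of f] num_regs_pos[of e] by simp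
  have t3: "exec (LOOP (Suc b) (DEC b)) (conf k w 0 (?R 0) v) ((\<Sum>i<?y. 1 + 3) + 1)
      (conf k w 0 (?R ?y) v)"
  proof (rule exec_LOOP[of "Suc b" k ?y ?R "DEC b" w "\<lambda>_. 0" "\<lambda>_. v"])
    fix i assume "i < ?y"
    let ?A = "(?R i)(Suc b := ?y - Suc i)"
    have "?A(b := ?A b - 1) = ?R (Suc i)" by (auto simp: fun_eq_iff)
    then show "exec (DEC b) (conf k w 0 ?A v) 1 (conf k w 0 (?R (Suc i)) v)"
      using exec_DEC[of b k w 0 ?A v] bk by simp
  qed (use bk in auto)
  have "?R ?y = \<rho>(b := ?x - ?y)"
    using Sub.prems(5)[of "Suc b"] by (auto simp: fun_eq_iff)
  moreover have "?R 0 = ?\<rho>(Suc b := ?y)" by simp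
  ultimately have t3': "exec (LOOP (Suc b) (DEC b)) (conf k w 0 (?\<rho>(Suc b := ?y)) v) (4 * ?y + 1)
      (conf k w 0 (\<rho>(b := ?x - ?y)) v)"
    using t3 by (simp add: mult.commute del: fun_upd_apply)
  have "exec (compile \<sigma> b (Sub e f)) (conf k w 0 \<rho> v) (t1 + (t2 + (4 * ?y + 1)))
      (conf k w 0 (\<rho>(b := ?x - ?y)) v)"
    using exec_Seq[OF t1(2) exec_Seq[OF t2(2) t3']] by simp
  moreover have "?y \<le> poly (val_bound f) m"
    using Sub.prems by (intro eval_le_val_bound)
  ultimately show ?case using t1(1) t2(1)
    by (intro exI[of _ "t1 + (t2 + (4 * ?y + 1))"]) (simp del: fun_upd_apply add: fun_upd_same fun_upd_other)
next
  case (SumE e f)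
  let ?x = "eval w (\<lambda>i. \<rho> (\<sigma> i)) e"
  let ?g = "\<lambda>i. eval w (case_nat i (\<lambda>i. \<rho> (\<sigma> i))) f"
  let ?M = "m + poly (val_bound e) m"
  let ?F = "poly (time_bound f) ?M + 4 * poly (val_bound f) ?M"
  have xM: "?x \<le> poly (val_bound e) m"
    using SumE.prems by (intro eval_le_val_bound)
  have \<sigma>: "\<sigma> i < b" for i using SumE.prems(2)[of i] by simp
  have kb: "b + 3 + num_regs f \<le> k" "b + 3 < k" using SumE.prems(1) num_regs_pos[of f] num_regs_pos[of e] by auto
  obtain t1 where t1: "t1 \<le> poly (time_bound e) m"
    "exec (compile \<sigma> (b + 1) e) (conf k w 0 \<rho> v) t1 (conf k w 0 (\<rho>(b + 1 := ?x)) v)"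
    using SumE.IH(1)[of "b + 1" \<sigma> \<rho> m v] SumE.prems by (auto simp: less_SucI simp del: fun_upd_apply)
  let ?R = "\<lambda>i. \<rho>(b := (\<Sum>j<i. ?g j), b + 1 := ?x - i, b + 2 := i)"
  let ?\<tau> = "case_nat (b + 2) \<sigma>"
  have body: "\<exists>t \<le> ?F + 2. exec (compile ?\<tau> (b + 3) f ;; MOVE (b + 3) b ;; INC (b + 2))
      (conf k w 0 ((?R i)(b + 1 := ?x - Suc i)) v) t (conf k w 0 (?R (Suc i)) v)" if "i < ?x" for i
  proof -
    let ?A = "(?R i)(b + 1 := ?x - Suc i)"
    \<comment> \<open>In iteration i the body sees the index i as variable 0 and the outer variables
      shifted by one, exactly as in \<open>eval\<close>.\<close>
    have A\<tau>: "(\<lambda>j. ?A (?\<tau> j)) = case_nat i (\<lambda>i. \<rho> (\<sigma> i))"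
    proof
      fix j show "?A (?\<tau> j) = case_nat i (\<lambda>i. \<rho> (\<sigma> i)) j"
        using \<sigma>[of "j - 1"] by (cases j) auto
    qed
    have le: "case_nat i (\<lambda>i. \<rho> (\<sigma> i)) j \<le> ?M" for j
      using SumE.prems(7)[of "j - 1"] that xM by (cases j) auto
    have lt: "?\<tau> j < b + 3" for j using \<sigma>[of "j - 1"] by (cases j) auto
    have "\<exists>t \<le> poly (time_bound f) ?M. exec (compile ?\<tau> (b + 3) f) (conf k w 0 ?A v) t
      (conf k w 0 (?A(b + 3 := eval w (\<lambda>j. ?A (?\<tau> j)) f)) v)"
    proof (rule SumE.IH(2))
      show "?A (?\<tau> j) \<le> ?M" for j using fun_cong[OF A\<tau>, of j] le[of j] by simp
    qed (use kb lt SumE.prems in auto)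
    then obtain t where t: "t \<le> poly (time_bound f) ?M"
      "exec (compile ?\<tau> (b + 3) f) (conf k w 0 ?A v) t (conf k w 0 (?A(b + 3 := ?g i)) v)"
      unfolding A\<tau> by blast
    let ?B = "?A(b + 3 := ?g i)"
    have t': "exec (MOVE (b + 3) b) (conf k w 0 ?B v) (4 * ?B (b + 3) + 1)
      (conf k w 0 (?B(b + 3 := 0, b := ?B b + ?B (b + 3))) v)"
      using kb by (intro exec_MOVE) auto
    let ?C = "?B(b + 3 := 0, b := ?B b + ?B (b + 3))"
    have t'': "exec (INC (b + 2)) (conf k w 0 ?C v) 1 (conf k w 0 (?C(b + 2 := Suc (?C (b + 2)))) v)"
      using kb by (intro exec_INC) auto
    have C: "?C(b + 2 := Suc (?C (b + 2))) = ?R (Suc i)"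
      using SumE.prems(5)[of "b + 3"] by (auto simp: fun_eq_iff)
    have "?g i \<le> poly (val_bound f) ?M"
      using le SumE.prems by (intro eval_le_val_bound) auto
    then have "t + (4 * ?B (b + 3) + 1 + 1) \<le> ?F + 2" using t(1) by simp
    then show ?thesis
      using exec_Seq[OF t(2) exec_Seq[OF t' t'']] unfolding C by blast
  qed
  then obtain T where T: "T i \<le> ?F + 2" "exec (compile ?\<tau> (b + 3) f ;; MOVE (b + 3) b ;; INC (b + 2))
      (conf k w 0 ((?R i)(b + 1 := ?x - Suc i)) v) (T i) (conf k w 0 (?R (Suc i)) v)" if "i < ?x" for i
    by metis
  have t2: "exec (LOOP (b + 1) (compile ?\<tau> (b + 3) f ;; MOVE (b + 3) b ;; INC (b + 2)))
      (conf k w 0 (?R 0) v) ((\<Sum>i<?x. T i + 3) + 1) (conf k w 0 (?R ?x) v)"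
    by (rule exec_LOOP[of "b + 1" k ?x ?R _ w "\<lambda>_. 0" "\<lambda>_. v"]) (use kb T in auto)
  have R0: "?R 0 = \<rho>(b + 1 := ?x)"
    using SumE.prems(5) by (auto simp: fun_eq_iff)
  have t3: "exec (CLEAR (b + 2)) (conf k w 0 (?R ?x) v) (4 * (?R ?x) (b + 2) + 1)
      (conf k w 0 ((?R ?x)(b + 2 := 0)) v)"
    using kb by (intro exec_CLEAR) auto
  have R1: "(?R ?x)(b + 2 := 0) = \<rho>(b := (\<Sum>j<?x. ?g j))"
    using SumE.prems(5) by (auto simp: fun_eq_iff)
  have "(\<Sum>i<?x. T i + 3) \<le> (\<Sum>i<?x. ?F + 5)"
    using T(1) by (intro sum_mono) fastforce
  also have "\<dots> \<le> poly (val_bound e) m * (?F + 5)"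
    using xM by (simp add: mult_le_mono1 del: add_mult_distrib2)
  finally have "t1 + ((\<Sum>i<?x. T i + 3) + 1 + (4 * (?R ?x) (b + 2) + 1)) \<le> poly (time_bound (SumE e f)) m"
    using t1(1) xM by (simp add: poly_pcompose)
  moreover note exec_Seq[OF t1(2) exec_Seq[OF t2[unfolded R0] t3, unfolded R1]]
  ultimately show ?case by (auto simp only: compile.simps eval.simps)
next
  case (Inp e)
  let ?x = "eval w (\<lambda>i. \<rho> (\<sigma> i)) e"
  have xM: "?x \<le> poly (val_bound e) m"
    using Inp.prems by (intro eval_le_val_bound)
  have kb: "b + 2 < k" using Inp.prems(1) num_regs_pos[of e] by auto
  obtain t1 where t1: "t1 \<le> poly (time_bound e) m"
    "exec (compile \<sigma> (b + 1) e) (conf k w 0 \<rho> v) t1 (conf k w 0 (\<rho>(b + 1 := ?x)) v)"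
    using Inp.IH[of "b + 1" \<sigma> \<rho> m v] Inp.prems by (auto simp: less_SucI simp del: fun_upd_apply)
  let ?R = "\<lambda>i. \<rho>(b + 1 := ?x - i, b + 2 := i)"
  have t2: "exec (LOOP (b + 1) (GO MRight ;; INC (b + 2))) (conf k w (int 0) (?R 0) v)
      ((\<Sum>i<?x. 2 + 3) + 1) (conf k w (int ?x) (?R ?x) v)"
  proof (rule exec_LOOP[of "b + 1" k ?x ?R _ w int "\<lambda>_. v"])
    fix i assume "i < ?x"
    let ?A = "(?R i)(b + 1 := ?x - Suc i)"
    have 1: "exec (GO MRight) (conf k w (int i) ?A v) 1 (conf k w (int i + head_shift MRight) ?A v)"
      by (rule exec_GO)
    have 2: "exec (INC (b + 2)) (conf k w (int i + head_shift MRight) ?A v) 1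
      (conf k w (int i + head_shift MRight) (?A(b + 2 := Suc (?A (b + 2)))) v)"
      using kb by (intro exec_INC) auto
    have 3: "?A(b + 2 := Suc (?A (b + 2))) = ?R (Suc i)" by (auto simp: fun_eq_iff)
    have 4: "int i + head_shift MRight = int (Suc i)" by simp
    show "exec (GO MRight ;; INC (b + 2)) (conf k w (int i) ?A v) 2 (conf k w (int (Suc i)) (?R (Suc i)) v)"
      using exec_Seq[OF 1 2] unfolding 3 4 one_add_one .
  qed (use kb in auto)
  let ?y = "word_contents w (int ?x)"
  have t3: "exec (READ b) (conf k w (int ?x) (?R ?x) v) 2
      (conf k w (int ?x) ((?R ?x)(b := (?R ?x) b + ?y)) v)"
    using kb by (intro exec_READ) auto
  let ?S = "\<lambda>i. \<rho>(b := ?y, b + 2 := ?x - i)"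
  have S0: "(?R ?x)(b := (?R ?x) b + ?y) = ?S 0"
    using Inp.prems(5) by (auto simp: fun_eq_iff)
  have t4: "exec (LOOP (b + 2) (GO MLeft)) (conf k w (int ?x - int 0) (?S 0) v)
      ((\<Sum>i<?x. 1 + 3) + 1) (conf k w (int ?x - int ?x) (?S ?x) v)"
  proof (rule exec_LOOP[of "b + 2" k ?x ?S _ w "\<lambda>i. int ?x - int i" "\<lambda>_. v"])
    fix i assume "i < ?x"
    have "(?S i)(b + 2 := ?x - Suc i) = ?S (Suc i)" by (auto simp: fun_eq_iff)
    then show "exec (GO MLeft) (conf k w (int ?x - int i) ((?S i)(b + 2 := ?x - Suc i)) v) 1
        (conf k w (int ?x - int (Suc i)) (?S (Suc i)) v)"
      using exec_GO[of MLeft k w "int ?x - int i" "?S (Suc i)" v] by (simp add: algebra_simps)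
  qed (use kb in auto)
  have S1: "?S ?x = \<rho>(b := ?y)" "?R 0 = \<rho>(b + 1 := ?x)"
    using Inp.prems(5) by (auto simp: fun_eq_iff)
  have i0: "int 0 = 0" "int ?x - 0 = int ?x" "int ?x - int ?x = 0" by auto
  have "exec (compile \<sigma> b (Inp e)) (conf k w 0 \<rho> v)
     (t1 + ((\<Sum>i<?x. 2 + 3) + 1 + (2 + ((\<Sum>i<?x. 1 + 3) + 1)))) (conf k w 0 (\<rho>(b := ?y)) v)"
    using exec_Seq[OF t1(2) exec_Seq[OF t2[unfolded S1 i0] exec_Seq[OF t3[unfolded S0] t4[unfolded S1 i0]]]]
    by (simp only: compile.simps)
  then show ?case using t1(1) xM
    by (intro exI[of _ "t1 + ((\<Sum>i<?x. 2 + 3) + 1 + (2 + ((\<Sum>i<?x. 1 + 3) + 1)))"]) (simp del: fun_upd_apply add: fun_upd_same fun_upd_other)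
next
  case Len
  have "exec (COPY 1 b) (conf k w 0 \<rho> v) (9 * \<rho> 1 + 2)
      (conf k w 0 (\<rho>(b := \<rho> b + \<rho> 1)) v)"
    using Len by (intro exec_COPY) auto
  then show ?case using Len(4) Len(5)[of b] Len(6)
    by (intro exI[of _ "9 * length w + 2"]) (simp del: fun_upd_apply add: fun_upd_same fun_upd_other)
qed


subsection \<open>Computing a word bit by bit\<close>

text \<open>Markers are written on the k register tapes, then the input length is counted in
  register 0 and moved to register 1 while the head returns. Register 0 is now 0 and stands for all
  variables without a value; register 2 counts the remaining output bits, 3 is the position and 4
  the computed bit.\<close>

definition program :: "nat \<Rightarrow> expr \<Rightarrow> expr \<Rightarrow> com" where
  "program k l e =
     Act (\<lambda>as. map (\<lambda>i. (if 1 \<le> i \<and> i \<le> k then 1 else as ! i, MStay)) [0..<length as]) ;;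
     While (\<lambda>as. as ! 0 \<noteq> 0) (GO MRight ;; INC 0) ;;
     LOOP 0 (GO MLeft ;; INC 1) ;;
     compile (\<lambda>_. 0) 2 l ;;
     LOOP 2 (compile (case_nat 3 (\<lambda>_. 0)) 4 e ;; OUT k 4 ;; CLEAR 4 ;; INC 3)"

lemma wf_program:
  assumes "4 + num_regs l + num_regs e \<le> k"
  shows "wf_com (k + 2) (program k l e)"
proof -
  have 1: "wf_com (k + 2) (Act (\<lambda>as. map (\<lambda>i. (if 1 \<le> i \<and> i \<le> k then 1 else as ! i, MStay)) [0..<length as]))"
    unfolding wf_com.simps using nth_mem by (fastforce simp: subset_iff)
  have 2: "wf_com (k + 2) (compile (\<lambda>_. 0) 2 l)" "wf_com (k + 2) (compile (case_nat 3 (\<lambda>_. 0)) 4 e)"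
    using assms by (intro wf_compile; auto split: nat.split)+
  have k: "4 < k" using assms num_regs_pos[of l] num_regs_pos[of e] by simp
  have "wf_com (k + 2) (CLEAR 4)"
    unfolding CLEAR_def SKIP_def by (intro wf_LOOP wf_GO k)
  then have "wf_com (k + 2) (LOOP 2 (compile (case_nat 3 (\<lambda>_. 0)) 4 e ;; OUT k 4 ;; CLEAR 4 ;; INC 3))"
    using k 2(2) wf_OUT[of k 4] by (intro wf_LOOP) (auto simp: wf_INC simp del: add_2_eq_Suc')
  moreover have "wf_com (k + 2) (LOOP 0 (GO MLeft ;; INC 1))"
    using k by (intro wf_LOOP) (auto simp: wf_INC wf_GO simp del: add_2_eq_Suc')
  moreover have "wf_com (k + 2) (GO MRight ;; INC 0)"
    using k by (auto simp: wf_INC wf_GO simp del: add_2_eq_Suc')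
  ultimately show ?thesis
    unfolding program_def wf_com.simps(2,3) using 1 2(1) by blast
qed

text \<open>The initial 9L + 3 is one step for the markers, 4L + 1 for measuring the input and 5L +
  1 for rewinding.\<close>

definition program_time :: "expr \<Rightarrow> expr \<Rightarrow> nat poly" where
  "program_time l e = [:3, 9:] + time_bound l +
     val_bound l * pcompose (time_bound e + smult 4 (val_bound e) + [:6:]) ([:0, 1:] + val_bound l) + 1"

lemma nth_Cons_replicate: "r \<le> k \<Longrightarrow> (x # replicate k x) ! r = x"
  by (cases r) auto

lemma exec_program:
  fixes w :: "bool list"
  assumes k: "4 + num_regs l + num_regs e \<le> k"
  defines "n \<equiv> eval w (\<lambda>_. 0) l"
  defines "u \<equiv> map (\<lambda>i. eval w (case_nat i (\<lambda>_. 0)) e \<noteq> 0) [0..<n]"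
  shows "\<exists>t \<le> poly (program_time l e) (length w). \<exists>\<rho>. exec (program k l e)
    ((word_contents w, 0) # replicate (k + 1) (word_contents [], 0)) t (conf k w 0 \<rho> u)"
proof -
  let ?s = "(word_contents w, 0) # replicate (k + 1) (word_contents [], 0) :: tape list"
  let ?L = "length w"
  have k4: "4 < k" using k num_regs_pos[of l] num_regs_pos[of e] by simp
  define \<rho>0 :: "nat \<Rightarrow> nat" where "\<rho>0 = (\<lambda>_. 0)"
  have init: "exec (Act (\<lambda>as. map (\<lambda>i. (if 1 \<le> i \<and> i \<le> k then 1 else as ! i, MStay)) [0..<length as]))
      ?s 1 (conf k w 0 \<rho>0 [])" (is "exec (Act ?h) _ _ _")
  proof -
    have "map2 tape_act (?h (map scanned ?s)) ?s = conf k w 0 \<rho>0 []"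
    proof (rule nth_equalityI)
      fix i assume i: "i < length (map2 tape_act (?h (map scanned ?s)) ?s)"
      consider "i = 0" | r where "i = Suc r" "r < k" | "i = Suc k"
        using i by (cases i) fastforce+
      then show "map2 tape_act (?h (map scanned ?s)) ?s ! i = conf k w 0 \<rho>0 [] ! i"
      proof cases
        case 2
        have e: "(word_contents [])(0 := 1) = marker"
          by (auto simp: word_contents_def marker_def)
        from 2 e show ?thesis by (simp add: conf_nth \<rho>0_def nth_Cons_replicate del: upt_Suc)
      next
        case 3
        then show ?thesis by (simp add: conf_nth nth_Cons_replicate del: upt_Suc)
      qed (simp_all add: conf_nth del: upt_Suc)
    qed simp
    then show ?thesis using exec_Act[of ?h ?s] by (simp only:)
  qed
  have len: "exec (While (\<lambda>as. as ! 0 \<noteq> 0) (GO MRight ;; INC 0)) (conf k w (int 0) (\<rho>0(0 := 0)) [])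
     ((\<Sum>i<?L. 2 + 2) + 1) (conf k w (int ?L) (\<rho>0(0 := ?L)) [])"
  proof (rule exec_While_iterate[of ?L _ "\<lambda>i. conf k w (int i) (\<rho>0(0 := i)) []"])
    fix i assume "i < ?L"
    then show "map scanned (conf k w (int i) (\<rho>0(0 := i)) []) ! 0 \<noteq> 0"
      by (simp only: scanned_conf) (simp add: word_contents_def)
    have "exec (GO MRight) (conf k w (int i) (\<rho>0(0 := i)) []) 1 (conf k w (int (Suc i)) (\<rho>0(0 := i)) [])"
      using exec_GO[of MRight k w "int i" "\<rho>0(0 := i)" "[]"] by (simp add: add.commute)
    moreover have "exec (INC 0) (conf k w (int (Suc i)) (\<rho>0(0 := i)) []) 1 (conf k w (int (Suc i)) (\<rho>0(0 := Suc i)) [])"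
      using exec_INC[of 0 k w "int (Suc i)" "\<rho>0(0 := i)" "[]"] k4 by simp
    ultimately show "exec (GO MRight ;; INC 0) (conf k w (int i) (\<rho>0(0 := i)) []) 2 (conf k w (int (Suc i)) (\<rho>0(0 := Suc i)) [])"
      using exec_Seq one_add_one by metis
  next
    show "\<not> map scanned (conf k w (int ?L) (\<rho>0(0 := ?L)) []) ! 0 \<noteq> 0"
      by (simp only: scanned_conf) (simp add: word_contents_def)
  qed
  let ?R = "\<lambda>i. \<rho>0(0 := ?L - i, 1 := i)"
  have rewind: "exec (LOOP 0 (GO MLeft ;; INC 1)) (conf k w (int ?L - int 0) (?R 0) [])
     ((\<Sum>i<?L. 2 + 3) + 1) (conf k w (int ?L - int ?L) (?R ?L) [])"
  proof (rule exec_LOOP[of 0 k ?L ?R _ w "\<lambda>i. int ?L - int i" "\<lambda>_. []"])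
    fix i assume "i < ?L"
    let ?A = "(?R i)(0 := ?L - Suc i)"
    have "exec (GO MLeft) (conf k w (int ?L - int i) ?A []) 1 (conf k w (int ?L - int (Suc i)) ?A [])"
      using exec_GO[of MLeft k w "int ?L - int i" ?A "[]"] by (simp add: algebra_simps)
    moreover have "exec (INC 1) (conf k w (int ?L - int (Suc i)) ?A []) 1 (conf k w (int ?L - int (Suc i)) (?A(1 := Suc (?A 1))) [])"
      using k4 by (intro exec_INC) simp
    moreover have "?A(1 := Suc (?A 1)) = ?R (Suc i)" by (auto simp: fun_eq_iff)
    ultimately show "exec (GO MLeft ;; INC 1) (conf k w (int ?L - int i) ?A []) 2
        (conf k w (int ?L - int (Suc i)) (?R (Suc i)) [])"
      using exec_Seq one_add_one by metis
  qed (use k4 in auto)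
  define \<rho>1 where "\<rho>1 = \<rho>0(1 := ?L)"
  have R: "?R 0 = \<rho>0(0 := ?L)" "?R ?L = \<rho>1" "\<rho>0(0 := 0) = \<rho>0"
    by (auto simp: \<rho>0_def \<rho>1_def fun_eq_iff)
  have "\<exists>t \<le> poly (time_bound l) ?L. exec (compile (\<lambda>_. 0) 2 l) (conf k w 0 \<rho>1 []) t
     (conf k w 0 (\<rho>1(2 := eval w (\<lambda>i. \<rho>1 0) l)) [])"
    using k by (intro exec_compile) (auto simp: \<rho>1_def \<rho>0_def)
  then obtain t1 where t1: "t1 \<le> poly (time_bound l) ?L"
    "exec (compile (\<lambda>_. 0) 2 l) (conf k w 0 \<rho>1 []) t1 (conf k w 0 (\<rho>1(2 := n)) [])"
    by (auto simp: n_def \<rho>1_def \<rho>0_def)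
  have n: "n \<le> poly (val_bound l) ?L" unfolding n_def by (rule eval_le_val_bound) auto
  let ?M = "?L + poly (val_bound l) ?L"
  let ?bit = "\<lambda>i. eval w (case_nat i (\<lambda>_. 0)) e"
  let ?S = "\<lambda>i. \<rho>1(2 := n - i, 3 := i)" and ?v = "\<lambda>i. map (\<lambda>i. ?bit i \<noteq> 0) [0..<i]"
  let ?F = "poly (time_bound e) ?M + 4 * poly (val_bound e) ?M + 3"
  have body: "\<exists>t \<le> ?F. exec (compile (case_nat 3 (\<lambda>_. 0)) 4 e ;; OUT k 4 ;; CLEAR 4 ;; INC 3)
      (conf k w 0 ((?S i)(2 := n - Suc i)) (?v i)) t (conf k w 0 (?S (Suc i)) (?v (Suc i)))" if "i < n" for i
  proof -
    let ?A = "(?S i)(2 := n - Suc i)"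
    have A: "(\<lambda>j. ?A (case_nat 3 (\<lambda>_. 0) j)) = case_nat i (\<lambda>_. 0)"
      by (auto simp: fun_eq_iff \<rho>1_def \<rho>0_def split: nat.split)
    have iM: "case_nat i (\<lambda>_. 0) j \<le> ?M" for j using that n by (cases j) auto
    have "\<exists>t \<le> poly (time_bound e) ?M. exec (compile (case_nat 3 (\<lambda>_. 0)) 4 e) (conf k w 0 ?A (?v i)) t
       (conf k w 0 (?A(4 := eval w (\<lambda>j. ?A (case_nat 3 (\<lambda>_. 0) j)) e)) (?v i))"
    proof (rule exec_compile)
      show "?A (case_nat 3 (\<lambda>_. 0) j) \<le> ?M" for j using fun_cong[OF A, of j] iM[of j] by simp
    qed (use k in \<open>auto simp: \<rho>1_def \<rho>0_def split: nat.split\<close>)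
    then obtain t where t: "t \<le> poly (time_bound e) ?M"
      "exec (compile (case_nat 3 (\<lambda>_. 0)) 4 e) (conf k w 0 ?A (?v i)) t (conf k w 0 (?A(4 := ?bit i)) (?v i))"
      unfolding A by blast
    let ?B = "?A(4 := ?bit i)"
    have o: "exec (OUT k 4) (conf k w 0 ?B (?v i)) 1 (conf k w 0 ?B (?v i @ [?B 4 \<noteq> 0]))"
      using k4 by (rule exec_OUT)
    have c: "exec (CLEAR 4) (conf k w 0 ?B (?v i @ [?B 4 \<noteq> 0])) (4 * ?B 4 + 1) (conf k w 0 (?B(4 := 0)) (?v i @ [?B 4 \<noteq> 0]))"
      using k4 by (rule exec_CLEAR)
    have d: "exec (INC 3) (conf k w 0 (?B(4 := 0)) (?v i @ [?B 4 \<noteq> 0])) 1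
       (conf k w 0 (?B(4 := 0, 3 := Suc ((?B(4 := 0)) 3))) (?v i @ [?B 4 \<noteq> 0]))"
      using k4 by (intro exec_INC) simp
    have e1: "?B(4 := 0, 3 := Suc ((?B(4 := 0)) 3)) = ?S (Suc i)"
      by (auto simp: fun_eq_iff \<rho>1_def \<rho>0_def)
    have e2: "?v i @ [?B 4 \<noteq> 0] = ?v (Suc i)" by simp
    have "?bit i \<le> poly (val_bound e) ?M"
      using iM by (intro eval_le_val_bound) auto
    then have "t + (1 + (4 * ?B 4 + 1 + 1)) \<le> ?F" using t(1) by simp
    then show ?thesis
      using exec_Seq[OF t(2) exec_Seq[OF o exec_Seq[OF c d]]] unfolding e1 e2 by blast
  qed
  then obtain T where T: "T i \<le> ?F" "exec (compile (case_nat 3 (\<lambda>_. 0)) 4 e ;; OUT k 4 ;; CLEAR 4 ;; INC 3)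
      (conf k w 0 ((?S i)(2 := n - Suc i)) (?v i)) (T i) (conf k w 0 (?S (Suc i)) (?v (Suc i)))" if "i < n" for i
    by metis
  have main: "exec (LOOP 2 (compile (case_nat 3 (\<lambda>_. 0)) 4 e ;; OUT k 4 ;; CLEAR 4 ;; INC 3))
      (conf k w 0 (?S 0) (?v 0)) ((\<Sum>i<n. T i + 3) + 1) (conf k w 0 (?S n) (?v n))"
    by (rule exec_LOOP[of 2 k n ?S _ w "\<lambda>_. 0" ?v]) (use k4 T in auto)
  have S0: "?S 0 = \<rho>1(2 := n)" "?v 0 = []" by (auto simp: fun_eq_iff \<rho>1_def \<rho>0_def)
  have i0: "int 0 = 0" "int ?L - 0 = int ?L" "int ?L - int ?L = 0" by auto
  note all = exec_Seq[OF init exec_Seq[OF len[unfolded R i0] exec_Seq[OF rewind[unfolded R i0]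
    exec_Seq[OF t1(2) main[unfolded S0]]]]]
  have "(\<Sum>i<n. T i + 3) \<le> (\<Sum>i<n. ?F + 3)"
    using T(1) by (intro sum_mono) fastforce
  also have "\<dots> \<le> poly (val_bound l) ?L * (?F + 3)"
    using n by (simp add: mult_le_mono1 del: add_mult_distrib2)
  finally have "1 + ((\<Sum>i<?L. 2 + 2) + 1 + ((\<Sum>i<?L. 2 + 3) + 1 + (t1 + ((\<Sum>i<n. T i + 3) + 1))))
     \<le> poly (program_time l e) ?L"
    using t1(1) by (simp add: program_time_def poly_pcompose algebra_simps)
  with all show ?thesis unfolding program_def u_def by blast
qed

lemma polytime_map_exprs:
  assumes "\<And>x. x \<in> D \<Longrightarrow> length (enc_out (f x)) = eval (enc_in x) (\<lambda>_. 0) l"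
    and "\<And>x i. x \<in> D \<Longrightarrow> i < length (enc_out (f x)) \<Longrightarrow>
      enc_out (f x) ! i \<longleftrightarrow> eval (enc_in x) (case_nat i (\<lambda>_. 0)) e \<noteq> 0"
  shows "polytime_map enc_in enc_out D f"
  unfolding polytime_map_def
proof (intro exI conjI ballI)
  let ?k = "4 + num_regs l + num_regs e"
  let ?c = "program ?k l e" and ?p = "program_time l e + 2"
  show "wf_tm (tm_of (?k + 2) ?c)"
    by (intro wf_tm_of wf_program) auto
  fix x assume x: "x \<in> D"
  have "enc_out (f x) = map (\<lambda>i. eval (enc_in x) (case_nat i (\<lambda>_. 0)) e \<noteq> 0) [0..<eval (enc_in x) (\<lambda>_. 0) l]"
    using assms[OF x] by (intro nth_equalityI) auto
  with exec_program[of l e ?k "enc_in x"] obtain t \<rho> where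
    t: "t \<le> poly (program_time l e) (length (enc_in x))"
    "exec ?c ((word_contents (enc_in x), 0) # replicate (?k + 1) (word_contents [], 0)) t
      (conf ?k (enc_in x) 0 \<rho> (enc_out (f x)))" by auto
  have "snd (tm_init (tm_of (?k + 2) ?c) (enc_in x)) =
     (word_contents (enc_in x), 0) # replicate (?k + 1) (word_contents [], 0)"
    by (simp add: tm_init_def tm_of_def)
  with t(2) show "tm_outputs_within (tm_of (?k + 2) ?c) (enc_in x) (enc_out (f x)) (poly ?p (length (enc_in x)))"
    using t(1) by (intro exec_tm_outputs) (auto simp: conf_def)
qed


section \<open>Expressible functions\<close>

text \<open>A semantic notion: definability of concrete functions is derived from closure rules
  instead of writing out expressions and evaluating them.\<close>

definition expressible :: "(bool list \<Rightarrow> (nat \<Rightarrow> nat) \<Rightarrow> nat) \<Rightarrow> bool" where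
  "expressible F \<longleftrightarrow> (\<exists>e. \<forall>w \<rho>. eval w \<rho> e = F w \<rho>)"

abbreviation decidable :: "(bool list \<Rightarrow> (nat \<Rightarrow> nat) \<Rightarrow> bool) \<Rightarrow> bool" where
  "decidable P \<equiv> expressible (\<lambda>w \<rho>. of_bool (P w \<rho>))"

lemma expressible_var: "expressible (\<lambda>w \<rho>. \<rho> i)"
  unfolding expressible_def by (rule exI[of _ "Var i"]) simp

lemma expressible_const: "expressible (\<lambda>w \<rho>. k)"
  unfolding expressible_def by (rule exI[of _ "Const k"]) simp

lemma expressible_length: "expressible (\<lambda>w \<rho>. length w)"
  unfolding expressible_def by (rule exI[of _ Len]) simp

lemma expressible_add:
  assumes "expressible f" "expressible g"
  shows "expressible (\<lambda>w \<rho>. f w \<rho> + g w \<rho>)"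
proof -
  obtain a b where "\<forall>w \<rho>. eval w \<rho> a = f w \<rho>" "\<forall>w \<rho>. eval w \<rho> b = g w \<rho>"
    using assms unfolding expressible_def by blast
  then show ?thesis unfolding expressible_def by (intro exI[of _ "Add a b"]) simp
qed

lemma expressible_diff:
  assumes "expressible f" "expressible g"
  shows "expressible (\<lambda>w \<rho>. f w \<rho> - g w \<rho>)"
proof -
  obtain a b where "\<forall>w \<rho>. eval w \<rho> a = f w \<rho>" "\<forall>w \<rho>. eval w \<rho> b = g w \<rho>"
    using assms unfolding expressible_def by blast
  then show ?thesis unfolding expressible_def by (intro exI[of _ "Sub a b"]) simp
qed

text \<open>In the second premise the bound variable is \<rho> 0 and the outer variables are
  shifted, as de Bruijn indices demand; parameters are carried under the binder by
  \<open>expressible_weaken\<close>.\<close>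

lemma expressible_sum:
  assumes "expressible f" "expressible (\<lambda>w \<rho>. g w (\<lambda>i. \<rho> (Suc i)) (\<rho> 0))"
  shows "expressible (\<lambda>w \<rho>. \<Sum>k<f w \<rho>. g w \<rho> k)"
proof -
  obtain a b where "\<forall>w \<rho>. eval w \<rho> a = f w \<rho>" "\<forall>w \<rho>. eval w \<rho> b = g w (\<lambda>i. \<rho> (Suc i)) (\<rho> 0)"
    using assms unfolding expressible_def by blast
  then show ?thesis unfolding expressible_def by (intro exI[of _ "SumE a b"]) simp
qed

lemma expressible_input:
  assumes "expressible f"
  shows "expressible (\<lambda>w \<rho>. word_contents w (int (f w \<rho>)))"
proof -
  obtain a where "\<forall>w \<rho>. eval w \<rho> a = f w \<rho>" using assms unfolding expressible_def by blast
  then show ?thesis unfolding expressible_def by (intro exI[of _ "Inp a"]) simp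
qed

fun rename :: "(nat \<Rightarrow> nat) \<Rightarrow> expr \<Rightarrow> expr" where
  "rename \<sigma> (Var i) = Var (\<sigma> i)"
| "rename \<sigma> (Const n) = Const n"
| "rename \<sigma> (Add a b) = Add (rename \<sigma> a) (rename \<sigma> b)"
| "rename \<sigma> (Sub a b) = Sub (rename \<sigma> a) (rename \<sigma> b)"
| "rename \<sigma> (SumE a b) = SumE (rename \<sigma> a) (rename (case_nat 0 (\<lambda>i. Suc (\<sigma> i))) b)"
| "rename \<sigma> (Inp a) = Inp (rename \<sigma> a)"
| "rename \<sigma> Len = Len"

lemma eval_rename: "eval w \<rho> (rename \<sigma> e) = eval w (\<lambda>i. \<rho> (\<sigma> i)) e"
proof (induction e arbitrary: \<rho> \<sigma>)
  case (SumE a b)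
  have "(\<lambda>i. case_nat k \<rho> (case_nat 0 (\<lambda>i. Suc (\<sigma> i)) i)) = case_nat k (\<lambda>i. \<rho> (\<sigma> i))" for k
    by (auto split: nat.split)
  then show ?case using SumE by simp
qed simp_all

lemma expressible_rename:
  assumes "expressible f"
  shows "expressible (\<lambda>w \<rho>. f w (\<lambda>i. \<rho> (\<sigma> i)))"
proof -
  obtain a where "\<forall>w \<rho>. eval w \<rho> a = f w \<rho>" using assms unfolding expressible_def by blast
  then show ?thesis unfolding expressible_def by (intro exI[of _ "rename \<sigma> a"]) (simp add: eval_rename)
qed

lemma expressible_weaken:
  assumes "expressible f"
  shows "expressible (\<lambda>w \<rho>. f w (\<lambda>i. \<rho> (Suc i)))" "expressible (\<lambda>w \<rho>. f w (\<lambda>i. \<rho> (Suc (Suc i))))"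
    "expressible (\<lambda>w \<rho>. f w (\<lambda>i. \<rho> (Suc (Suc (Suc i)))))"
  using expressible_rename[OF assms, of Suc] expressible_rename[OF assms, of "\<lambda>i. Suc (Suc i)"]
    expressible_rename[OF assms, of "\<lambda>i. Suc (Suc (Suc i))"] by simp_all

lemma expressible_Suc: "expressible f \<Longrightarrow> expressible (\<lambda>w \<rho>. Suc (f w \<rho>))"
  using expressible_add[OF _ expressible_const[of 1], of f] by simp

text \<open>A product is a sum of equal terms.\<close>

lemma expressible_mult:
  assumes "expressible f" "expressible g"
  shows "expressible (\<lambda>w \<rho>. f w \<rho> * g w \<rho>)"
  using expressible_sum[OF assms(1), of "\<lambda>w \<rho> k. g w \<rho>"] expressible_weaken(1)[OF assms(2)] by simp

lemma decidable_le:
  assumes "expressible f" "expressible g"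
  shows "decidable (\<lambda>w \<rho>. f w \<rho> \<le> g w \<rho>)"
proof -
  have "expressible (\<lambda>w \<rho>. 1 - (f w \<rho> - g w \<rho>))"
    by (intro expressible_diff expressible_const assms)
  moreover have "1 - (x - y) = (of_bool (x \<le> y) :: nat)" for x y :: nat by auto
  ultimately show ?thesis by simp
qed

lemma decidable_not:
  assumes "decidable P"
  shows "decidable (\<lambda>w \<rho>. \<not> P w \<rho>)"
proof -
  have "expressible (\<lambda>w \<rho>. 1 - of_bool (P w \<rho>))"
    by (intro expressible_diff expressible_const assms)
  moreover have "1 - of_bool p = (of_bool (\<not> p) :: nat)" for p by simp
  ultimately show ?thesis by simp
qed

lemma decidable_conj:
  assumes "decidable P" "decidable Q"
  shows "decidable (\<lambda>w \<rho>. P w \<rho> \<and> Q w \<rho>)"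
  using expressible_mult[OF assms] by (simp only: of_bool_conj)

lemma decidable_disj:
  assumes "decidable P" "decidable Q"
  shows "decidable (\<lambda>w \<rho>. P w \<rho> \<or> Q w \<rho>)"
  using decidable_not[OF decidable_conj[OF decidable_not[OF assms(1)] decidable_not[OF assms(2)]]] by simp

lemma decidable_less:
  assumes "expressible f" "expressible g"
  shows "decidable (\<lambda>w \<rho>. f w \<rho> < g w \<rho>)"
  using decidable_le[OF expressible_Suc[OF assms(1)] assms(2)] by (simp only: Suc_le_eq)

lemma decidable_eq:
  assumes "expressible f" "expressible g"
  shows "decidable (\<lambda>w \<rho>. f w \<rho> = g w \<rho>)"
  using decidable_conj[OF decidable_le[OF assms] decidable_le[OF assms(2,1)]] by (simp only: eq_iff)

lemma decidable_ex:
  assumes "expressible f" "decidable (\<lambda>w \<rho>. P w (\<lambda>i. \<rho> (Suc i)) (\<rho> 0))"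
  shows "decidable (\<lambda>w \<rho>. \<exists>k < f w \<rho>. P w \<rho> k)"
proof -
  have "decidable (\<lambda>w \<rho>. 0 < (\<Sum>k<f w \<rho>. of_bool (P w \<rho> k) :: nat))"
    by (intro decidable_less expressible_const expressible_sum assms)
  moreover have "0 < (\<Sum>k<m. of_bool (p k) :: nat) \<longleftrightarrow> (\<exists>k < m. p k)" for m :: nat and p
    by (auto simp: sum_nonneg_eq_0_iff simp flip: neq0_conv)
  ultimately show ?thesis by (simp only:)
qed

text \<open>The disjunction is unrolled into the expression, so the index set may consist of objects
  outside the language, such as sets of numbers.\<close>

lemma decidable_finite_ex:
  assumes "finite I" "\<And>i. i \<in> I \<Longrightarrow> decidable (P i)"
  shows "decidable (\<lambda>w \<rho>. \<exists>i \<in> I. P i w \<rho>)"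
  using assms
proof (induction I rule: finite_induct)
  case empty
  then show ?case using expressible_const[of 0] by simp
next
  case (insert i I)
  have "decidable (\<lambda>w \<rho>. P i w \<rho> \<or> (\<exists>i \<in> I. P i w \<rho>))"
    using insert by (intro decidable_disj) auto
  then show ?case by simp
qed

lemma decidable_mem:
  assumes "finite F" "expressible f"
  shows "decidable (\<lambda>w \<rho>. f w \<rho> \<in> F)"
proof -
  have "decidable (\<lambda>w \<rho>. \<exists>i \<in> F. f w \<rho> = i)"
    using assms by (intro decidable_finite_ex decidable_eq expressible_const)
  then show ?thesis by simp
qed

lemma expressible_if:
  assumes "decidable P" "expressible f" "expressible g"
  shows "expressible (\<lambda>w \<rho>. if P w \<rho> then f w \<rho> else g w \<rho>)"
proof -
  have "expressible (\<lambda>w \<rho>. of_bool (P w \<rho>) * f w \<rho> + of_bool (\<not> P w \<rho>) * g w \<rho>)"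
    by (intro expressible_add expressible_mult decidable_not assms)
  moreover have "of_bool p * x + of_bool (\<not> p) * y = (if p then x else y)" for p and x y :: nat by simp
  ultimately show ?thesis by simp
qed

text \<open>The quotient x div y counts the q with (q + 1)y \<le> x. The case y = 0 is separated, as
  there the count would be x instead of 0.\<close>

lemma expressible_div:
  assumes "expressible f" "expressible g"
  shows "expressible (\<lambda>w \<rho>. f w \<rho> div g w \<rho>)"
proof -
  have "expressible (\<lambda>w \<rho>. if g w \<rho> = 0 then 0 else (\<Sum>q<f w \<rho>. of_bool (Suc q * g w \<rho> \<le> f w \<rho>)))"
    by (intro expressible_if decidable_eq expressible_const expressible_sum decidable_le expressible_mult
        expressible_Suc expressible_var assms assms[THEN expressible_weaken(1)])
  moreover have "(if y = 0 then 0 else (\<Sum>q<x. of_bool (Suc q * y \<le> x))) = x div y" for x y :: nat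
  proof (cases "y = 0")
    case False
    then have "(Suc q * y \<le> x) \<longleftrightarrow> q < x div y" for q
      using less_eq_div_iff_mult_less_eq[of y "Suc q" x] by (simp add: Suc_le_eq)
    then have "(\<Sum>q<x. of_bool (Suc q * y \<le> x)) = (\<Sum>q<x. of_bool (q < x div y) :: nat)" by simp
    also have "\<dots> = card ({..<x} \<inter> {q. q < x div y})" by (simp add: of_bool_def sum.If_cases)
    also have "{..<x} \<inter> {q. q < x div y} = {..<x div y}"
      using div_le_dividend[of x y] by (auto intro: less_le_trans)
    finally show ?thesis using False by simp
  qed simp
  ultimately show ?thesis by simp
qed

lemma expressible_mod:
  assumes "expressible f" "expressible g"
  shows "expressible (\<lambda>w \<rho>. f w \<rho> mod g w \<rho>)"
proof -
  have "expressible (\<lambda>w \<rho>. f w \<rho> - g w \<rho> * (f w \<rho> div g w \<rho>))"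
    by (intro expressible_diff expressible_mult expressible_div assms)
  then show ?thesis by (simp only: minus_mult_div_eq_mod)
qed

lemma expressible_card:
  assumes "expressible f" "decidable (\<lambda>w \<rho>. P w (\<lambda>i. \<rho> (Suc i)) (\<rho> 0))"
  shows "expressible (\<lambda>w \<rho>. card {k. k < f w \<rho> \<and> P w \<rho> k})"
proof -
  have "expressible (\<lambda>w \<rho>. \<Sum>k<f w \<rho>. of_bool (P w \<rho> k))"
    by (intro expressible_sum assms)
  moreover have "(\<Sum>k<m. of_bool (p k) :: nat) = card {k. k < m \<and> p k}" for m :: nat and p
    by (simp add: of_bool_def sum.If_cases Int_def)
  ultimately show ?thesis by simp
qed

lemmas expressible_intros = expressible_var expressible_const expressible_length expressible_sum
  expressible_input expressible_Suc expressible_add expressible_diff expressible_mult expressible_div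
  expressible_mod expressible_if expressible_card decidable_le decidable_less decidable_eq decidable_not
  decidable_conj decidable_disj decidable_ex

lemma polytime_map_expressible:
  assumes "expressible l" "decidable b"
    and "\<And>x. x \<in> D \<Longrightarrow> length (enc_out (f x)) = l (enc_in x) (\<lambda>_. 0)"
    and "\<And>x i. x \<in> D \<Longrightarrow> i < length (enc_out (f x)) \<Longrightarrow> enc_out (f x) ! i \<longleftrightarrow> b (enc_in x) (case_nat i (\<lambda>_. 0))"
  shows "polytime_map enc_in enc_out D f"
proof -
  obtain e1 where e1: "eval w \<rho> e1 = l w \<rho>" for w \<rho> using assms(1) unfolding expressible_def by blast
  obtain e2 where e2: "eval w \<rho> e2 = of_bool (b w \<rho>)" for w \<rho> using assms(2) unfolding expressible_def by blast
  show ?thesis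
    by (rule polytime_map_exprs[of D enc_out f enc_in e1 e2]) (simp_all add: assms(3,4) e1 e2)
qed


subsection \<open>The degree reduction is expressible\<close>

definition word_size :: "bool list \<Rightarrow> nat" where
  "word_size w = (\<Sum>x<length w. of_bool (Suc x * Suc x + Suc x + 1 \<le> length w))"

text \<open>The offset skips the unary prefix and the separator; symbol 2 is a true bit, and beyond
  the word the blank yields false.\<close>

definition word_adj :: "bool list \<Rightarrow> nat \<Rightarrow> bool" where
  "word_adj w t \<longleftrightarrow> word_contents w (int (word_size w + 1 + t)) = 2"

lemma expressible_word_size: "expressible (\<lambda>w \<rho>. word_size w)"
  unfolding word_size_def by (intro expressible_intros)

lemma decidable_word_adj: "expressible f \<Longrightarrow> decidable (\<lambda>w \<rho>. word_adj w (f w \<rho>))"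
  unfolding word_adj_def by (intro expressible_intros expressible_word_size)

lemma expressible_isqrt: "expressible f \<Longrightarrow> expressible (\<lambda>w \<rho>. isqrt (f w \<rho>))"
  unfolding isqrt_def by (rule expressible_sum, assumption) (intro expressible_intros, rule expressible_weaken(1))

lemma expressible_torus_map:
  assumes "expressible f" "expressible g" "expressible h"
  shows "expressible (\<lambda>w \<rho>. torus_map (f w \<rho>) (g w \<rho>) (h w \<rho>))"
  unfolding torus_map_def by (intro expressible_intros assms)

lemma expressible_cluster_map:
  assumes "expressible f" "expressible g" "expressible h"
  shows "expressible (\<lambda>w \<rho>. cluster_map (f w \<rho>) (g w \<rho>) (h w \<rho>))"
  unfolding cluster_map_def
  by (intro expressible_intros expressible_isqrt expressible_torus_map assms)

lemma expressible_cum: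
  assumes "expressible f"
  shows "expressible (\<lambda>w \<rho>. cum (word_adj w) (f w \<rho>))"
  unfolding cum_def by (intro expressible_intros decidable_word_adj assms)

lemma expressible_arc_pos:
  assumes "expressible f"
  shows "expressible (\<lambda>w \<rho>. arc_pos (word_size w) (word_adj w) (f w \<rho>))"
  unfolding arc_pos_def
  by (intro expressible_intros expressible_word_size expressible_cum assms[THEN expressible_weaken(1)])

lemma expressible_arc:
  assumes "expressible f"
  shows "expressible (\<lambda>w \<rho>. arc_tail (word_size w) (word_adj w) (f w \<rho>))"
    and "expressible (\<lambda>w \<rho>. arc_head (word_size w) (word_adj w) (f w \<rho>))"
    and "expressible (\<lambda>w \<rho>. arc_rev (word_size w) (word_adj w) (f w \<rho>))"
    and "expressible (\<lambda>w \<rho>. outdeg (word_size w) (word_adj w) (f w \<rho>))"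
  unfolding arc_rev_def arc_tail_def arc_head_def outdeg_def
  by (intro expressible_intros expressible_word_size expressible_arc_pos expressible_cum assms)+

lemma expressible_point_map:
  assumes "expressible f" "expressible g"
  shows "expressible (\<lambda>w \<rho>. point_map (word_size w) (word_adj w) (f w \<rho>) (g w \<rho>))"
  unfolding point_map_def inner_map_def
  by (intro expressible_intros expressible_word_size expressible_arc expressible_cum expressible_cluster_map assms)

lemma decidable_port_adj:
  assumes "expressible f" "expressible g"
  shows "decidable (\<lambda>w \<rho>. port_adj (point_map (word_size w) (word_adj w)) (f w \<rho>) (g w \<rho>))"
  unfolding port_adj_def port_link_def port_near_def
  by (intro expressible_intros expressible_point_map assms)

lemma decidable_in_tails:
  assumes "finite F" "expressible f"
  shows "decidable (\<lambda>w \<rho>. in_tails (word_size w) (word_adj w) F (f w \<rho>))"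
  unfolding in_tails_def
  by (intro expressible_intros expressible_word_size expressible_cum expressible_arc decidable_mem
      assms assms(2)[THEN expressible_weaken(1)])

lemma expressible_tails:
  assumes "finite F"
  shows "expressible (\<lambda>w \<rho>. tail_volume (word_size w) (word_adj w) F)"
    and "expressible (\<lambda>w \<rho>. tail_crossing (word_size w) (word_adj w) F)"
  unfolding tail_volume_def tail_crossing_def
  by (intro expressible_intros expressible_word_size expressible_cum expressible_arc decidable_in_tails assms)+

text \<open>All quantifiers range over finite sets that depend on \<open>B\<close> only, and
  \<open>Q\<close> is applied to fixed numbers before they are compared with the input. Its values
  are constants of the expression, even though \<open>Q\<close> will contain the real
  parameters.\<close>

definition small_case :: "nat \<Rightarrow> (nat \<Rightarrow> nat \<Rightarrow> nat \<Rightarrow> bool) \<Rightarrow> nat \<Rightarrow> (nat \<Rightarrow> bool) \<Rightarrow> bool" where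
  "small_case B Q n A \<longleftrightarrow> cum A (n * n) < B \<and>
     \<not> (\<exists>F \<in> Pow {..<B}. \<exists>v \<in> {1..B}. \<exists>k \<in> {..B}. \<exists>m \<in> {..B}.
       Q m v k \<and> cum A (n * n) = m \<and> tail_volume n A F = v \<and> tail_crossing n A F = k)"

lemma decidable_small_case: "decidable (\<lambda>w \<rho>. small_case B Q (word_size w) (word_adj w))"
  unfolding small_case_def
  by (intro expressible_intros decidable_finite_ex expressible_word_size expressible_cum expressible_tails)
    (auto intro: finite_subset)

definition reduced_graph :: "nat \<Rightarrow> (nat \<Rightarrow> nat \<Rightarrow> nat \<Rightarrow> bool) \<Rightarrow> nat \<Rightarrow> (nat \<Rightarrow> bool) \<Rightarrow> nat pair_pre_digraph" where
  "reduced_graph B Q n A = (if small_case B Q n A then null_graph else degree_reduction n A)"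

definition reduced_size :: "nat \<Rightarrow> (nat \<Rightarrow> nat \<Rightarrow> nat \<Rightarrow> bool) \<Rightarrow> nat \<Rightarrow> (nat \<Rightarrow> bool) \<Rightarrow> nat" where
  "reduced_size B Q n A = (if small_case B Q n A then 0 else 48 * cum A (n * n))"

lemma pverts_reduced_graph: "pverts (reduced_graph B Q n A) = {..<reduced_size B Q n A}"
  by (simp add: reduced_graph_def reduced_size_def null_graph_def degree_reduction_def)

text \<open>In the small case the size is 0 and the premises fail, so one formula describes the
  matrix in both cases.\<close>

lemma parcs_reduced_graph:
  assumes "i < reduced_size B Q n A" "j < reduced_size B Q n A"
  shows "(i, j) \<in> parcs (reduced_graph B Q n A) \<longleftrightarrow> port_adj (point_map n A) i j"
  using assms by (auto simp: reduced_graph_def reduced_size_def degree_reduction_def split: if_splits)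

lemma expressible_reduced_size: "expressible (\<lambda>w \<rho>. reduced_size B Q (word_size w) (word_adj w))"
  unfolding reduced_size_def
  by (intro expressible_intros decidable_small_case expressible_cum expressible_word_size)

section \<open>Reading and writing the graph encoding\<close>

lemma length_concat_square: "length (concat (map (\<lambda>i. map (f i) [0..<n]) [0..<m])) = m * n"
  by (induction m) simp_all

lemma nth_concat_square:
  assumes "t < m * n"
  shows "concat (map (\<lambda>i. map (f i) [0..<n]) [0..<m]) ! t = f (t div n) (t mod n)"
  using assms
proof (induction m)
  case (Suc m)
  show ?case
  proof (cases "t < m * n")
    case True
    then show ?thesis using Suc.IH by (simp add: nth_append length_concat_square)
  next
    case False
    then have "t - m * n < n" "t = m * n + (t - m * n)" using Suc.prems by auto
    then have "t div n = m" "t mod n = t - m * n"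
      by (metis add.commute div_mult_self3 div_less add_0 less_nat_zero_code neq0_conv,
          metis mod_mult_self3 mod_less)
    then show ?thesis using False \<open>t - m * n < n\<close> by (simp add: nth_append length_concat_square)
  qed
qed simp

lemma length_encode_graph: "length (encode_graph G) = card (pverts G) + 1 + card (pverts G) * card (pverts G)"
  by (simp add: encode_graph_def Let_def length_concat_square)

lemma nth_encode_graph:
  assumes "i < length (encode_graph G)"
  defines "n \<equiv> card (pverts G)"
  shows "encode_graph G ! i \<longleftrightarrow> i < n \<or> (n < i \<and> ((i - n - 1) div n, (i - n - 1) mod n) \<in> parcs G)"
proof -
  have e: "encode_graph G = replicate n True @ [False] @ concat (map (\<lambda>i. map (\<lambda>j. (i, j) \<in> parcs G) [0..<n]) [0..<n])"
    by (simp add: encode_graph_def Let_def n_def)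
  consider "i < n" | "i = n" | t where "i = n + 1 + t" "t < n * n"
    using assms(1) that(3)[of "i - n - 1"] by (fastforce simp: length_encode_graph n_def)
  then show ?thesis
  proof cases
    case 3
    then have "encode_graph G ! i = concat (map (\<lambda>i. map (\<lambda>j. (i, j) \<in> parcs G) [0..<n]) [0..<n]) ! t"
      by (simp add: e nth_append)
    also have "\<dots> = ((t div n, t mod n) \<in> parcs G)" by (rule nth_concat_square[OF 3(2)])
    finally show ?thesis using 3(1) by simp
  qed (simp_all add: e nth_append)
qed

lemma word_size_encode: "word_size (encode_graph G) = card (pverts G)"
proof -
  let ?n = "card (pverts G)"
  have "Suc x * Suc x + Suc x + 1 \<le> length (encode_graph G) \<longleftrightarrow> x < ?n" for x
  proof
    assume "Suc x * Suc x + Suc x + 1 \<le> length (encode_graph G)"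
    then have le: "Suc x * Suc x + Suc x \<le> ?n * ?n + ?n" unfolding length_encode_graph by linarith
    show "x < ?n"
    proof (rule ccontr)
      assume "\<not> x < ?n"
      then have "?n * ?n \<le> Suc x * Suc x" by (intro mult_le_mono) auto
      then show False using le \<open>\<not> x < ?n\<close> by linarith
    qed
  next
    assume x: "x < ?n"
    then have "Suc x * Suc x \<le> ?n * ?n" by (intro mult_le_mono) auto
    then show "Suc x * Suc x + Suc x + 1 \<le> length (encode_graph G)" using x unfolding length_encode_graph by linarith
  qed
  then have "word_size (encode_graph G) = (\<Sum>x<length (encode_graph G). of_bool (x < ?n))"
    unfolding word_size_def by simp
  also have "\<dots> = card ({..<length (encode_graph G)} \<inter> {x. x < ?n})" by (simp add: of_bool_def sum.If_cases)
  also have "{..<length (encode_graph G)} \<inter> {x. x < ?n} = {..<?n}" by (auto simp: length_encode_graph)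
  finally show ?thesis by simp
qed

lemma word_adj_encode:
  assumes "G \<in> input_graphs"
  shows "word_adj (encode_graph G) = adj_bit G"
proof
  fix t
  let ?n = "card (pverts G)"
  interpret input_graph G by (rule input_graph.intro[OF assms])
  show "word_adj (encode_graph G) t = adj_bit G t"
  proof (cases "t < ?n * ?n")
    case True
    then have l: "?n + 1 + t < length (encode_graph G)" by (simp add: length_encode_graph)
    have "word_adj (encode_graph G) t \<longleftrightarrow> encode_graph G ! (?n + 1 + t)"
      unfolding word_adj_def word_size_encode word_contents_def nat_int using l by simp
    also have "\<dots> \<longleftrightarrow> adj_bit G t" unfolding nth_encode_graph[OF l] by (simp add: adj_bit_def)
    finally show ?thesis .
  next
    case False
    then have "\<not> adj_bit G t" using A_less by blast
    moreover have "\<not> ?n + 1 + t < length (encode_graph G)" using False by (simp add: length_encode_graph)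
    then have "\<not> word_adj (encode_graph G) t"
      unfolding word_adj_def word_size_encode word_contents_def of_nat_less_iff by simp
    ultimately show ?thesis by simp
  qed
qed

text \<open>With s vertices in the output, bit i belongs to the unary prefix for i < s, is the
  separator for i = s, and is matrix entry i - s - 1 afterwards; all this is expressible from the
  input word.\<close>

lemma polytime_reduced_graph:
  "polytime_map encode_graph encode_graph input_graphs (\<lambda>G. reduced_graph B Q (card (pverts G)) (adj_bit G))"
proof (rule polytime_map_expressible)
  define s where "s w = reduced_size B Q (word_size w) (word_adj w)" for w
  have s: "expressible (\<lambda>w \<rho>. s w)" unfolding s_def by (rule expressible_reduced_size)
  show "expressible (\<lambda>w \<rho>. s w + 1 + s w * s w)"
    by (intro expressible_intros s)
  show "decidable (\<lambda>w \<rho>. \<rho> 0 < s w \<or> (s w < \<rho> 0 \<and>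
      port_adj (point_map (word_size w) (word_adj w)) ((\<rho> 0 - s w - 1) div s w) ((\<rho> 0 - s w - 1) mod s w)))"
    by (intro expressible_intros decidable_port_adj s)
  fix G assume G: "G \<in> input_graphs"
  let ?H = "reduced_graph B Q (card (pverts G)) (adj_bit G)"
  have sG: "s (encode_graph G) = card (pverts ?H)"
    by (simp add: s_def word_size_encode word_adj_encode[OF G] pverts_reduced_graph)
  show "length (encode_graph ?H) = s (encode_graph G) + 1 + s (encode_graph G) * s (encode_graph G)"
    by (simp add: sG length_encode_graph)
  fix i assume i: "i < length (encode_graph ?H)"
  let ?s = "card (pverts ?H)"
  have "((i - ?s - 1) div ?s, (i - ?s - 1) mod ?s) \<in> parcs ?H \<longleftrightarrow>
      port_adj (point_map (card (pverts G)) (adj_bit G)) ((i - ?s - 1) div ?s) ((i - ?s - 1) mod ?s)" if "?s < i"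
  proof -
    have "i - ?s - 1 < ?s * ?s" using i that unfolding length_encode_graph by linarith
    then have "(i - ?s - 1) div ?s < ?s" "(i - ?s - 1) mod ?s < ?s"
      by (auto simp: less_mult_imp_div_less intro!: mod_less_divisor Nat.gr0I)
    then show ?thesis by (intro parcs_reduced_graph) (simp_all add: pverts_reduced_graph)
  qed
  then show "encode_graph ?H ! i \<longleftrightarrow> case_nat i (\<lambda>_. 0) 0 < s (encode_graph G) \<or> (s (encode_graph G) < case_nat i (\<lambda>_. 0) 0 \<and>
      port_adj (point_map (word_size (encode_graph G)) (word_adj (encode_graph G)))
        ((case_nat i (\<lambda>_. 0) 0 - s (encode_graph G) - 1) div s (encode_graph G))
        ((case_nat i (\<lambda>_. 0) 0 - s (encode_graph G) - 1) mod s (encode_graph G)))"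
    unfolding sG word_size_encode word_adj_encode[OF G] nth_encode_graph[OF i] by auto
qed

text \<open>The positions of true bits form a fixed finite set, membership in which is decided by
  finitely many comparisons.\<close>

lemma polytime_const: "polytime_map enc_in enc_out D (\<lambda>_. y)"
proof (rule polytime_map_expressible)
  show "expressible (\<lambda>w \<rho>. length (enc_out y))" by (rule expressible_const)
  show "decidable (\<lambda>w \<rho>. \<rho> 0 \<in> {i. i < length (enc_out y) \<and> enc_out y ! i})"
    by (intro decidable_mem expressible_var) simp
qed simp_all


section \<open>Correctness of the reduction\<close>

theorem theoremB1:
  shows "\<exists>C::real. C \<ge> 1 \<and>
    (\<forall>\<gamma> \<beta> \<delta> :: real. 0 < \<gamma> \<and> \<gamma> < 1 \<and> 0 < \<beta> \<and> \<beta> < 1 \<and> 0 < \<delta> \<longrightarrow>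
      (\<exists>f. polytime_reduction encode_graph encode_graph
        (SSE input_graphs \<delta> (1 - \<gamma>) (1 - \<beta>))
        (SSE (regular_input_graphs 4) \<delta> (1 - \<gamma>) (1 - \<beta> / C)) f))"
proof (intro exI[of _ 578224128] conjI allI impI)
  fix \<gamma> \<beta> \<delta> :: real
  assume "0 < \<gamma> \<and> \<gamma> < 1 \<and> 0 < \<beta> \<and> \<beta> < 1 \<and> 0 < \<delta>"
  then have \<gamma>: "0 < \<gamma>" and \<beta>: "0 < \<beta>" "\<beta> < 1" and \<delta>: "0 < \<delta>" by auto
  let ?P = "SSE input_graphs \<delta> (1 - \<gamma>) (1 - \<beta>)"
  let ?Q = "SSE (regular_input_graphs 4) \<delta> (1 - \<gamma>) (1 - \<beta> / 578224128)"
  have inst: "instances ?P = input_graphs" "instances ?Q = regular_input_graphs 4"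
    "yes_set ?P \<subseteq> input_graphs" "no_set ?P \<subseteq> input_graphs" "yes_set ?Q \<subseteq> regular_input_graphs 4"
    by (auto simp: SSE_def)
  show "\<exists>f. polytime_reduction encode_graph encode_graph ?P ?Q f"
  proof (cases "\<delta> < 1 \<and> \<beta> < \<gamma>")
    case True
    then obtain Z where "Z \<in> yes_set ?Q" "Z \<in> no_set ?Q"
      using compatible_promises[of \<beta> \<gamma> \<delta>] \<beta> \<delta> by blast
    then have "polytime_reduction encode_graph encode_graph ?P ?Q (\<lambda>_. Z)"
      unfolding polytime_reduction_def inst using polytime_const[of encode_graph encode_graph input_graphs Z] inst(5) by auto
    then show ?thesis by blast
  next
    case False
    have disj: "G \<notin> yes_set ?P" if no_G: "G \<in> no_set ?P" for G
    proof
      assume "G \<in> yes_set ?P"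
      then obtain S where S: "S \<in> expansion_sets G" "real (vol G S) \<le> \<delta> * real (vol G (pverts G))"
        "expansion G S < \<gamma>" by (auto simp: SSE_def)
      interpret input_graph G using no_G inst(4) by (intro input_graph.intro) blast
      have no: "\<beta> \<le> expansion G T" if "T \<in> expansion_sets G" "real (vol G T) \<le> \<delta> * real (vol G (pverts G))" for T
        using no_G that by (auto simp: SSE_def)
      \<comment> \<open>A graph meeting both promises forces \<beta> < \<gamma>, so here \<delta>
        \<ge> 1. Then the NO promise covers the full vertex set, whose expansion is 0.\<close>
      have "\<beta> < \<gamma>" using no[OF S(1,2)] S(3) by simp
      then have \<delta>1: "1 \<le> \<delta>" using False by simp
      have SV: "S \<subseteq> pverts G" "vol G S > 0" using S(1) by (auto simp: expansion_sets_def)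
      have pos: "vol G (pverts G) > 0" using vol_disjoint[OF SV(1)] SV(2) by simp
      then have "pverts G \<in> expansion_sets G" by (auto simp: expansion_sets_def vol_def)
      moreover have "1 * real (vol G (pverts G)) \<le> \<delta> * real (vol G (pverts G))"
        using \<delta>1 by (intro mult_right_mono) auto
      ultimately have "\<beta> \<le> expansion G (pverts G)" by (intro no) auto
      then show False using \<beta> by (simp add: expansion_def crossing_def)
    qed
    define B where "B = nat \<lceil>512 / (\<beta>\<^sup>2 * \<delta>)\<rceil>"
    define Q where "Q m v k \<longleftrightarrow> \<delta> * real m / 2 \<le> real v \<and> real v \<le> \<delta> * real m \<and> real k / real v < 1 - (1 - \<gamma>)" for m v k :: nat
    define f where "f G = reduced_graph B Q (card (pverts G)) (adj_bit G)" for G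
    have f_cases: "(f G = null_graph \<and> G \<notin> yes_set ?P) \<or>
        (f G = adjacency.cluster_graph (card (pverts G)) (adj_bit G) \<and> (G \<in> yes_set ?P \<or> 512 / (\<beta>\<^sup>2 * \<delta>) \<le> real (cum (adj_bit G) (card (pverts G) * card (pverts G)))))"
      if G: "G \<in> input_graphs" for G
    proof -
      interpret input_graph G by (rule input_graph.intro[OF G])
      have yes: "small_case B Q n A \<longleftrightarrow> N < B \<and> G \<notin> yes_set ?P"
        using yes_iff_arc_set[of B \<delta> "1 - \<gamma>" "1 - \<beta>"] unfolding small_case_def Q_def by (cases "N < B") auto
      have "512 / (\<beta>\<^sup>2 * \<delta>) \<le> real N" if "\<not> N < B" using that unfolding B_def by linarith
      then show ?thesis unfolding f_def reduced_graph_def degree_reduction_conv yes by auto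
    qed
    have reg: "f G \<in> regular_input_graphs 4" if "G \<in> input_graphs" for G
      using f_cases[OF that] null_graph_regular input_graph.degree_reduction_regular[OF input_graph.intro[OF that]] by metis
    have "f G \<in> yes_set ?Q" if "G \<in> yes_set ?P" for G
    proof -
      have G: "G \<in> input_graphs" using that inst(3) by blast
      then show ?thesis
        using f_cases[OF G] that input_graph.degree_reduction_yes[OF input_graph.intro[OF G] that] by metis
    qed
    moreover have "f G \<in> no_set ?Q" if "G \<in> no_set ?P" for G
    proof -
      have G: "G \<in> input_graphs" using that inst(4) by blast
      from f_cases[OF G] show ?thesis
      proof (elim disjE conjE)
        assume "f G = null_graph"
        then show ?thesis using null_graph_no by simp
      qed (use disj[OF that] input_graph.degree_reduction_no[OF input_graph.intro[OF G] \<beta> \<delta> that] in auto)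
    qed
    ultimately have "polytime_reduction encode_graph encode_graph ?P ?Q f"
      unfolding polytime_reduction_def inst using polytime_reduced_graph[of B Q] reg unfolding f_def by blast
    then show ?thesis by blast
  qed
qed simp

end
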